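(* Let $\alpha>-1$. For $z,w\in\mathbb{D}$ with $z\neq w$ set $$G_\alpha(z,w)=(1-\overline{z}w)^\alpha\, h(g(z,w)),$$ where $$h(s)=\int_0^s\frac{t^\alpha}{1-t}\,dt=\sum_{n=0}^\infty\frac{s^{\alpha+1+n}}{\alpha+1+n},\quad 0\le s<1,$$ $$g(z,w)=1-\left|\frac{z-w}{1-\overline{z}w}\right|^2=\frac{(1-|z|^2)(1-|w|^2)}{|1-z\overline{w}|^2},$$ and $(1-\overline{z}w)^\alpha$ is taken with the principal branch. Then $G_\alpha$ is the Green's function for the operator $L_\alpha=-\overline{\partial}_z(1-|z|^2)^{-\alpha}\partial_z$ in $\mathbb{D}$. That is, $G_\alpha$ is the unique function on $\mathbb{D}\times\mathbb{D}$ (values on the diagonal being irrelevant, and uniqueness meaning that for each $w$ the function of $z$ is determined almost everywhere) such that, for each fixed $w\in\mathbb{D}$, the function $G_\alpha(\cdot,w)$ is in $L^1_{loc}(\mathbb{D})$ and: (1) $L_\alpha G_\alpha(\cdot,w)=\delta_0(z-w)$ in the sense of distributions on $\mathbb{D}$; (2) $G_\alpha(z,w)\to0$ when $z\to\zeta$, for every $\zeta\in\partial\mathbb{D}$; (3) $G_\alpha(z,w)=\overline{G_\alpha(w,z)}$ for all $z\in\mathbb{D}$, $z\ne w$.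
   Context: $\mathbb{D}$ is the open unit disc in $\mathbb{C}$. $\partial_z=\frac12(\partial_x-i\partial_y)$ and $\overline{\partial}_z=\frac12(\partial_x+i\partial_y)$, with $z=x+iy$, are the Wirtinger derivatives. The area measure is normalized as $dA=\frac1\pi\,dx\,dy$. A function $u\in L^1_{loc}(\mathbb{D})$ is identified with the distribution $\langle u,\phi\rangle=\int_{\mathbb{D}}u\,\phi\,dA$, $\phi\in C_0^\infty(\mathbb{D})$ (complex-valued test functions). The operator $L_\alpha$ acts on distributions on $\mathbb{D}$ by $\langle L_\alpha u,\phi\rangle=\langle u,\overline{L_\alpha}\phi\rangle$, where $\overline{L_\alpha}=-\partial_z(1-|z|^2)^{-\alpha}\overline{\partial}_z$. $\delta_0(z-w)$ is the Dirac delta at $w$ with respect to $z$: $\langle\delta_0(z-w),\phi\rangle=\phi(w)$. The principal branch of $\zeta^\alpha$ for $\operatorname{Re}\zeta>0$ is the one that is real (positive) for real $\zeta>0$. *)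

theory Defs
  imports "HOL-Analysis.Analysis"
begin

abbreviation unit_disc :: "complex set" (\<open>\<D>\<close>) where
  "\<D> \<equiv> ball 0 1"

text \<open>Differentiability in the real sense: \<^term>\<open>frechet_derivative\<close> is the real Frechet derivative on
  the real vector space \<^typ>\<open>complex\<close>, so its values at \<open>1\<close> and at \<open>\<i>\<close> are
  the partial derivatives with respect to \<open>x\<close> and \<open>y\<close>.\<close>

definition wirt_d :: "(complex \<Rightarrow> complex) \<Rightarrow> complex \<Rightarrow> complex" where
  "wirt_d f z = (frechet_derivative f (at z) 1 - \<i> * frechet_derivative f (at z) \<i>) / 2"

definition wirt_dbar :: "(complex \<Rightarrow> complex) \<Rightarrow> complex \<Rightarrow> complex" where
  "wirt_dbar f z = (frechet_derivative f (at z) 1 + \<i> * frechet_derivative f (at z) \<i>) / 2"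

primrec Ck :: "nat \<Rightarrow> (complex \<Rightarrow> complex) \<Rightarrow> bool" where
  "Ck 0 f \<longleftrightarrow> continuous_on UNIV f"
| "Ck (Suc k) f \<longleftrightarrow> (\<forall>z. f differentiable (at z)) \<and>
     Ck k (\<lambda>z. frechet_derivative f (at z) 1) \<and>
     Ck k (\<lambda>z. frechet_derivative f (at z) \<i>)"

text \<open>Elements of \<open>C\<^sub>0\<^sup>\<infinity>(\<D>)\<close>, extended by zero to the whole plane.\<close>

definition test_fun :: "(complex \<Rightarrow> complex) set" where
  "test_fun = {\<phi>. (\<forall>k. Ck k \<phi>) \<and>
     compact (closure {z. \<phi> z \<noteq> 0}) \<and> closure {z. \<phi> z \<noteq> 0} \<subseteq> \<D>}"

definition L1_loc :: "(complex \<Rightarrow> complex) set" where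
  "L1_loc = {u. \<forall>K. compact K \<and> K \<subseteq> \<D> \<longrightarrow> u absolutely_integrable_on K}"

text \<open>Distributions on \<open>\<D>\<close> are represented by functionals on functions, of which only the values
  on \<^const>\<open>test_fun\<close> matter. The factor \<open>1 / pi\<close> is the normalization of area measure.\<close>

type_synonym functional = "(complex \<Rightarrow> complex) \<Rightarrow> complex"

definition distr_of :: "(complex \<Rightarrow> complex) \<Rightarrow> functional" where
  "distr_of u \<phi> = complex_of_real (1 / pi) * (LINT z:\<D>|lebesgue. u z * \<phi> z)"

definition dirac :: "complex \<Rightarrow> functional" where
  "dirac w \<phi> = \<phi> w"

definition distr_eq :: "functional \<Rightarrow> functional \<Rightarrow> bool" where
  "distr_eq S T \<longleftrightarrow> (\<forall>\<phi>\<in>test_fun. S \<phi> = T \<phi>)"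

definition L_bar :: "real \<Rightarrow> (complex \<Rightarrow> complex) \<Rightarrow> complex \<Rightarrow> complex" where
  "L_bar \<alpha> \<phi> z =
     - wirt_d (\<lambda>\<zeta>. complex_of_real ((1 - (norm \<zeta>)\<^sup>2) powr (- \<alpha>)) * wirt_dbar \<phi> \<zeta>) z"

definition L_op :: "real \<Rightarrow> functional \<Rightarrow> functional" where
  "L_op \<alpha> T \<phi> = T (L_bar \<alpha> \<phi>)"

definition h_fun :: "real \<Rightarrow> real \<Rightarrow> real" where
  "h_fun \<alpha> s = (LINT t:{0..s}|lborel. t powr \<alpha> / (1 - t))"

definition g_fun :: "complex \<Rightarrow> complex \<Rightarrow> real" where
  "g_fun z w = 1 - (norm ((z - w) / (1 - cnj z * w)))\<^sup>2"

text \<open>The complex \<open>powr\<close> is the principal branch. The value for \<open>z = w\<close> is irrelevant.\<close>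

definition G_fun :: "real \<Rightarrow> complex \<Rightarrow> complex \<Rightarrow> complex" where
  "G_fun \<alpha> z w =
     (1 - cnj z * w) powr complex_of_real \<alpha> * complex_of_real (h_fun \<alpha> (g_fun z w))"

text \<open>No condition below depends on the values of \<open>G\<close> on the diagonal or outside \<open>\<D> \<times> \<D>\<close>.\<close>

definition is_Green_function :: "real \<Rightarrow> (complex \<Rightarrow> complex \<Rightarrow> complex) \<Rightarrow> bool" where
  "is_Green_function \<alpha> G \<longleftrightarrow>
     (\<forall>w\<in>\<D>. (\<lambda>z. G z w) \<in> L1_loc \<and>
        distr_eq (L_op \<alpha> (distr_of (\<lambda>z. G z w))) (dirac w) \<and>
        (\<forall>\<zeta>\<in>sphere 0 1. ((\<lambda>z. G z w) \<longlongrightarrow> 0) (at \<zeta> within \<D>))) \<and>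
     (\<forall>w\<in>\<D>. \<forall>z\<in>\<D>. z \<noteq> w \<longrightarrow> G z w = cnj (G w z))"

end

theory Submission
  imports Defs
begin

text \<open>
  Existence. With \<open>a z = (1 - \<bar>z\<bar>\<^sup>2) powr - \<alpha>\<close> one computes, off the diagonal,
  \<open>a \<partial>G = - k z / (z - w)\<close> where \<open>k z = ((1 - \<bar>w\<bar>\<^sup>2) / (1 - z cnj w)) powr (\<alpha> + 1)\<close> is holomorphic and
  \<open>k w = 1\<close>. Since \<open>G\<close> is only logarithmically singular, integration by parts produces no term at \<open>w\<close>,
  and what remains is the Cauchy-Pompeiu formula for \<open>k \<phi>\<close>.

  Uniqueness. Let \<open>u\<close> be the difference of two Green functions for the same \<open>w\<close>. Up to a smooth cutoff near
  the circle, \<open>(1 - \<bar>z\<bar>\<^sup>2) powr (\<alpha> + 1) z^m (cnj z)^n\<close> is an admissible test function; because \<open>u\<close> vanishes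
  at the boundary, the cutoff costs nothing in the limit and the moments
  \<open>I(m, n)\<close>, the integrals of \<open>u z^m (cnj z)^n\<close>, satisfy
  \<open>n m I(m - 1, n - 1) = (m + 1) (n + \<alpha> + 1) I(m, n)\<close>. Hence they all vanish, and \<open>u = 0\<close> almost everywhere by
  the Stone-Weierstrass theorem.
\<close>

section \<open>Wirtinger derivatives and integration along lines\<close>

text \<open>Integration by parts is done line by line: an integrable Wirtinger derivative of a
  compactly supported function has integral zero by the fundamental theorem of calculus on almost
  every horizontal and vertical line, and the two lines through the singularity form a null set.
  Hence nothing finer than a bound of order 1/|z - w| for the kernel and its first derivatives is
  required, and the logarithm in h may be replaced by the cruder power (1 - s)^(-1/2).

  For uniqueness, the exponent \<alpha> + 1 is the one for which the weight (1 - |z|^2)^(-\<alpha>)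
  cancels: where the cutoff equals 1, the adjoint operator turns the test function into a
  polynomial, so its integrals against u are moments. With a cutoff layer of width e, the term with
  the unbounded cutoff derivatives is of size 1/e on an annulus of area of order e. Its integral is
  therefore merely bounded, and it is the boundary condition on u that makes it small. That
  condition is pointwise on the circle; compactness makes it uniform.\<close>

definition has_wirt :: "(complex \<Rightarrow> complex) \<Rightarrow> complex \<Rightarrow> complex \<Rightarrow> complex \<Rightarrow> bool" where
  "has_wirt f A B z \<longleftrightarrow> (f has_derivative (\<lambda>v. A * v + B * cnj v)) (at z)"

lemma frechet_has_wirt: "has_wirt f A B z \<Longrightarrow> frechet_derivative f (at z) v = A * v + B * cnj v"
  unfolding has_wirt_def by (drule frechet_derivative_at) (simp add: fun_eq_iff)

lemma wirt_d_eq: "has_wirt f A B z \<Longrightarrow> wirt_d f z = A"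
  and wirt_dbar_eq: "has_wirt f A B z \<Longrightarrow> wirt_dbar f z = B"
  by (simp_all add: frechet_has_wirt wirt_d_def wirt_dbar_def complex_eq_iff)

lemma has_wirt_frechet:
  assumes "f differentiable (at z)"
  shows "has_wirt f (wirt_d f z) (wirt_dbar f z) z"
proof -
  define D where "D = frechet_derivative f (at z)"
  have D: "(f has_derivative D) (at z)"
    using assms frechet_derivative_works D_def by blast
  interpret D: bounded_linear D using D by (rule has_derivative_bounded_linear)
  have "D v = wirt_d f z * v + wirt_dbar f z * cnj v" for v
  proof -
    have "v = Re v *\<^sub>R 1 + Im v *\<^sub>R \<i>" by (simp add: complex_eq_iff)
    then have "D v = Re v *\<^sub>R D 1 + Im v *\<^sub>R D \<i>"
      by (metis D.add D.scaleR)
    then show ?thesis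
      by (simp add: wirt_d_def wirt_dbar_def D_def[symmetric] complex_eq_iff field_simps)
  qed
  then have "D = (\<lambda>v. wirt_d f z * v + wirt_dbar f z * cnj v)" by auto
  then show ?thesis using D by (simp add: has_wirt_def)
qed

lemma has_wirt_isCont: "has_wirt f A B z \<Longrightarrow> isCont f z"
  unfolding has_wirt_def by (rule has_derivative_continuous)

lemma has_wirt_differentiable: "has_wirt f A B z \<Longrightarrow> f differentiable (at z)"
  unfolding has_wirt_def by (auto simp: differentiable_def)

lemma has_wirt_cong: "has_wirt f A B z \<Longrightarrow> A = A' \<Longrightarrow> B = B' \<Longrightarrow> has_wirt f A' B' z"
  by simp

lemma has_wirt_const: "has_wirt (\<lambda>_. c) 0 0 z"
  by (simp add: has_wirt_def)

lemma has_wirt_add: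
  "has_wirt f A B z \<Longrightarrow> has_wirt g C D z \<Longrightarrow> has_wirt (\<lambda>x. f x + g x) (A + C) (B + D) z"
  unfolding has_wirt_def by (erule (1) has_derivative_eq_rhs[OF has_derivative_add]) (simp add: algebra_simps)

lemma has_wirt_diff:
  "has_wirt f A B z \<Longrightarrow> has_wirt g C D z \<Longrightarrow> has_wirt (\<lambda>x. f x - g x) (A - C) (B - D) z"
  unfolding has_wirt_def by (erule (1) has_derivative_eq_rhs[OF has_derivative_diff]) (simp add: algebra_simps)

lemma has_wirt_mult:
  "has_wirt f A B z \<Longrightarrow> has_wirt g C D z \<Longrightarrow>
    has_wirt (\<lambda>x. f x * g x) (A * g z + f z * C) (B * g z + f z * D) z"
  unfolding has_wirt_def by (erule (1) has_derivative_eq_rhs[OF has_derivative_mult]) (simp add: algebra_simps)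

lemma has_wirt_cmult: "has_wirt f A B z \<Longrightarrow> has_wirt (\<lambda>x. c * f x) (c * A) (c * B) z"
  using has_wirt_mult[OF has_wirt_const[of c z]] by fastforce

lemma has_wirt_field_derivative:
  "(f has_field_derivative A) (at z) \<Longrightarrow> has_wirt f A 0 z"
  by (simp add: has_wirt_def has_field_derivative_def)

lemma has_wirt_cnj: "has_wirt f A B z \<Longrightarrow> has_wirt (\<lambda>x. cnj (f x)) (cnj B) (cnj A) z"
  unfolding has_wirt_def
  by (erule has_derivative_eq_rhs[OF bounded_linear.has_derivative[OF bounded_linear_cnj]])
     (simp add: algebra_simps)

text \<open>Uniqueness of the derivative forces \<open>A * v + B * cnj v\<close> to be real, hence
  equal to its real part. This lets the real chain rule be read back as multiplication of both
  Wirtinger coefficients by \<open>d\<close>.\<close>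

lemma has_wirt_comp_real:
  assumes "has_wirt (\<lambda>x. of_real (f x)) A B z" "(h has_real_derivative d) (at (f z))"
  shows "has_wirt (\<lambda>x. of_real (h (f x))) (of_real d * A) (of_real d * B) z"
proof -
  have "((\<lambda>x. Re (of_real (f x))) has_derivative (\<lambda>v. Re (A * v + B * cnj v))) (at z)"
    using assms(1) unfolding has_wirt_def by (rule has_derivative_Re)
  then have f: "(f has_derivative (\<lambda>v. Re (A * v + B * cnj v))) (at z)" by simp
  have "((\<lambda>x. of_real (f x)) has_derivative (\<lambda>v. complex_of_real (Re (A * v + B * cnj v)))) (at z)"
    by (rule has_derivative_of_real[OF f])
  then have "(\<lambda>v. complex_of_real (Re (A * v + B * cnj v))) = (\<lambda>v. A * v + B * cnj v)"
    using assms(1) unfolding has_wirt_def by (rule has_derivative_unique)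
  then have eq: "of_real (Re (A * v + B * cnj v)) = A * v + B * cnj v" for v
    by meson
  have "((h \<circ> f) has_derivative ((*) d \<circ> (\<lambda>v. Re (A * v + B * cnj v)))) (at z)"
    using assms(2) by (intro diff_chain_at f) (simp add: has_field_derivative_def)
  then have "((\<lambda>x. of_real (h (f x))) has_derivative
      (\<lambda>v. complex_of_real (d * Re (A * v + B * cnj v)))) (at z)"
    by (intro has_derivative_of_real) (simp add: o_def)
  then show ?thesis
    unfolding has_wirt_def of_real_mult eq by (simp add: algebra_simps)
qed

lemma has_wirt_transform:
  assumes "has_wirt f A B z" "open S" "z \<in> S" "\<And>x. x \<in> S \<Longrightarrow> f x = g x"
  shows "has_wirt g A B z"
  using assms has_derivative_transform_within_open[of f _ z UNIV S g]
  unfolding has_wirt_def by auto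

lemma has_wirt_zero_off_closed:
  assumes "closed S" "z \<notin> S" "\<And>x. x \<notin> S \<Longrightarrow> g x = 0"
  shows "has_wirt g 0 0 z"
  by (rule has_wirt_transform[OF has_wirt_const[of 0], of "- S"]) (use assms in auto)

lemma has_wirt_norm_squared: "has_wirt (\<lambda>z. of_real (1 - (norm z)\<^sup>2)) (- cnj z) (- z) z"
proof -
  have id: "has_wirt (\<lambda>z. z) 1 0 z"
    by (rule has_wirt_field_derivative) (rule DERIV_ident)
  have "has_wirt (\<lambda>z. 1 - z * cnj z) (- cnj z) (- z) z"
    by (rule has_wirt_cong[OF has_wirt_diff[OF has_wirt_const has_wirt_mult[OF id has_wirt_cnj[OF id]]]])
       auto
  then show ?thesis
    by (simp only: of_real_diff of_real_1 complex_norm_square)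
qed

section \<open>Restriction to horizontal and vertical lines, and Fubini in the plane\<close>

lemma vector_derivative_Re_line:
  assumes "has_wirt F A B (Complex x y)"
  shows "((\<lambda>x. F (Complex x y)) has_vector_derivative A + B) (at x)"
proof -
  have "((\<lambda>x. Complex x y) has_derivative (\<lambda>h. of_real h)) (at x)"
    unfolding Complex_eq by (auto intro!: derivative_eq_intros)
  from has_derivative_compose[OF this assms[unfolded has_wirt_def]]
  show ?thesis
    by (simp add: has_vector_derivative_def scaleR_conv_of_real algebra_simps)
qed

lemma vector_derivative_Im_line:
  assumes "has_wirt F A B (Complex y x)"
  shows "((\<lambda>x. F (Complex y x)) has_vector_derivative \<i> * (A - B)) (at x)"
proof -
  have "((\<lambda>x. Complex y x) has_derivative (\<lambda>h. \<i> * of_real h)) (at x)"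
    unfolding Complex_eq by (auto intro!: derivative_eq_intros)
  from has_derivative_compose[OF this assms[unfolded has_wirt_def]]
  show ?thesis
    by (simp add: has_vector_derivative_def scaleR_conv_of_real algebra_simps)
qed

lemma Complex_measurable [measurable]:
  "(\<lambda>(x, y). Complex x y) \<in> borel_measurable (lborel \<Otimes>\<^sub>M lborel)"
  unfolding Complex_eq by measurable

text \<open>Lebesgue measure is determined by its values on boxes, and a complex box pulls back to a
  product of intervals. This brings Fubini's theorem to the type of complex numbers.\<close>

lemma lborel_Complex: "lborel = distr (lborel \<Otimes>\<^sub>M lborel) borel (\<lambda>(x, y). Complex x y)"
proof (rule lborel_eqI)
  fix l u :: complex
  assume le: "\<And>b. b \<in> Basis \<Longrightarrow> l \<bullet> b \<le> u \<bullet> b"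
  have "Re l \<le> Re u" "Im l \<le> Im u"
    using le[of 1] le[of \<i>] by (auto simp: Basis_complex_def)
  have "(\<lambda>(x, y). Complex x y) -` box l u = {Re l<..<Re u} \<times> {Im l<..<Im u}"
    by (auto simp: box_def Basis_complex_def)
  then have "emeasure (distr (lborel \<Otimes>\<^sub>M lborel) borel (\<lambda>(x, y). Complex x y)) (box l u)
      = emeasure (lborel \<Otimes>\<^sub>M lborel) ({Re l<..<Re u} \<times> {Im l<..<Im u})"
    by (subst emeasure_distr) (auto simp: space_pair_measure)
  also have "\<dots> = ennreal (Re u - Re l) * ennreal (Im u - Im l)"
    using \<open>Re l \<le> Re u\<close> \<open>Im l \<le> Im u\<close>
    by (subst lborel.emeasure_pair_measure_Times) simp_all
  also have "\<dots> = (\<Prod>b\<in>Basis. (u - l) \<bullet> b)"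
    using \<open>Re l \<le> Re u\<close> \<open>Im l \<le> Im u\<close>
    by (simp add: Basis_complex_def flip: ennreal_mult)
  finally show "emeasure (distr (lborel \<Otimes>\<^sub>M lborel) borel (\<lambda>(x, y). Complex x y)) (box l u)
      = (\<Prod>b\<in>Basis. (u - l) \<bullet> b)" .
qed simp

text \<open>With the coordinates exchanged, a lemma that integrates in the first coordinate also
  serves for vertical lines.\<close>

lemma lborel_Complex_swap: "lborel = distr (lborel \<Otimes>\<^sub>M lborel) borel (\<lambda>(x, y). Complex y x)"
proof -
  have "lborel = distr (distr (lborel \<Otimes>\<^sub>M lborel) (lborel \<Otimes>\<^sub>M lborel) (\<lambda>(x, y). (y, x)))
      borel (\<lambda>(x, y). Complex x y)"
    unfolding lborel_pair.distr_pair_swap[symmetric] by (rule lborel_Complex)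
  also have "\<dots> = distr (lborel \<Otimes>\<^sub>M lborel) borel (\<lambda>(x, y). Complex y x)"
    by (subst distr_distr) (auto simp: o_def case_prod_unfold intro!: distr_cong)
  finally show ?thesis .
qed

text \<open>Almost every slice of \<open>f'\<close> is integrable, and the single bad line
  \<open>y = b\<close> is null. On any other such line the fundamental theorem of calculus, which
  tolerates finitely many exceptional points of a continuous function, gives a difference of two
  boundary values, both 0.\<close>

lemma integral_zero_by_lines:
  fixes f f' :: "real \<times> real \<Rightarrow> complex"
  assumes int: "integrable (lborel \<Otimes>\<^sub>M lborel) f'"
    and fin: "\<And>y. y \<noteq> b \<Longrightarrow> finite (S y)"
    and deriv: "\<And>x y. y \<noteq> b \<Longrightarrow> x \<notin> S y \<Longrightarrow>
      ((\<lambda>x. f (x, y)) has_vector_derivative f' (x, y)) (at x)"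
    and cont: "\<And>y. y \<noteq> b \<Longrightarrow> continuous_on UNIV (\<lambda>x. f (x, y))"
    and supp: "\<And>x y. \<bar>x\<bar> \<ge> R \<Longrightarrow> f (x, y) = 0" "\<And>x y. \<bar>x\<bar> \<ge> R \<Longrightarrow> f' (x, y) = 0"
  shows "(\<integral>p. f' p \<partial>(lborel \<Otimes>\<^sub>M lborel)) = 0"
proof -
  have int': "integrable (lborel \<Otimes>\<^sub>M lborel) (case_prod (\<lambda>x y. f' (x, y)))"
    using int by simp
  have slice: "(\<integral>x. f' (x, y) \<partial>lborel) = 0"
    if y: "y \<noteq> b" and i: "integrable lborel (\<lambda>x. f' (x, y))" for y
  proof -
    \<comment> \<open>The maximum keeps the interval nonempty and its endpoints in the region where
      \<open>f\<close> vanishes, whatever the sign of \<open>R\<close>.\<close>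
    define r where "r = max R 0"
    have "((\<lambda>x. f' (x, y)) has_integral (f (r, y) - f (- r, y))) {- r..r}"
      by (rule fundamental_theorem_of_calculus_strong[OF fin[OF y]])
         (use deriv[OF y] cont[OF y] in \<open>auto simp: r_def intro: continuous_on_subset\<close>)
    moreover have "f (r, y) = 0" "f (- r, y) = 0"
      by (auto intro!: supp simp: r_def)
    ultimately have "((\<lambda>x. f' (x, y)) has_integral 0) {- r..r}" by simp
    then have "((\<lambda>x. f' (x, y)) has_integral 0) UNIV"
      by (rule has_integral_on_superset) (auto intro!: supp simp: r_def)
    with has_integral_integral_lborel[OF i] show ?thesis
      using has_integral_unique by blast
  qed
  have "AE y in lborel. (\<integral>x. f' (x, y) \<partial>lborel) = 0"
    using lborel_pair.AE_integrable_snd[OF int'] AE_lborel_singleton[of b]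
    by eventually_elim (use slice in auto)
  then have "(\<integral>y. (\<integral>x. f' (x, y) \<partial>lborel) \<partial>lborel) = (\<integral>y. 0 \<partial>(lborel :: real measure))"
    using lborel_pair.integrable_snd[OF int'] by (intro integral_cong_AE) auto
  then show ?thesis
    using lborel_pair.integral_snd[OF int'] by simp
qed

text \<open>Horizontal lines give the integral of \<open>A + B\<close>, vertical ones that of
  \<open>A - B\<close>; both vanish. Differentiability may fail on \<open>E\<close>, which each line
  meets in finitely many points. Continuity may fail only at \<open>w\<close>, which spoils one line
  in each direction.\<close>

lemma integral_wirt_zero:
  assumes int: "integrable lborel A" "integrable lborel B"
    and wirt: "\<And>z. z \<notin> E \<Longrightarrow> has_wirt F (A z) (B z) z"
    and fin: "\<And>y. finite {x. Complex x y \<in> E}" "\<And>x. finite {y. Complex x y \<in> E}"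
    and cont: "\<And>z. z \<noteq> w \<Longrightarrow> isCont F z"
    and supp: "\<And>z. norm z \<ge> R \<Longrightarrow> F z = 0 \<and> A z = 0 \<and> B z = 0"
  shows "(\<integral>z. A z \<partial>lborel) = 0" "(\<integral>z. B z \<partial>lborel) = 0"
proof -
  have [measurable]: "A \<in> borel_measurable borel" "B \<in> borel_measurable borel"
    using int by (auto dest: borel_measurable_integrable)
  have normRe: "\<bar>x\<bar> \<le> norm (Complex x y)" for x y
    using abs_Re_le_cmod[of "Complex x y"] by simp
  have normIm: "\<bar>x\<bar> \<le> norm (Complex y x)" for x y
    using abs_Im_le_cmod[of "Complex y x"] by simp
  have supp_Re: "F (Complex x y) = 0" "A (Complex x y) = 0" "B (Complex x y) = 0" if "\<bar>x\<bar> \<ge> R" for x y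
    using supp[of "Complex x y"] normRe[of x y] that by auto
  have supp_Im: "F (Complex y x) = 0" "A (Complex y x) = 0" "B (Complex y x) = 0" if "\<bar>x\<bar> \<ge> R" for x y
    using supp[of "Complex y x"] normIm[of x y] that by auto
  have c1: "isCont (\<lambda>x. Complex x y) x" for x y
    unfolding Complex_eq by (intro continuous_intros)
  have c2: "isCont (\<lambda>x. Complex y x) x" for x y
    unfolding Complex_eq by (intro continuous_intros)
  have M2 [measurable]: "(\<lambda>(x, y). Complex y x) \<in> borel_measurable (lborel \<Otimes>\<^sub>M lborel)"
    unfolding Complex_eq by measurable
  have "(\<integral>p. (case p of (x, y) \<Rightarrow> A (Complex x y) + B (Complex x y)) \<partial>(lborel \<Otimes>\<^sub>M lborel)) = 0"
  proof (rule integral_zero_by_lines[where f = "\<lambda>(x, y). F (Complex x y)" and b = "Im w"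
        and S = "\<lambda>y. {x. Complex x y \<in> E}" and R = R])
    have "integrable (distr (lborel \<Otimes>\<^sub>M lborel) borel (\<lambda>(x, y). Complex x y)) (\<lambda>z. A z + B z)"
      using int lborel_Complex by simp
    then show "integrable (lborel \<Otimes>\<^sub>M lborel) (\<lambda>(x, y). A (Complex x y) + B (Complex x y))"
      by (subst (asm) integrable_distr_eq) (auto simp: case_prod_unfold)
    show "continuous_on UNIV (\<lambda>x. case (x, y) of (x, y) \<Rightarrow> F (Complex x y))" if "y \<noteq> Im w" for y
      using that by (auto intro!: continuous_at_imp_continuous_on isCont_o2[OF c1] cont)
  qed (use fin supp_Re wirt vector_derivative_Re_line in auto)
  then have 1: "(\<integral>z. A z + B z \<partial>lborel) = 0"
    by (subst lborel_Complex, subst integral_distr) (auto simp: case_prod_unfold)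
  have "(\<integral>p. (case p of (x, y) \<Rightarrow> \<i> * (A (Complex y x) - B (Complex y x))) \<partial>(lborel \<Otimes>\<^sub>M lborel)) = 0"
  proof (rule integral_zero_by_lines[where f = "\<lambda>(x, y). F (Complex y x)" and b = "Re w"
        and S = "\<lambda>y. {x. Complex y x \<in> E}" and R = R])
    have "integrable (distr (lborel \<Otimes>\<^sub>M lborel) borel (\<lambda>(x, y). Complex y x)) (\<lambda>z. \<i> * (A z - B z))"
      using int lborel_Complex_swap by simp
    then show "integrable (lborel \<Otimes>\<^sub>M lborel) (\<lambda>(x, y). \<i> * (A (Complex y x) - B (Complex y x)))"
      by (subst (asm) integrable_distr_eq) (auto simp: case_prod_unfold)
    show "continuous_on UNIV (\<lambda>x. case (x, y) of (x, y) \<Rightarrow> F (Complex y x))" if "y \<noteq> Re w" for y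
      using that by (auto intro!: continuous_at_imp_continuous_on isCont_o2[OF c2] cont)
  qed (use fin supp_Im wirt vector_derivative_Im_line in auto)
  then have 2: "(\<integral>z. \<i> * (A z - B z) \<partial>lborel) = 0"
    by (subst lborel_Complex_swap, subst integral_distr) (auto simp: case_prod_unfold)
  show "(\<integral>z. A z \<partial>lborel) = 0" "(\<integral>z. B z \<partial>lborel) = 0"
    using 1 2 int by auto
qed

section \<open>Local integrability of the kernel\<close>

lemma sets_borel_ball [measurable]: "ball x r \<in> sets borel"
  by simp

lemma integrable_powr_minus_half:
  "integrable lborel (\<lambda>x::real. indicator {-R..R} x * \<bar>x\<bar> powr (-1/2))"
proof (cases "R \<ge> 0")
  case True
  have "((\<lambda>x::real. x powr (-1/2)) has_integral R powr (1/2) / (1/2)) {0..R}"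
    using has_integral_powr_from_0[of "-1/2" R] True by simp
  then have "set_integrable lebesgue {0..R} (\<lambda>x::real. x powr (-1/2))"
    by (intro nonnegative_absolutely_integrable_1) (auto simp: integrable_on_def)
  then have 1: "set_integrable lborel {0..R} (\<lambda>x::real. x powr (-1/2))"
    unfolding set_integrable_def by (subst (asm) integrable_completion) simp_all
  then have "integrable lborel (\<lambda>x. indicator {0..R} x * x powr (-1/2))"
    by (simp add: set_integrable_def)
  moreover from this have "integrable lborel (\<lambda>x. indicator {0..R} (-x) * (-x) powr (-1/2))"
    using lborel_integrable_real_affine_iff[of "-1" "\<lambda>x. indicator {0..R} x * x powr (-1/2)" 0] by simp
  ultimately have "integrable lborel (\<lambda>x. indicator {0..R} x * x powr (-1/2)
      + indicator {0..R} (-x) * (-x) powr (-1/2))"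
    by (rule Bochner_Integration.integrable_add)
  then show ?thesis
    by (rule back_subst[where P = "integrable lborel"]) (auto simp: fun_eq_iff indicator_def)
qed (auto simp: indicator_def)

text \<open>From |x| |y| \<le> x^2 + y^2. The kernel 1/|z| is thus dominated by a product of
  functions of one variable, each with an exponent above -1, so that its local integrability follows
  from Fubini.\<close>

lemma inverse_norm_Complex_le: "1 / norm (Complex x y) \<le> \<bar>x\<bar> powr (-1/2) * \<bar>y\<bar> powr (-1/2)"
  if "x \<noteq> 0" "y \<noteq> 0"
proof -
  have "\<bar>x\<bar> * \<bar>y\<bar> \<le> (norm (Complex x y))\<^sup>2"
  proof -
    have "0 \<le> \<bar>x\<bar> * \<bar>y\<bar>" by simp
    then show ?thesis
      using sum_squares_bound[of "\<bar>x\<bar>" "\<bar>y\<bar>"] unfolding cmod_power2 complex.sel power2_abs by linarith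
  qed
  then have "sqrt (\<bar>x\<bar> * \<bar>y\<bar>) \<le> norm (Complex x y)"
    by (rule real_le_lsqrt[OF norm_ge_zero])
  moreover have "\<bar>x\<bar> powr (-1/2) * \<bar>y\<bar> powr (-1/2) = 1 / sqrt (\<bar>x\<bar> * \<bar>y\<bar>)"
    using that by (simp add: powr_minus_divide powr_half_sqrt real_sqrt_mult)
  ultimately show ?thesis
    using that by (auto intro!: divide_left_mono mult_pos_pos simp: complex_eq_iff)
qed

lemma integrable_inverse_norm:
  "integrable lborel (\<lambda>z. indicator (ball 0 R) z / norm (z - w :: complex))"
proof -
  \<comment> \<open>Large enough that translation by \<open>- w\<close> maps the ball of radius
    \<open>R\<close> into that of radius \<open>r\<close>; the case \<open>w = 0\<close> is treated
    first and then translated.\<close>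
  define r where "r = \<bar>R\<bar> + norm w"
  define q where "q = (\<lambda>x::real. indicator {-r..r} x * \<bar>x\<bar> powr (-1/2))"
  have [measurable]: "q \<in> borel_measurable borel"
    unfolding q_def by measurable
  have prod: "integrable (lborel \<Otimes>\<^sub>M lborel) (\<lambda>(x, y). q x * q y)"
  proof (rule lborel_pair.Fubini_integrable)
    have q: "integrable lborel q"
      using integrable_powr_minus_half[of r] by (simp add: q_def)
    then show "AE x in lborel. integrable lborel (\<lambda>y. case (x, y) of (x, y) \<Rightarrow> q x * q y)"
      by simp
    show "integrable lborel (\<lambda>x. \<integral>y. norm (case (x, y) of (x, y) \<Rightarrow> q x * q y) \<partial>lborel)"
      using q by (simp add: abs_mult)
  qed simp
  have "AE x in lborel. AE y in lborel.
      norm (indicator (ball 0 r) (Complex x y) / norm (Complex x y)) \<le> norm (q x * q y)"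
    \<comment> \<open>The coordinate axes are left out: there the majorant is 0, because
      \<open>0 powr (-1/2) = 0\<close>, and the bound fails.\<close>
    using AE_lborel_singleton[of 0]
  proof eventually_elim
    case (elim x)
    show ?case
      using AE_lborel_singleton[of 0]
    proof eventually_elim
      case (elim y)
      show ?case
      proof (cases "Complex x y \<in> ball 0 r")
        case True
        then have "\<bar>x\<bar> \<le> r" "\<bar>y\<bar> \<le> r"
          using abs_Re_le_cmod[of "Complex x y"] abs_Im_le_cmod[of "Complex x y"] by auto
        then show ?thesis
          using True inverse_norm_Complex_le[OF \<open>x \<noteq> 0\<close> \<open>y \<noteq> 0\<close>] by (auto simp: q_def indicator_def)
      qed auto
    qed
  qed
  moreover have meas: "(\<lambda>p. indicator (ball 0 r) (Complex (fst p) (snd p)) / norm (Complex (fst p) (snd p)))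
      \<in> borel_measurable (lborel \<Otimes>\<^sub>M lborel)"
    by (rule measurable_compose[OF Complex_measurable[unfolded case_prod_unfold],
          where g = "\<lambda>z. indicator (ball 0 r) z / norm z :: real"]) measurable
  have "{p \<in> space (lborel \<Otimes>\<^sub>M lborel).
      norm (indicator (ball 0 r) (Complex (fst p) (snd p)) / norm (Complex (fst p) (snd p)) :: real)
        \<le> norm (q (fst p) * q (snd p))} \<in> sets (lborel \<Otimes>\<^sub>M lborel)"
    by (intro borel_measurable_le measurable_compose[OF _ borel_measurable_norm] meas) simp
  ultimately have "AE p in lborel \<Otimes>\<^sub>M lborel.
      norm (indicator (ball 0 r) (Complex (fst p) (snd p)) / norm (Complex (fst p) (snd p)) :: real)
        \<le> norm (q (fst p) * q (snd p))"
    by (intro lborel_pair.AE_pair_measure) simp_all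
  with prod meas have "integrable (lborel \<Otimes>\<^sub>M lborel)
      (\<lambda>p. indicator (ball 0 r) (Complex (fst p) (snd p)) / norm (Complex (fst p) (snd p)) :: real)"
    unfolding case_prod_unfold by (rule Bochner_Integration.integrable_bound)
  then have "integrable (distr (lborel \<Otimes>\<^sub>M lborel) borel (\<lambda>(x, y). Complex x y))
      (\<lambda>z. indicator (ball 0 r) z / norm z :: real)"
    by (subst integrable_distr_eq) (auto simp: case_prod_unfold)
  then have "integrable lborel (\<lambda>z::complex. indicator (ball 0 r) z / norm z :: real)"
    by (simp only: lborel_Complex[symmetric])
  then have "integrable (distr lborel borel ((+) (- w))) (\<lambda>z::complex. indicator (ball 0 r) z / norm z :: real)"
    by (simp only: lborel_distr_plus)
  then have "integrable lborel (\<lambda>z. indicator (ball 0 r) (z - w) / norm (z - w) :: real)"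
    by (subst (asm) integrable_distr_eq) auto
  then show ?thesis
  proof (rule Bochner_Integration.integrable_bound)
    have "z \<in> ball 0 R \<Longrightarrow> z - w \<in> ball 0 r" for z
      using norm_triangle_ineq4[of z w] by (auto simp: r_def)
    then show "AE z in lborel. norm (indicator (ball 0 R) z / norm (z - w) :: real)
        \<le> norm (indicator (ball 0 r) (z - w) / norm (z - w))"
      by (auto simp: indicator_def)
  qed auto
qed

text \<open>A singularity of order one is integrable in real dimension two. This is the criterion
  behind all integrals across the point \<open>w\<close> below.\<close>

lemma integrable_weak_singularity:
  fixes f :: "complex \<Rightarrow> complex"
  assumes [measurable]: "f \<in> borel_measurable borel"
    and bound: "\<And>z. z \<noteq> w \<Longrightarrow> norm (f z) \<le> C / norm (z - w)"
    and supp: "\<And>z. norm z \<ge> R \<Longrightarrow> f z = 0"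
  shows "integrable lborel f"
proof (rule Bochner_Integration.integrable_bound)
  show "integrable lborel (\<lambda>z. C * (indicator (ball 0 R) z / norm (z - w)))"
    by (intro integrable_mult_right integrable_inverse_norm)
  show "AE z in lborel. norm (f z) \<le> norm (C * (indicator (ball 0 R) z / norm (z - w)))"
    using AE_lborel_singleton[of w]
  proof eventually_elim
    case (elim z)
    show ?case
      using order_trans[OF bound[OF elim] divide_right_mono[OF abs_ge_self]] supp[of z]
      by (cases "norm z < R") (auto simp: indicator_def)
  qed
qed simp

lemma borel_measurable_continuous_off_point:
  fixes f :: "complex \<Rightarrow> complex"
  assumes "continuous_on (- {w}) f"
  shows "f \<in> borel_measurable borel"
proof -
  have "(\<lambda>z. if z \<in> - {w} then f z else f w) \<in> borel_measurable borel"
    by (rule borel_measurable_continuous_on_if) (use assms in auto)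
  then show ?thesis
    by (rule back_subst[where P = "\<lambda>f. f \<in> borel_measurable borel"]) auto
qed

lemma finite_circle_section: "finite {x::real. (x - a)\<^sup>2 + b = c}"
proof (rule finite_subset)
  show "{x. (x - a)\<^sup>2 + b = c} \<subseteq> {a + sqrt (c - b), a - sqrt (c - b)}"
  proof
    fix x assume "x \<in> {x. (x - a)\<^sup>2 + b = c}"
    then have "(x - a)\<^sup>2 = c - b" by auto
    then have "\<bar>x - a\<bar> = sqrt (c - b)" by (metis real_sqrt_abs)
    then show "x \<in> {a + sqrt (c - b), a - sqrt (c - b)}" by auto
  qed
qed auto

text \<open>The auxiliary function in the Cauchy-Pompeiu formula is not differentiable on a circle.
  A line meets a circle in at most two points, so this set is admissible as \<open>E\<close> in
  \<open>integral_wirt_zero\<close>.\<close>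

lemma finite_sphere_sections:
  "finite {x. Complex x y \<in> sphere w r}" "finite {y. Complex x y \<in> sphere w r}"
proof -
  have "(Re w - x)\<^sup>2 + (Im w - y)\<^sup>2 = r\<^sup>2" if "Complex x y \<in> sphere w r" for x y
    using that by (auto simp: dist_norm cmod_power2)
  then have *: "Complex x y \<in> sphere w r \<Longrightarrow> (x - Re w)\<^sup>2 + (Im w - y)\<^sup>2 = r\<^sup>2"
    "Complex x y \<in> sphere w r \<Longrightarrow> (y - Im w)\<^sup>2 + (Re w - x)\<^sup>2 = r\<^sup>2" for x y
    by (simp_all add: power2_commute add.commute)
  show "finite {x. Complex x y \<in> sphere w r}"
    by (rule finite_subset[OF _ finite_circle_section[of "Re w" "(Im w - y)\<^sup>2" "r\<^sup>2"]]) (use *(1) in blast)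
  show "finite {y. Complex x y \<in> sphere w r}"
    by (rule finite_subset[OF _ finite_circle_section[of "Im w" "(Re w - x)\<^sup>2" "r\<^sup>2"]]) (use *(2) in blast)
qed

section \<open>The Cauchy-Pompeiu formula\<close>

lemma borel_measurable_cnj [measurable]: "cnj \<in> borel_measurable borel"
  by (intro borel_measurable_continuous_onI continuous_intros)

lemma has_wirt_shifted_cone:
  assumes "z \<notin> sphere w 1"
  shows "has_wirt (\<lambda>z. of_real (max 0 (1 - (norm (z - w))\<^sup>2)))
    (- indicator (ball w 1) z * cnj (z - w)) (- indicator (ball w 1) z * (z - w)) z"
proof (cases "z \<in> ball w 1")
  case True
  have "has_wirt (\<lambda>z. z - w) 1 0 z"
    by (rule has_wirt_field_derivative) (auto intro!: derivative_eq_intros)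
  from has_wirt_diff[OF has_wirt_const[of 1] has_wirt_mult[OF this has_wirt_cnj[OF this]]]
  have "has_wirt (\<lambda>z. 1 - (z - w) * cnj (z - w)) (- cnj (z - w)) (- (z - w)) z"
    by simp
  then have "has_wirt (\<lambda>z. of_real (max 0 (1 - (norm (z - w))\<^sup>2))) (- cnj (z - w)) (- (z - w)) z"
  proof (rule has_wirt_transform[where S = "ball w 1"])
    fix x assume "x \<in> ball w 1"
    then have "(norm (x - w))\<^sup>2 \<le> 1"
      by (simp add: dist_norm norm_minus_commute abs_square_le_1)
    then show "1 - (x - w) * cnj (x - w) = of_real (max 0 (1 - (norm (x - w))\<^sup>2))"
      using complex_norm_square[of "x - w"] by (simp add: max_def)
  qed (use True in auto)
  then show ?thesis using True by simp
next
  case False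
  have "has_wirt (\<lambda>z. of_real (max 0 (1 - (norm (z - w))\<^sup>2))) 0 0 z"
  proof (rule has_wirt_zero_off_closed[where S = "cball w 1"])
    fix x assume "x \<notin> cball w 1"
    then have "(norm (x - w))\<^sup>2 \<ge> 1"
      by (simp add: dist_norm norm_minus_commute)
    then show "of_real (max 0 (1 - (norm (x - w))\<^sup>2)) = (0::complex)" by simp
  qed (use False assms in auto)
  then show ?thesis using False by simp
qed

lemma continuous_compact_support_bounded:
  fixes f :: "complex \<Rightarrow> complex"
  assumes "continuous_on UNIV f" "\<And>z. norm z \<ge> R \<Longrightarrow> f z = 0"
  obtains C where "C \<ge> 0" "\<And>z. norm (f z) \<le> C"
proof -
  have "bounded (f ` cball 0 R)"
    using assms(1) by (intro compact_imp_bounded compact_continuous_image)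
      (auto intro: continuous_on_subset)
  then obtain C where C: "\<And>z. z \<in> cball 0 R \<Longrightarrow> norm (f z) \<le> C"
    unfolding bounded_iff by blast
  show thesis
  proof
    show "norm (f z) \<le> max 0 C" for z
      using C[of z] assms(2)[of z] by (cases "norm z \<le> R") auto
  qed simp
qed

lemma has_wirt_bounded_imp_lipschitz:
  assumes "\<And>z. has_wirt f (A z) (B z) z" "\<And>z. norm (A z) \<le> C" "\<And>z. norm (B z) \<le> D"
  shows "norm (f x - f y) \<le> (C + D) * norm (x - y)"
proof (rule differentiable_bound[of UNIV f "\<lambda>z v. A z * v + B z * cnj v"])
  show "onorm (\<lambda>v. A z * v + B z * cnj v) \<le> C + D" for z
  proof (rule onorm_le)
    fix v
    have "norm (A z * v + B z * cnj v) \<le> norm (A z) * norm v + norm (B z) * norm v"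
      by (rule order_trans[OF norm_triangle_ineq]) (simp add: norm_mult)
    also have "\<dots> \<le> (C + D) * norm v"
      using assms(2,3) by (simp add: distrib_right add_mono mult_right_mono)
    finally show "norm (A z * v + B z * cnj v) \<le> (C + D) * norm v" .
  qed
qed (use assms(1) in \<open>auto simp: has_wirt_def\<close>)

text \<open>Subtracting the multiple \<open>f w\<close> of the cone \<open>max 0 (1 - \<bar>z - w\<bar>\<^sup>2)\<close> makes
  \<open>f z / (z - w)\<close> bounded with integrable derivatives; the contribution of the cone itself
  is the area of a disc.\<close>

theorem Cauchy_Pompeiu:
  assumes wirt: "\<And>z. has_wirt f (A z) (B z) z"
    and cont: "continuous_on UNIV A" "continuous_on UNIV B"
    and supp: "\<And>z. norm z \<ge> R \<Longrightarrow> f z = 0 \<and> A z = 0 \<and> B z = 0"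
  shows "(\<integral>z. B z / (z - w) \<partial>lborel) = - of_real pi * f w"
proof -
  define \<eta> where "\<eta> = (\<lambda>z. complex_of_real (max 0 (1 - (norm (z - w))\<^sup>2)))"
  define I where "I = (\<lambda>z. indicator (ball w 1) z :: complex)"
  define F where "F = (\<lambda>z. (f z - f w * \<eta> z) / (z - w))"
  define FA where "FA = (\<lambda>z. (A z + f w * (I z * cnj (z - w))) / (z - w) - (f z - f w * \<eta> z) / (z - w)\<^sup>2)"
  \<comment> \<open>The dbar-derivative of \<open>\<eta>\<close> is \<open>- I z * (z - w)\<close>.
    Its factor \<open>z - w\<close> cancels the denominator, so what \<open>\<eta>\<close>
    contributes is just \<open>f w\<close> times the indicator of a disc of area pi.\<close>
  define FB where "FB = (\<lambda>z. B z / (z - w) + f w * I z)"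
  obtain CA where CA: "CA \<ge> 0" "\<And>z. norm (A z) \<le> CA"
    using continuous_compact_support_bounded[OF cont(1)] supp by metis
  obtain CB where CB: "CB \<ge> 0" "\<And>z. norm (B z) \<le> CB"
    using continuous_compact_support_bounded[OF cont(2)] supp by metis
  have contf: "continuous_on UNIV f"
    using has_wirt_isCont[OF wirt] by (simp add: continuous_at_imp_continuous_on)
  have [measurable]: "f \<in> borel_measurable borel" "A \<in> borel_measurable borel" "B \<in> borel_measurable borel"
    using contf cont by (auto intro: borel_measurable_continuous_onI)
  have cont\<eta>: "continuous_on UNIV \<eta>"
    unfolding \<eta>_def by (intro continuous_intros)
  then have [measurable]: "\<eta> \<in> borel_measurable borel"
    by (rule borel_measurable_continuous_onI)
  have [measurable]: "I \<in> borel_measurable borel"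
    unfolding I_def by measurable
  have I_real: "I = (\<lambda>z. of_real (indicator (ball w 1) z))"
    by (auto simp: I_def indicator_def)
  have \<eta>_lip: "norm (1 - \<eta> z) \<le> norm (z - w)" for z
  proof (cases "norm (z - w) \<le> 1")
    case True
    then have "(norm (z - w))\<^sup>2 \<le> 1" by (simp add: abs_square_le_1)
    then have "1 - \<eta> z = of_real ((norm (z - w))\<^sup>2)" by (simp add: \<eta>_def max_def)
    also have "norm \<dots> \<le> norm (z - w)"
      using mult_left_le_one_le[of "norm (z - w)" "norm (z - w)"] True
      by (simp add: power2_eq_square norm_mult)
    finally show ?thesis .
  next
    case False
    then have "(norm (z - w))\<^sup>2 \<ge> 1" by simp
    then have "\<eta> z = 0" unfolding \<eta>_def by simp
    then show ?thesis using False by simp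
  qed
  define C where "C = CA + CB + norm (f w)"
  \<comment> \<open>The numerator of \<open>F\<close> vanishes to first order at \<open>w\<close>.
    This lowers the second-order pole in \<open>FA\<close> to an integrable first-order one.\<close>
  have lip: "norm (f z - f w * \<eta> z) \<le> C * norm (z - w)" for z
  proof -
    have "f z - f w * \<eta> z = (f z - f w) + f w * (1 - \<eta> z)" by (simp add: algebra_simps)
    then have "norm (f z - f w * \<eta> z) \<le> norm (f z - f w) + norm (f w) * norm (1 - \<eta> z)"
      by (metis norm_mult norm_triangle_ineq)
    also have "\<dots> \<le> (CA + CB) * norm (z - w) + norm (f w) * norm (z - w)"
      by (intro add_mono mult_left_mono \<eta>_lip has_wirt_bounded_imp_lipschitz[OF wirt CA(2) CB(2)]) simp
    finally show ?thesis by (simp add: C_def algebra_simps)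
  qed
  have "C \<ge> 0" using CA CB by (simp add: C_def)
  \<comment> \<open>Beyond this radius both \<open>f\<close> and the unit disc around
    \<open>w\<close> have been left.\<close>
  define r where "r = max R (norm w + 1)"
  have far: "z \<notin> ball w 1" "z \<noteq> w" "norm (z - w) \<ge> 1" if "norm z \<ge> r" for z
    using norm_triangle_ineq2[of z w] that by (auto simp: r_def dist_norm norm_minus_commute)
  have suppI: "I z = 0" "\<eta> z = 0" if "norm z \<ge> r" for z
    using far[OF that] by (auto simp: I_def \<eta>_def)
  have suppF: "F z = 0 \<and> FA z = 0 \<and> FB z = 0" if "norm z \<ge> r" for z
    using suppI[OF that] supp[of z] that by (simp add: F_def FA_def FB_def r_def)
  have wirtF: "has_wirt F (FA z) (FB z) z" if "z \<notin> insert w (sphere w 1)" for z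
  proof -
    have "has_wirt (\<lambda>z. 1 / (z - w)) (- 1 / (z - w)\<^sup>2) 0 z"
      using that by (intro has_wirt_field_derivative)
        (auto intro!: derivative_eq_intros simp: power2_eq_square)
    from has_wirt_mult[OF has_wirt_diff[OF wirt
        has_wirt_cmult[OF has_wirt_shifted_cone, of z w "f w"]] this] that
    have "has_wirt (\<lambda>z. (f z - f w * \<eta> z) * (1 / (z - w)))
        ((A z - f w * (- I z * cnj (z - w))) * (1 / (z - w)) + (f z - f w * \<eta> z) * (- 1 / (z - w)\<^sup>2))
        ((B z - f w * (- I z * (z - w))) * (1 / (z - w))) z"
      by (simp add: \<eta>_def I_def)
    then show ?thesis
      using that by (simp add: F_def FA_def FB_def field_simps)
  qed
  have "integrable lborel FA"
  proof (rule integrable_weak_singularity)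
    show "norm (FA z) \<le> (CA + norm (f w) + C) / norm (z - w)" if "z \<noteq> w" for z
    proof -
      have "norm (I z * cnj (z - w)) \<le> 1"
        unfolding norm_mult complex_mod_cnj
        by (auto simp: I_def indicator_def dist_norm norm_minus_commute)
      then have "norm (f w * (I z * cnj (z - w))) \<le> norm (f w)"
        unfolding norm_mult[of "f w"] by (rule mult_left_le) simp
      then have "norm (A z + f w * (I z * cnj (z - w))) \<le> CA + norm (f w)"
        using CA(2) by (intro norm_triangle_le add_mono)
      then have 1: "norm ((A z + f w * (I z * cnj (z - w))) / (z - w)) \<le> (CA + norm (f w)) / norm (z - w)"
        by (simp add: norm_divide divide_right_mono)
      have "norm ((f z - f w * \<eta> z) / (z - w)\<^sup>2) \<le> C * norm (z - w) / (norm (z - w))\<^sup>2"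
        using lip[of z] by (simp add: norm_divide norm_power divide_right_mono)
      also have "\<dots> = C / norm (z - w)" by (simp add: power2_eq_square)
      finally have "norm (FA z) \<le> (CA + norm (f w)) / norm (z - w) + C / norm (z - w)"
        unfolding FA_def using 1 by (intro norm_triangle_le_diff add_mono)
      then show ?thesis by (simp add: add_divide_distrib)
    qed
    show "FA z = 0" if "norm z \<ge> r" for z using suppF that by blast
  qed (simp add: FA_def)
  have intB: "integrable lborel (\<lambda>z. B z / (z - w))"
  proof (rule integrable_weak_singularity)
    show "norm (B z / (z - w)) \<le> CB / norm (z - w)" for z
      using CB(2)[of z] by (simp add: norm_divide divide_right_mono)
    show "B z / (z - w) = 0" if "norm z \<ge> R" for z using supp that by simp
  qed simp
  have intI: "integrable lborel I"
    unfolding I_real by (intro integrable_of_real integrable_real_indicator)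
      (use emeasure_bounded_finite[OF bounded_ball, of w 1] in simp_all)
  have "integrable lborel FB"
    unfolding FB_def using intB intI by simp
  have contF: "isCont F z" if "z \<noteq> w" for z
    unfolding F_def using that contf cont\<eta>
    by (intro continuous_intros) (auto simp: continuous_on_eq_continuous_at)
  have fin1: "finite {x. Complex x y \<in> insert w (sphere w 1)}" for y
    by (rule finite_subset[of _ "insert (Re w) {x. Complex x y \<in> sphere w 1}"])
       (use finite_sphere_sections(1)[of y w 1] in \<open>auto simp: complex_eq_iff\<close>)
  have fin2: "finite {y. Complex x y \<in> insert w (sphere w 1)}" for x
    by (rule finite_subset[of _ "insert (Im w) {y. Complex x y \<in> sphere w 1}"])
       (use finite_sphere_sections(2)[of x w 1] in \<open>auto simp: complex_eq_iff\<close>)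
  have "(\<integral>z. FB z \<partial>lborel) = 0"
    by (rule integral_wirt_zero(2)[OF \<open>integrable lborel FA\<close> \<open>integrable lborel FB\<close> wirtF fin1 fin2 contF suppF])
  then have "(\<integral>z. B z / (z - w) \<partial>lborel) = - (f w * (\<integral>z. I z \<partial>lborel))"
    unfolding FB_def using intB intI by (simp add: add_eq_0_iff)
  moreover have "(\<integral>z. I z \<partial>lborel) = of_real pi"
    unfolding I_real integral_complex_of_real by (simp add: content_ball unit_ball_vol_2)
  ultimately show ?thesis by simp
qed

section \<open>The function h\<close>

lemma set_integrable_powr_from_0:
  fixes a c :: real
  assumes "a > -1" "c \<ge> 0"
  shows "set_integrable lborel {0..c} (\<lambda>x. x powr a)"
    and "(LINT x:{0..c}|lborel. x powr a) = c powr (a + 1) / (a + 1)"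
proof -
  have *: "((\<lambda>x. x powr a) has_integral (c powr (a + 1) / (a + 1))) {0..c}"
    by (rule has_integral_powr_from_0[OF assms])
  then have "set_integrable lebesgue {0..c} (\<lambda>x. x powr a)"
    by (intro nonnegative_absolutely_integrable_1) (auto simp: integrable_on_def)
  then show **: "set_integrable lborel {0..c} (\<lambda>x. x powr a)"
    unfolding set_integrable_def by (subst (asm) integrable_completion) simp_all
  show "(LINT x:{0..c}|lborel. x powr a) = c powr (a + 1) / (a + 1)"
    using set_borel_integral_eq_integral(2)[OF **] * by (simp add: integral_unique)
qed

text \<open>The geometric series of 1/(1 - t) has nonnegative terms on the interval, so summability
  of their integrals yields integrability of the sum and termwise integration at once.\<close>

lemma h_fun_series:
  assumes "\<alpha> > -1" "0 \<le> s" "s < 1"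
  shows "set_integrable lborel {0..s} (\<lambda>t. t powr \<alpha> / (1 - t))"
    and "(\<lambda>n. s powr (\<alpha> + 1 + real n) / (\<alpha> + 1 + real n)) sums h_fun \<alpha> s"
proof -
  define f where "f = (\<lambda>n t. indicator {0..s} t * t powr (\<alpha> + real n))"
  have int: "integrable lborel (f n)" for n
    using set_integrable_powr_from_0(1)[of "\<alpha> + real n" s] assms by (simp add: f_def set_integrable_def)
  have lint: "integral\<^sup>L lborel (f n) = s powr (\<alpha> + 1 + real n) / (\<alpha> + 1 + real n)" for n
    using set_integrable_powr_from_0(2)[of "\<alpha> + real n" s] assms
    by (simp add: f_def set_lebesgue_integral_def add_ac)
  have powr_split: "t powr (b + real n) = t powr b * t ^ n" if "t \<ge> 0" for t b :: real and n
    using that by (cases "t = 0") (auto simp: powr_add powr_realpow)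
  have sums: "(\<lambda>n. f n t) sums (indicator {0..s} t * (t powr \<alpha> / (1 - t)))" for t
  proof (cases "t \<in> {0..s}")
    case True
    then have "(\<lambda>n. t powr \<alpha> * t ^ n) sums (t powr \<alpha> * (1 / (1 - t)))"
      using assms by (intro sums_mult geometric_sums) auto
    then show ?thesis using True by (simp add: f_def powr_split)
  qed (simp add: f_def)
  have norm_f: "norm (f n t) = f n t" for n t by (simp add: f_def)
  have "summable (\<lambda>n. s powr (\<alpha> + 1 + real n) / (\<alpha> + 1 + real n))"
  proof (rule summable_comparison_test')
    show "summable (\<lambda>n. s powr (\<alpha> + 1) / (\<alpha> + 1) * s ^ n)"
      using assms by (intro summable_mult summable_geometric) auto
    show "norm (s powr (\<alpha> + 1 + real n) / (\<alpha> + 1 + real n)) \<le> s powr (\<alpha> + 1) / (\<alpha> + 1) * s ^ n" for n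
      using assms by (auto simp: powr_split intro!: divide_left_mono mult_pos_pos)
  qed
  then have sl: "summable (\<lambda>n. \<integral>t. norm (f n t) \<partial>lborel)"
    by (simp only: norm_f lint)
  have sn: "AE t in lborel. summable (\<lambda>n. norm (f n t))"
    unfolding norm_f using sums by (auto simp: sums_iff)
  have eq: "(\<Sum>n. f n t) = indicator {0..s} t * (t powr \<alpha> / (1 - t))" for t
    using sums[of t] by (simp add: sums_iff)
  show "set_integrable lborel {0..s} (\<lambda>t. t powr \<alpha> / (1 - t))"
    using integrable_suminf[OF int sn sl] by (simp add: eq set_integrable_def)
  show "(\<lambda>n. s powr (\<alpha> + 1 + real n) / (\<alpha> + 1 + real n)) sums h_fun \<alpha> s"
    using sums_integral[OF int sn sl] by (simp add: eq lint h_fun_def set_lebesgue_integral_def)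
qed

lemma h_fun_nonneg: "0 \<le> h_fun \<alpha> s" if "s < 1"
  unfolding h_fun_def set_lebesgue_integral_def
  using that by (intro Bochner_Integration.integral_nonneg) (auto simp: indicator_def)

text \<open>The termwise comparison \<open>1 / (\<alpha> + 1 + n) \<le> 1 / n\<close> for \<open>n \<ge> 1\<close> bounds \<open>h\<close> by
  \<open>s powr (\<alpha> + 1) * (1 / (\<alpha> + 1) - ln (1 - s))\<close>.\<close>

lemma h_fun_le:
  assumes "\<alpha> > -1" "0 \<le> s" "s < 1"
  shows "h_fun \<alpha> s \<le> (1 / (\<alpha> + 1) + 2) * s powr (\<alpha> + 1) / sqrt (1 - s)"
proof -
  have split: "s powr (\<alpha> + 1 + real n) = s powr (\<alpha> + 1) * s ^ n" for n
    using assms by (cases "s = 0") (auto simp: powr_add powr_realpow)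
  \<comment> \<open>For \<open>n = 0\<close> the second summand is \<open>s ^ 0 / 0 = 0\<close>, so
    the first term of the series for h is accounted for by \<open>1 / (\<alpha> + 1)\<close>
    alone.\<close>
  have "(\<lambda>n. (if n = 0 then 1 / (\<alpha> + 1) else 0) + s ^ n / real n) sums (1 / (\<alpha> + 1) + (- ln (1 - s)))"
  proof (rule sums_add)
    show "(\<lambda>n. if n = 0 then 1 / (\<alpha> + 1) else 0) sums (1 / (\<alpha> + 1))"
      using sums_single[of 0 "\<lambda>_. 1 / (\<alpha> + 1)"] by simp
    show "(\<lambda>n. s ^ n / real n) sums (- ln (1 - s))"
      using sums_minus[OF ln_series'[of "- s"]] assms by simp
  qed
  then have bound: "(\<lambda>n. s powr (\<alpha> + 1) * ((if n = 0 then 1 / (\<alpha> + 1) else 0) + s ^ n / real n)) sums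
      (s powr (\<alpha> + 1) * (1 / (\<alpha> + 1) + (- ln (1 - s))))"
    by (rule sums_mult)
  have "s powr (\<alpha> + 1 + real n) / (\<alpha> + 1 + real n)
      \<le> s powr (\<alpha> + 1) * ((if n = 0 then 1 / (\<alpha> + 1) else 0) + s ^ n / real n)" for n
  proof (cases "n = 0")
    case False
    have "s powr (\<alpha> + 1) * s ^ n / (\<alpha> + 1 + real n) \<le> s powr (\<alpha> + 1) * s ^ n / real n"
      using assms False by (intro frac_le) simp_all
    then show ?thesis using False by (simp add: split)
  next
    case True
    then show ?thesis by simp
  qed
  then have "h_fun \<alpha> s \<le> s powr (\<alpha> + 1) * (1 / (\<alpha> + 1) + (- ln (1 - s)))"
    using sums_le[OF _ h_fun_series(2)[OF assms] bound] by blast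
  also have "\<dots> \<le> s powr (\<alpha> + 1) * ((1 / (\<alpha> + 1) + 2) / sqrt (1 - s))"
  proof (rule mult_left_mono)
    have root: "0 < sqrt (1 - s)" "sqrt (1 - s) \<le> 1" using assms by auto
    \<comment> \<open>The logarithm is traded for a square root because \<open>1 - g\<close> is the
      square of a quotient with numerator |z - w|: the root produces exactly one power of 1/|z -
      w|.\<close>
    have "- ln (1 - s) = 2 * ln (1 / sqrt (1 - s))"
      using assms by (simp add: ln_div ln_sqrt)
    also have "\<dots> \<le> 2 * (1 / sqrt (1 - s))"
      using root ln_le_minus_one[of "1 / sqrt (1 - s)"] by simp
    finally have "- ln (1 - s) \<le> 2 / sqrt (1 - s)" by simp
    moreover have "1 / (\<alpha> + 1) \<le> 1 / (\<alpha> + 1) / sqrt (1 - s)"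
      using root assms by (simp add: pos_le_divide_eq mult_left_le divide_right_mono)
    ultimately show "1 / (\<alpha> + 1) + (- ln (1 - s)) \<le> (1 / (\<alpha> + 1) + 2) / sqrt (1 - s)"
      by (simp only: add_divide_distrib)
  qed simp
  finally show ?thesis by (simp add: mult_ac)
qed

lemma h_fun_has_derivative:
  assumes "\<alpha> > -1" "0 < s" "s < 1"
  shows "(h_fun \<alpha> has_real_derivative s powr \<alpha> / (1 - s)) (at s)"
proof -
  define k where "k = (\<lambda>t. t powr \<alpha> / (1 - t))"
  \<comment> \<open>The integrand is continuous only away from 0 and 1. The fundamental theorem is
    applied on this neighbourhood of \<open>s\<close>, and the integral up to \<open>a\<close>
    enters as a constant.\<close>
  define a b where "a = s / 2" and "b = (1 + s) / 2"
  have ab: "0 < a" "a < s" "s < b" "b < 1" using assms by (auto simp: a_def b_def)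
  have "continuous_on {a..b} k"
    unfolding k_def using ab by (intro continuous_intros) auto
  from integral_has_real_derivative[OF this, of s] ab
  have "((\<lambda>x. integral {a..x} k) has_real_derivative k s) (at s within {a..b})" by simp
  moreover have "at s within {a..b} = at s"
    by (rule at_within_interior) (use ab in auto)
  ultimately have "((\<lambda>x. integral {0..a} k + integral {a..x} k) has_real_derivative k s) (at s)"
    by (auto intro!: derivative_eq_intros)
  then have "(h_fun \<alpha> has_real_derivative k s) (at s)"
  proof (rule has_field_derivative_transform_within_open)
    fix x assume "x \<in> {a<..<b}"
    then have x: "a < x" "x < 1" using ab by auto
    have "set_integrable lborel {0..x} k"
      unfolding k_def using h_fun_series(1)[of \<alpha> x] assms x ab by simp
    from set_borel_integral_eq_integral[OF this]
    have "k integrable_on {0..x}" "h_fun \<alpha> x = integral {0..x} k"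
      by (simp_all add: h_fun_def k_def)
    then show "integral {0..a} k + integral {a..x} k = h_fun \<alpha> x"
      using x ab by (simp add: Henstock_Kurzweil_Integration.integral_combine)
  qed (use ab in auto)
  then show ?thesis by (simp add: k_def)
qed

section \<open>The Green function off the diagonal\<close>

lemma norm_one_minus_mult_cnj: "norm (1 - cnj z * w) = norm (1 - z * cnj w)"
proof -
  have "1 - cnj z * w = cnj (1 - z * cnj w)" by simp
  then show ?thesis by (simp only: complex_mod_cnj)
qed

lemma Re_one_minus_mult_pos:
  assumes "norm z * norm w < 1"
  shows "Re (1 - z * w) > 0"
  using complex_Re_le_cmod[of "z * w"] assms by (simp add: norm_mult)

lemma norm_mult_less_one: "z \<in> \<D> \<Longrightarrow> w \<in> \<D> \<Longrightarrow> norm z * norm w < 1" for z w :: complex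
  using mult_strict_mono'[of "norm z" 1 "norm w" 1] by simp

lemma one_minus_mult_cnj_nonzero: "z \<in> \<D> \<Longrightarrow> w \<in> \<D> \<Longrightarrow> 1 - z * cnj w \<noteq> 0"
  using Re_one_minus_mult_pos[of z "cnj w"] norm_mult_less_one[of z w] by force

lemma one_minus_mult_cnj_not_nonpos: "z \<in> \<D> \<Longrightarrow> w \<in> \<D> \<Longrightarrow> 1 - z * cnj w \<notin> \<real>\<^sub>\<le>\<^sub>0"
  using Re_one_minus_mult_pos[of z "cnj w"] norm_mult_less_one[of z w]
  by (auto simp: complex_nonpos_Reals_iff)

lemma one_minus_g_fun: "1 - g_fun z w = (norm (z - w))\<^sup>2 / (norm (1 - z * cnj w))\<^sup>2"
  by (simp add: g_fun_def norm_divide power_divide norm_one_minus_mult_cnj)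

lemma g_fun_eq:
  assumes "z \<in> \<D>" "w \<in> \<D>"
  shows "g_fun z w = (1 - (norm z)\<^sup>2) * (1 - (norm w)\<^sup>2) / (norm (1 - z * cnj w))\<^sup>2"
proof -
  have "(norm (1 - z * cnj w))\<^sup>2 - (norm (z - w))\<^sup>2 = (1 - (norm z)\<^sup>2) * (1 - (norm w)\<^sup>2)"
    unfolding cmod_power2 by (simp add: power2_eq_square algebra_simps)
  moreover have "norm (1 - z * cnj w) \<noteq> 0"
    using one_minus_mult_cnj_nonzero[OF assms] by simp
  ultimately show ?thesis
    using one_minus_g_fun[of z w] by (simp add: field_simps)
qed

lemma g_fun_commute:
  assumes "z \<in> \<D>" "w \<in> \<D>"
  shows "g_fun z w = g_fun w z"
proof -
  have "norm (1 - z * cnj w) = norm (1 - w * cnj z)"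
    using norm_one_minus_mult_cnj[of z w] by (simp add: mult.commute)
  then show ?thesis
    using assms by (simp add: g_fun_eq mult.commute)
qed

lemma norm_squared_less_one: "z \<in> \<D> \<Longrightarrow> 0 < 1 - (norm z)\<^sup>2" for z :: complex
  by (simp add: abs_square_less_1)

lemma g_fun_pos: "z \<in> \<D> \<Longrightarrow> w \<in> \<D> \<Longrightarrow> 0 < g_fun z w"
  using one_minus_mult_cnj_nonzero[of z w] norm_squared_less_one[of z] norm_squared_less_one[of w]
  by (auto simp: g_fun_eq intro!: divide_pos_pos mult_pos_pos)

lemma g_fun_less_one: "z \<in> \<D> \<Longrightarrow> w \<in> \<D> \<Longrightarrow> z \<noteq> w \<Longrightarrow> g_fun z w < 1"
  using one_minus_g_fun[of z w] one_minus_mult_cnj_nonzero[of z w]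
  by (smt (verit) zero_less_divide_iff zero_less_norm_iff zero_less_power right_minus_eq)

text \<open>The base of the power lies in the right half-plane, where the principal branch commutes
  with conjugation; the factor \<open>h_fun \<alpha> (g_fun z w)\<close> is real and
  symmetric.\<close>

lemma G_fun_commute:
  assumes "z \<in> \<D>" "w \<in> \<D>"
  shows "G_fun \<alpha> z w = cnj (G_fun \<alpha> w z)"
proof -
  have "Re (1 - cnj w * z) > 0"
    by (rule Re_one_minus_mult_pos) (use norm_mult_less_one[OF assms(2,1)] in simp)
  then have "cnj ((1 - cnj w * z) powr of_real \<alpha>) = cnj (1 - cnj w * z) powr cnj (of_real \<alpha>)"
    by (intro cnj_powr) auto
  also have "\<dots> = (1 - cnj z * w) powr of_real \<alpha>" by (simp add: mult.commute)
  finally show ?thesis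
    using g_fun_commute[OF assms] by (simp add: G_fun_def)
qed

section \<open>Wirtinger derivatives of G for a fixed pole w\<close>

locale disc_point =
  fixes \<alpha> :: real and w :: complex
  assumes \<alpha>: "\<alpha> > -1" and w: "w \<in> \<D>"
begin

definition c :: real where "c = 1 - (norm w)\<^sup>2"

definition Q :: "complex \<Rightarrow> complex" where "Q z = (1 - cnj z * w) powr of_real \<alpha>"

text \<open>The suffix \<open>A\<close> marks a d-derivative and \<open>B\<close> a dbar-derivative,
  here and in the names that follow. \<open>Q\<close> itself is antiholomorphic, so it has only the
  latter.\<close>

definition QB :: "complex \<Rightarrow> complex" where
  "QB z = - of_real \<alpha> * w * (1 - cnj z * w) powr (of_real \<alpha> - 1)"

text \<open>The d-derivative of \<open>h_fun \<alpha> (g_fun z w)\<close>; as this function is real,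
  its dbar-derivative is the conjugate.\<close>

definition HA :: "complex \<Rightarrow> complex" where
  "HA z = - of_real (g_fun z w powr \<alpha> * c) / ((1 - z * cnj w) * (z - w))"

definition GA :: "complex \<Rightarrow> complex" where "GA z = Q z * HA z"

definition GB :: "complex \<Rightarrow> complex" where
  "GB z = QB z * of_real (h_fun \<alpha> (g_fun z w)) + Q z * cnj (HA z)"

definition k :: "complex \<Rightarrow> complex" where
  "k z = of_real (c powr (\<alpha> + 1)) * (1 - z * cnj w) powr of_real (- (\<alpha> + 1))"

definition kA :: "complex \<Rightarrow> complex" where
  "kA z = of_real (c powr (\<alpha> + 1)) *
    (of_real (\<alpha> + 1) * cnj w * (1 - z * cnj w) powr (of_real (- (\<alpha> + 1)) - 1))"

lemma c_pos: "c > 0"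
  using norm_squared_less_one[OF w] by (simp add: c_def)

lemma G_fun_eq: "G_fun \<alpha> z w = Q z * of_real (h_fun \<alpha> (g_fun z w))"
  by (simp add: G_fun_def Q_def)

lemma cnj_not_nonpos: "1 - cnj z * w \<notin> \<real>\<^sub>\<le>\<^sub>0" if "z \<in> \<D>"
  using one_minus_mult_cnj_not_nonpos[OF w that] by (simp add: mult.commute)

text \<open>On the disc \<open>g\<close> equals \<open>c\<close> times 1 - |z|^2 times
  \<open>P z * cnj (P z)\<close> with \<open>P\<close> holomorphic, so the product rule applies with
  few terms.\<close>

lemma has_wirt_g_fun:
  assumes z: "z \<in> \<D>"
  defines "P \<equiv> \<lambda>z. 1 / (1 - z * cnj w)"
  shows "has_wirt (\<lambda>z. of_real (g_fun z w)) (of_real c * (cnj (P z) * (P z)\<^sup>2 * (cnj w - cnj z)))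
    (of_real c * (P z * (cnj (P z))\<^sup>2 * (w - z))) z"
proof -
  note nz = one_minus_mult_cnj_nonzero[OF z w]
  have P: "has_wirt P (cnj w * (P z)\<^sup>2) 0 z"
    unfolding P_def using nz
    by (intro has_wirt_field_derivative) (auto intro!: derivative_eq_intros simp: power2_eq_square)
  note prod = has_wirt_cmult[OF has_wirt_mult[OF has_wirt_norm_squared has_wirt_mult[OF P has_wirt_cnj[OF P]]]]
  have alg: "- cnj z * (P z * cnj (P z)) + of_real (1 - (norm z)\<^sup>2) * (cnj w * (P z)\<^sup>2 * cnj (P z))
      = cnj (P z) * (P z)\<^sup>2 * (cnj w - cnj z)"
  proof -
    have "P z * (1 - z * cnj w) = 1" using nz by (simp add: P_def)
    \<comment> \<open>Inserting the factor \<open>P z * (1 - z * cnj w) = 1\<close> gives both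
      summands the common factor \<open>cnj (P z) * (P z)\<^sup>2\<close>.\<close>
    then have *: "- cnj z * (P z * cnj (P z)) = - cnj z * (P z * cnj (P z)) * (P z * (1 - z * cnj w))"
      by simp
    have **: "complex_of_real (1 - (norm z)\<^sup>2) = 1 - z * cnj z"
      unfolding of_real_diff of_real_1 complex_norm_square ..
    show ?thesis
      unfolding ** by (subst *) (simp add: algebra_simps power2_eq_square)
  qed
  have alg': "- z * (P z * cnj (P z)) + of_real (1 - (norm z)\<^sup>2) * (P z * (w * (cnj (P z))\<^sup>2))
      = P z * (cnj (P z))\<^sup>2 * (w - z)"
  proof -
    have "cnj (P z * (cnj (P z))\<^sup>2 * (w - z)) = cnj (P z) * (P z)\<^sup>2 * (cnj w - cnj z)"
      by simp
    also have "\<dots> = cnj (- z * (P z * cnj (P z)) + of_real (1 - (norm z)\<^sup>2) * (P z * (w * (cnj (P z))\<^sup>2)))"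
      unfolding alg[symmetric] by (simp add: ac_simps)
    finally show ?thesis by (simp only: complex_cnj_cancel_iff)
  qed
  have "has_wirt (\<lambda>z. of_real c * (of_real (1 - (norm z)\<^sup>2) * (P z * cnj (P z))))
    (of_real c * (cnj (P z) * (P z)\<^sup>2 * (cnj w - cnj z))) (of_real c * (P z * (cnj (P z))\<^sup>2 * (w - z))) z"
    by (rule has_wirt_cong[OF prod], unfold alg[symmetric] alg'[symmetric]) simp_all
  then show ?thesis
  proof (rule has_wirt_transform)
    fix x :: complex assume "x \<in> \<D>"
    have "P x * cnj (P x) = of_real ((norm (P x))\<^sup>2)"
      by (simp only: complex_norm_square)
    also have "(norm (P x))\<^sup>2 = 1 / (norm (1 - x * cnj w))\<^sup>2"
      by (simp add: P_def norm_divide power_divide)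
    finally have "P x * cnj (P x) = of_real (1 / (norm (1 - x * cnj w))\<^sup>2)" .
    then show "of_real c * (of_real (1 - (norm x)\<^sup>2) * (P x * cnj (P x))) = of_real (g_fun x w)"
      using g_fun_eq[OF \<open>x \<in> \<D>\<close> w] by (simp add: c_def mult.commute)
  qed (use z in auto)
qed

text \<open>The derivative of h at \<open>g\<close> has the denominator \<open>1 - g\<close>, which
  contains |z - w|^2. The derivative of \<open>g\<close> contributes a factor
  \<open>cnj w - cnj z\<close>, so only a simple pole is left.\<close>

lemma has_wirt_h_g:
  assumes z: "z \<in> \<D>" "z \<noteq> w"
  shows "has_wirt (\<lambda>z. of_real (h_fun \<alpha> (g_fun z w))) (HA z) (cnj (HA z)) z"
proof -
  define g where "g = g_fun z w"
  note nz = one_minus_mult_cnj_nonzero[OF z(1) w]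
  have nz': "1 - cnj z * w \<noteq> 0" using nz by (metis complex_cnj_cnj complex_cnj_diff complex_cnj_mult complex_cnj_one complex_cnj_zero_iff)
  have zw: "z - w \<noteq> 0" "cnj z - cnj w \<noteq> 0" using z(2) by auto
  have "of_real (1 - g) = ((z - w) * (cnj z - cnj w)) / ((1 - z * cnj w) * (1 - cnj z * w))"
    unfolding g_def one_minus_g_fun of_real_divide complex_norm_square by simp
  then have d: "of_real (g powr \<alpha> / (1 - g)) =
      of_real (g powr \<alpha>) * ((1 - z * cnj w) * (1 - cnj z * w)) / ((z - w) * (cnj z - cnj w))"
    unfolding of_real_divide by simp
  have A: "of_real (g powr \<alpha> / (1 - g)) *
      (of_real c * (cnj (1 / (1 - z * cnj w)) * (1 / (1 - z * cnj w))\<^sup>2 * (cnj w - cnj z))) = HA z"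
    unfolding d HA_def g_def[symmetric] using nz nz' zw
    by (simp add: power2_eq_square divide_simps) (simp add: algebra_simps)
  have B: "of_real (g powr \<alpha> / (1 - g)) *
      (of_real c * ((1 / (1 - z * cnj w)) * (cnj (1 / (1 - z * cnj w)))\<^sup>2 * (w - z))) = cnj (HA z)"
    using arg_cong[OF A, of cnj] by (simp add: mult_ac)
  show ?thesis
    using has_wirt_comp_real[OF has_wirt_g_fun[OF z(1)] h_fun_has_derivative[OF \<alpha> g_fun_pos g_fun_less_one]]
      z w A B unfolding g_def by simp
qed

lemma has_wirt_Q:
  assumes "z \<in> \<D>"
  shows "has_wirt Q 0 (QB z) z"
proof -
  have *: "has_wirt (\<lambda>z. (1 - z * cnj w) powr of_real \<alpha>)
      (- of_real \<alpha> * cnj w * (1 - z * cnj w) powr (of_real \<alpha> - 1)) 0 z"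
    using one_minus_mult_cnj_not_nonpos[OF assms w]
    by (intro has_wirt_field_derivative) (auto intro!: derivative_eq_intros)
  have cnj: "cnj ((1 - z * cnj w) powr b) = (1 - cnj z * w) powr cnj b" if "z \<in> \<D>" for z b
    using Re_one_minus_mult_pos[of z "cnj w"] norm_mult_less_one[OF that w]
    by (subst cnj_powr) auto
  have "has_wirt (\<lambda>z. cnj ((1 - z * cnj w) powr of_real \<alpha>)) 0 (QB z) z"
    using has_wirt_cnj[OF *] cnj[OF assms] by (simp add: QB_def)
  then show ?thesis
    by (rule has_wirt_transform[where S = \<D>]) (use assms cnj in \<open>auto simp: Q_def\<close>)
qed

lemma has_wirt_G:
  assumes "z \<in> \<D>" "z \<noteq> w"
  shows "has_wirt (\<lambda>z. G_fun \<alpha> z w) (GA z) (GB z) z"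
  using has_wirt_mult[OF has_wirt_Q[OF assms(1)] has_wirt_h_g[OF assms]]
  unfolding G_fun_eq GA_def GB_def by simp

lemma has_wirt_k:
  assumes "z \<in> \<D>"
  shows "has_wirt k (kA z) 0 z"
  unfolding k_def[abs_def] kA_def using one_minus_mult_cnj_not_nonpos[OF assms w]
  by (intro has_wirt_cmult[of _ _ 0, simplified] has_wirt_field_derivative)
     (auto intro!: derivative_eq_intros simp: algebra_simps)

lemma k_w: "k w = 1"
proof -
  have "1 - w * cnj w = of_real c"
    by (simp add: c_def complex_norm_square[symmetric])
  then show ?thesis
    using c_pos by (simp only: k_def powr_of_real[OF less_imp_le] flip: of_real_mult)
      (simp flip: powr_add)
qed

text \<open>The weight cancels the power of 1 - |z|^2 in \<open>g powr \<alpha>\<close>. What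
  remains has |\<zeta>| to the power -2\<alpha>, and the factor \<open>Q\<close>, the conjugate of
  \<open>\<zeta> powr \<alpha>\<close>, turns this into the holomorphic inverse of
  \<open>\<zeta> powr \<alpha>\<close>: this is what the factor in front of h in G is for. At
  \<open>z = w\<close> both sides are 0, by division by zero.\<close>

lemma weighted_GA:
  assumes z: "z \<in> \<D>"
  shows "of_real ((1 - (norm z)\<^sup>2) powr (- \<alpha>)) * GA z = - (k z / (z - w))"
proof -
  define \<zeta> where "\<zeta> = 1 - z * cnj w"
  note nz = one_minus_mult_cnj_nonzero[OF z w, folded \<zeta>_def]
  define N where "N = 1 - (norm z)\<^sup>2"
  have N: "N > 0" using norm_squared_less_one[OF z] by (simp add: N_def)
  have g: "g_fun z w powr \<alpha> = N powr \<alpha> * c powr \<alpha> / (norm \<zeta>) powr \<alpha> / (norm \<zeta>) powr \<alpha>"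
    using g_fun_eq[OF z w] N c_pos nz
    by (simp add: N_def c_def \<zeta>_def powr_divide powr_mult power2_eq_square)
  have Q: "Q z = cnj (\<zeta> powr of_real \<alpha>)"
    using Re_one_minus_mult_pos[of z "cnj w"] norm_mult_less_one[OF z w]
    unfolding Q_def \<zeta>_def by (subst cnj_powr) auto
  have "cnj (\<zeta> powr of_real \<alpha>) * \<zeta> powr of_real \<alpha> = of_real ((norm \<zeta> powr \<alpha>)\<^sup>2)"
    using complex_norm_square[of "\<zeta> powr of_real \<alpha>"] by (simp add: norm_powr_real_powr' mult.commute)
  then have Q': "Q z = of_real (norm \<zeta> powr \<alpha>) * of_real (norm \<zeta> powr \<alpha>) / \<zeta> powr of_real \<alpha>"
    unfolding Q using nz by (simp add: field_simps power2_eq_square)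
  have k: "k z = of_real (c powr \<alpha> * c) / (\<zeta> powr of_real \<alpha> * \<zeta>)"
    unfolding k_def \<zeta>_def[symmetric] using nz c_pos
    by (simp add: powr_add powr_minus powr_diff field_simps)
  have NN: "N powr (- \<alpha>) * N powr \<alpha> = 1" using N by (simp flip: powr_add)
  define r p d where "r = complex_of_real (norm \<zeta> powr \<alpha>)" and "p = \<zeta> powr of_real \<alpha>" and "d = z - w"
  have nn: "r \<noteq> 0" "p \<noteq> 0" using nz by (auto simp: r_def p_def)
  have "of_real (N powr (- \<alpha>)) * GA z =
     - of_real (N powr (- \<alpha>) * N powr \<alpha>) * (of_real (c powr \<alpha> * c) / (\<zeta> powr of_real \<alpha> * \<zeta>)) / (z - w)"
    unfolding GA_def HA_def \<zeta>_def[symmetric] g Q' of_real_mult of_real_divide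
      r_def[symmetric] p_def[symmetric] d_def[symmetric]
    using nn nz by (simp add: mult_ac)
  then show ?thesis unfolding NN k by (simp add: N_def)
qed

end

section \<open>Test functions and the singularity on the diagonal\<close>

lemma Ck_lincomb: "Ck k f \<Longrightarrow> Ck k g \<Longrightarrow> Ck k (\<lambda>z. a * f z + b * g z)"
proof (induction k arbitrary: f g)
  case 0
  then show ?case by (auto intro!: continuous_intros)
next
  case (Suc k)
  have f: "f differentiable (at z)" "Ck k (\<lambda>z. frechet_derivative f (at z) 1)"
      "Ck k (\<lambda>z. frechet_derivative f (at z) \<i>)" for z
    using Suc.prems(1) by simp_all
  have g: "g differentiable (at z)" "Ck k (\<lambda>z. frechet_derivative g (at z) 1)"
      "Ck k (\<lambda>z. frechet_derivative g (at z) \<i>)" for z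
    using Suc.prems(2) by simp_all
  have der: "((\<lambda>z. a * f z + b * g z) has_derivative
      (\<lambda>v. a * frechet_derivative f (at z) v + b * frechet_derivative g (at z) v)) (at z)" for z
    by (intro has_derivative_add has_derivative_mult_right frechet_derivative_works[THEN iffD1] f(1) g(1))
  have "(\<lambda>z. a * f z + b * g z) differentiable (at z)" for z
    using der differentiableI by blast
  then show ?case
    using Suc.IH[OF f(2) g(2)] Suc.IH[OF f(3) g(3)]
    by (simp add: frechet_derivative_at[OF der, symmetric])
qed

text \<open>The partial derivatives and the Wirtinger derivatives are linear combinations of each
  other, so the induction on smoothness can be run on the latter.\<close>

lemma Ck_Suc_iff:
  "Ck (Suc k) f \<longleftrightarrow> (\<exists>A B. (\<forall>z. has_wirt f (A z) (B z) z) \<and> Ck k A \<and> Ck k B)"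
proof
  assume f: "Ck (Suc k) f"
  then have c: "Ck k (\<lambda>z. frechet_derivative f (at z) 1)" "Ck k (\<lambda>z. frechet_derivative f (at z) \<i>)"
    by simp_all
  have "wirt_d f = (\<lambda>z. (1/2) * frechet_derivative f (at z) 1 + (-\<i>/2) * frechet_derivative f (at z) \<i>)"
    "wirt_dbar f = (\<lambda>z. (1/2) * frechet_derivative f (at z) 1 + (\<i>/2) * frechet_derivative f (at z) \<i>)"
    by (auto simp: wirt_d_def wirt_dbar_def field_simps)
  then have "Ck k (wirt_d f)" "Ck k (wirt_dbar f)"
    by (simp_all only: Ck_lincomb[OF c])
  moreover have "\<forall>z. has_wirt f (wirt_d f z) (wirt_dbar f z) z"
    using f by (auto intro: has_wirt_frechet)
  ultimately show "\<exists>A B. (\<forall>z. has_wirt f (A z) (B z) z) \<and> Ck k A \<and> Ck k B" by blast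
next
  assume "\<exists>A B. (\<forall>z. has_wirt f (A z) (B z) z) \<and> Ck k A \<and> Ck k B"
  then obtain A B where w: "\<And>z. has_wirt f (A z) (B z) z" and AB: "Ck k A" "Ck k B" by blast
  then show "Ck (Suc k) f"
    using Ck_lincomb[OF AB, of 1 1] Ck_lincomb[OF AB, of \<i> "-\<i>"] has_wirt_differentiable[OF w]
    by (simp add: frechet_has_wirt[OF w] mult.commute)
qed

lemma Ck_imp_continuous: "Ck k f \<Longrightarrow> continuous_on UNIV f"
proof (cases k)
  case (Suc n)
  assume "Ck k f"
  then have "f differentiable (at z)" for z using Suc by simp
  then show ?thesis
    by (intro continuous_at_imp_continuous_on ballI differentiable_imp_continuous_within)
qed simp

lemma Ck_SucE:
  assumes "Ck (Suc k) f"
  obtains A B where "\<forall>z. has_wirt f (A z) (B z) z" "Ck k A" "Ck k B"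
proof -
  from Ck_Suc_iff[THEN iffD1, OF assms] show thesis
    by (elim exE conjE) (rule that)
qed

text \<open>Only what \<open>L_bar\<close> consumes is extracted: \<phi> is differentiated once, and
  its dbar-derivative once more.\<close>

lemma test_funD:
  assumes "\<phi> \<in> test_fun"
  obtains S \<phi>A \<phi>B \<phi>BA \<phi>BB where "compact S" "S \<subseteq> \<D>" "\<And>z. z \<notin> S \<Longrightarrow> \<phi> z = 0"
    "\<And>z. has_wirt \<phi> (\<phi>A z) (\<phi>B z) z" "continuous_on UNIV \<phi>A" "continuous_on UNIV \<phi>B"
    "\<And>z. has_wirt \<phi>B (\<phi>BA z) (\<phi>BB z) z" "continuous_on UNIV \<phi>BA" "continuous_on UNIV \<phi>BB"
proof -
  from assms have "\<forall>k. Ck k \<phi>" unfolding test_fun_def by blast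
  then have ck: "Ck (Suc (Suc 0)) \<phi>" by (rule spec)
  obtain A B where A: "\<forall>z. has_wirt \<phi> (A z) (B z) z" "Ck (Suc 0) A" and B: "Ck (Suc 0) B"
    by (rule Ck_SucE[OF ck])
  obtain BA BB where BA: "\<forall>z. has_wirt B (BA z) (BB z) z" "Ck 0 BA" "Ck 0 BB"
    by (rule Ck_SucE[OF B])
  have S: "compact (closure {z. \<phi> z \<noteq> 0})" "closure {z. \<phi> z \<noteq> 0} \<subseteq> \<D>"
    using assms by (simp_all add: test_fun_def)
  have off: "\<phi> z = 0" if "z \<notin> closure {z. \<phi> z \<noteq> 0}" for z
    using subsetD[OF closure_subset, of z "{z. \<phi> z \<noteq> 0}"] that by auto
  show thesis
    by (rule that[OF S off A(1)[rule_format] Ck_imp_continuous[OF A(2)] Ck_imp_continuous[OF B] BA(1)[rule_format]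
          Ck_imp_continuous[OF BA(2)] Ck_imp_continuous[OF BA(3)]])
qed

lemma has_wirt_zero_off_support:
  assumes "closed S" "\<And>z. z \<notin> S \<Longrightarrow> f z = 0" "has_wirt f A B z" "z \<notin> S"
  shows "A = 0" "B = 0"
  using wirt_d_eq[OF assms(3)] wirt_dbar_eq[OF assms(3)]
    wirt_d_eq[OF has_wirt_zero_off_closed[OF assms(1,4,2)]]
    wirt_dbar_eq[OF has_wirt_zero_off_closed[OF assms(1,4,2)]] by simp_all

text \<open>Nothing is assumed about \<open>q\<close> outside \<open>D\<close>: a point there has a
  neighbourhood free of the closed set \<open>S\<close>, on which the product is 0. This admits
  weights and kernels that are meaningful only on the disc.\<close>

lemma has_wirt_mult_support:
  assumes "closed S" "open D" "S \<subseteq> D" "\<And>z. z \<notin> S \<Longrightarrow> f z = 0"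
    and q: "\<And>z. z \<in> D \<Longrightarrow> has_wirt q (qA z) (qB z) z"
    and f: "\<And>z. has_wirt f (fA z) (fB z) z"
  shows "has_wirt (\<lambda>z. q z * f z) (qA z * f z + q z * fA z) (qB z * f z + q z * fB z) z"
proof (cases "z \<in> D")
  case True
  then show ?thesis by (intro has_wirt_mult q f)
next
  case False
  with assms(3) have "z \<notin> S" by blast
  then have "f z = 0" "fA z = 0" "fB z = 0"
    using has_wirt_zero_off_support[OF assms(1,4) f] assms(4) by auto
  then show ?thesis
    using has_wirt_zero_off_closed[OF \<open>closed S\<close> \<open>z \<notin> S\<close>, of "\<lambda>z. q z * f z"] assms(4) by simp
qed

lemma continuous_on_support:
  fixes f :: "complex \<Rightarrow> complex"
  assumes "open V" "closed S" "continuous_on V f" "\<And>z. z \<notin> S \<Longrightarrow> f z = 0" "W \<subseteq> V \<union> - S"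
  shows "continuous_on W f"
proof -
  have "continuous_on (- S) f \<longleftrightarrow> continuous_on (- S) (\<lambda>_. 0 :: complex)"
    by (rule continuous_on_cong) (use assms(4) in auto)
  then have "continuous_on (V \<union> - S) f"
    using assms by (intro continuous_on_open_Un) auto
  then show ?thesis using assms(5) by (rule continuous_on_subset)
qed

section \<open>Continuity and size of the weight, of G and of its derivatives\<close>

lemma has_wirt_weight:
  assumes "z \<in> \<D>"
  shows "has_wirt (\<lambda>z. of_real ((1 - (norm z)\<^sup>2) powr b))
    (of_real (b * (1 - (norm z)\<^sup>2) powr (b - 1)) * - cnj z)
    (of_real (b * (1 - (norm z)\<^sup>2) powr (b - 1)) * - z) z"
  by (rule has_wirt_comp_real[OF has_wirt_norm_squared]) (rule has_real_derivative_powr[OF norm_squared_less_one[OF assms]])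

lemma continuous_on_weight: "continuous_on \<D> (\<lambda>z. (1 - (norm z)\<^sup>2) powr b)"
  by (intro continuous_intros ballI) (rule less_imp_neq[OF norm_squared_less_one, symmetric])

context disc_point
begin

lemma continuous_on_g_fun: "continuous_on \<D> (\<lambda>z. g_fun z w)"
proof -
  have "continuous_on \<D> (\<lambda>z. Re (of_real (g_fun z w)))"
    by (intro continuous_on_Re continuous_at_imp_continuous_on ballI)
       (rule has_wirt_isCont[OF has_wirt_g_fun])
  then show ?thesis by simp
qed

lemma continuous_on_Q: "continuous_on \<D> Q"
  by (intro continuous_at_imp_continuous_on ballI) (rule has_wirt_isCont[OF has_wirt_Q])

lemma continuous_on_QB: "continuous_on \<D> QB"
  unfolding QB_def[abs_def]
  by (intro continuous_at_imp_continuous_on ballI continuous_intros cnj_not_nonpos)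

lemma continuous_on_g_powr: "continuous_on \<D> (\<lambda>z. g_fun z w powr b)"
  using g_fun_pos[OF _ w] by (intro continuous_intros continuous_on_g_fun) force

lemma continuous_on_HA: "continuous_on (\<D> - {w}) HA"
  unfolding HA_def[abs_def]
  by (intro continuous_intros continuous_on_subset[OF continuous_on_g_powr])
     (use one_minus_mult_cnj_nonzero[OF _ w] in auto)

lemma continuous_on_h_g: "continuous_on (\<D> - {w}) (\<lambda>z. complex_of_real (h_fun \<alpha> (g_fun z w)))"
  by (intro continuous_at_imp_continuous_on ballI) (rule has_wirt_isCont[OF has_wirt_h_g]; auto)

lemma continuous_on_G: "continuous_on (\<D> - {w}) (\<lambda>z. G_fun \<alpha> z w)"
  unfolding G_fun_eq by (intro continuous_intros continuous_on_h_g continuous_on_subset[OF continuous_on_Q]) auto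

lemma continuous_on_GA: "continuous_on (\<D> - {w}) GA"
  unfolding GA_def[abs_def] by (intro continuous_intros continuous_on_HA continuous_on_subset[OF continuous_on_Q]) auto

lemma continuous_on_GB: "continuous_on (\<D> - {w}) GB"
  unfolding GB_def[abs_def]
  by (intro continuous_intros continuous_on_HA continuous_on_h_g
      continuous_on_subset[OF continuous_on_Q] continuous_on_subset[OF continuous_on_QB]) auto

text \<open>A bound with two uses: the denominator controls the singularity at \<open>w\<close>, and
  the factor \<open>g powr (\<alpha> + 1)\<close> yields the decay at the circle.\<close>

lemma h_g_le:
  assumes "z \<in> \<D>" "z \<noteq> w"
  shows "h_fun \<alpha> (g_fun z w)
    \<le> (1 / (\<alpha> + 1) + 2) * g_fun z w powr (\<alpha> + 1) * norm (1 - z * cnj w) / norm (z - w)"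
proof -
  have "sqrt (1 - g_fun z w) = norm (z - w) / norm (1 - z * cnj w)"
    unfolding one_minus_g_fun by (simp add: real_sqrt_divide)
  then show ?thesis
    using h_fun_le[OF \<alpha> less_imp_le[OF g_fun_pos[OF assms(1) w]] g_fun_less_one[OF assms(1) w assms(2)]]
    by simp
qed

lemma G_singularity:
  assumes "compact K" "K \<subseteq> \<D>"
  obtains C where "\<And>z. z \<in> K \<Longrightarrow> z \<noteq> w \<Longrightarrow> norm (G_fun \<alpha> z w) \<le> C / norm (z - w)"
    "\<And>z. z \<in> K \<Longrightarrow> z \<noteq> w \<Longrightarrow> norm (GA z) \<le> C / norm (z - w)"
    "\<And>z. z \<in> K \<Longrightarrow> z \<noteq> w \<Longrightarrow> norm (GB z) \<le> C / norm (z - w)"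
proof -
  define M where "M = 1 / (\<alpha> + 1) + 2"
  define b where "b = (\<lambda>z. M * g_fun z w powr (\<alpha> + 1) * norm (1 - z * cnj w))"
  define e where "e = (\<lambda>z. norm (Q z) * (g_fun z w powr \<alpha> * c / norm (1 - z * cnj w)))"
  note sub = continuous_on_subset[OF _ assms(2)]
  have den: "continuous_on K (\<lambda>z. norm (1 - z * cnj w))"
    by (intro continuous_intros)
  have den0: "\<forall>z\<in>K. norm (1 - z * cnj w) \<noteq> 0"
    using one_minus_mult_cnj_nonzero[OF _ w] assms(2) unfolding norm_eq_zero by blast
  have b_cont: "continuous_on K b"
    unfolding b_def by (intro continuous_on_mult continuous_on_const den sub[OF continuous_on_g_powr])
  have e_cont: "continuous_on K e"
    unfolding e_def by (intro continuous_on_mult continuous_on_divide continuous_on_const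
        continuous_on_norm[OF sub[OF continuous_on_Q]] den den0 sub[OF continuous_on_g_powr])
  \<comment> \<open>One continuous majorant serves all three estimates, its terms being nonnegative:
    the first bounds G, the last bounds \<open>GA\<close>, and the last two together bound
    \<open>GB\<close>, each up to the factor 1/|z - w|.\<close>
  have "continuous_on K (\<lambda>z. norm (Q z) * b z + norm (QB z) * b z + e z)"
    by (intro continuous_on_add continuous_on_mult b_cont e_cont
        continuous_on_norm[OF sub[OF continuous_on_Q]] continuous_on_norm[OF sub[OF continuous_on_QB]])
  then have "bounded ((\<lambda>z. norm (Q z) * b z + norm (QB z) * b z + e z) ` K)"
    using assms(1) by (intro compact_imp_bounded compact_continuous_image)
  then obtain C where C: "\<And>z. z \<in> K \<Longrightarrow> \<bar>norm (Q z) * b z + norm (QB z) * b z + e z\<bar> \<le> C"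
    unfolding bounded_iff ball_simps real_norm_def by blast
  have M: "M > 0" using \<alpha> by (simp add: M_def add_pos_pos)
  have b: "b z \<ge> 0" and e: "e z \<ge> 0" for z
    unfolding b_def e_def using M c_pos
    by (intro mult_nonneg_nonneg divide_nonneg_nonneg norm_ge_zero powr_ge_zero less_imp_le[OF M] less_imp_le[OF c_pos])+
  have C': "norm (Q z) * b z \<le> C" "e z \<le> C" "norm (QB z) * b z + e z \<le> C" if "z \<in> K" for z
  proof -
    have "0 \<le> norm (Q z) * b z" "0 \<le> norm (QB z) * b z"
      by (intro mult_nonneg_nonneg norm_ge_zero b)+
    then show "norm (Q z) * b z \<le> C" "e z \<le> C" "norm (QB z) * b z + e z \<le> C"
      using abs_le_D1[OF C[OF that]] e[of z] by linarith+
  qed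
  have H: "norm (complex_of_real (h_fun \<alpha> (g_fun z w))) \<le> b z / norm (z - w)" if "z \<in> K" "z \<noteq> w" for z
  proof -
    have z: "z \<in> \<D>" using that assms(2) by blast
    have "0 \<le> h_fun \<alpha> (g_fun z w)"
      by (rule h_fun_nonneg[OF g_fun_less_one[OF z w that(2)]])
    then show ?thesis
      using h_g_le[OF z that(2)] unfolding b_def M_def norm_of_real by linarith
  qed
  have HA: "norm (Q z) * norm (HA z) \<le> e z / norm (z - w)" for z
  proof -
    have "norm (HA z) = g_fun z w powr \<alpha> * c / (norm (1 - z * cnj w) * norm (z - w))"
      using c_pos unfolding HA_def norm_divide norm_mult norm_minus_cancel norm_of_real by simp
    then show ?thesis by (simp add: e_def)
  qed
  show thesis
  proof
    fix z assume z: "z \<in> K" "z \<noteq> w"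
    have "norm (G_fun \<alpha> z w) \<le> norm (Q z) * (b z / norm (z - w))"
      unfolding G_fun_eq norm_mult[of "Q z"] by (intro mult_left_mono H z norm_ge_zero)
    also have "\<dots> \<le> C / norm (z - w)" using C'[OF z(1)] by (simp add: divide_right_mono)
    finally show "norm (G_fun \<alpha> z w) \<le> C / norm (z - w)" .
    have "norm (GA z) \<le> e z / norm (z - w)"
      unfolding GA_def norm_mult by (rule HA)
    also have "\<dots> \<le> C / norm (z - w)" using C'[OF z(1)] by (simp add: divide_right_mono)
    finally show "norm (GA z) \<le> C / norm (z - w)" .
    have "norm (GB z) \<le> norm (QB z) * (b z / norm (z - w)) + e z / norm (z - w)"
    proof -
      have "norm (QB z * of_real (h_fun \<alpha> (g_fun z w))) \<le> norm (QB z) * (b z / norm (z - w))"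
        unfolding norm_mult[of "QB z"] by (intro mult_left_mono H z norm_ge_zero)
      moreover have "norm (Q z * cnj (HA z)) \<le> e z / norm (z - w)"
        unfolding norm_mult complex_mod_cnj by (rule HA)
      ultimately show ?thesis
        unfolding GB_def by (intro norm_triangle_le add_mono)
    qed
    also have "\<dots> \<le> C / norm (z - w)"
      using divide_right_mono[OF C'(3)[OF z(1)], of "norm (z - w)"] by (simp add: add_divide_distrib)
    finally show "norm (GB z) \<le> C / norm (z - w)" .
  qed
qed

end

section \<open>The fundamental solution property\<close>

context disc_point
begin

lemma G_fun_L1_loc: "(\<lambda>z. G_fun \<alpha> z w) \<in> L1_loc"
  unfolding L1_loc_def
proof (intro CollectI allI impI, elim conjE)
  fix K :: "complex set" assume K: "compact K" "K \<subseteq> \<D>"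
  obtain C where C: "\<And>z. z \<in> K \<Longrightarrow> z \<noteq> w \<Longrightarrow> norm (G_fun \<alpha> z w) \<le> C / norm (z - w)"
    by (rule G_singularity[OF K]) (rule that)
  \<comment> \<open>The pole is cut out so that \<open>G\<close> is continuous on the remaining
    Borel set; the value at \<open>w\<close> is put back below as a function carried by at most one
    point.\<close>
  define F where "F = (\<lambda>z. indicator (K - {w}) z *\<^sub>R G_fun \<alpha> z w)"
  have "F \<in> borel_measurable borel"
    unfolding F_def using K
    by (intro borel_measurable_continuous_on_indicator continuous_on_subset[OF continuous_on_G])
       (auto intro: borel_closed compact_imp_closed)
  moreover have "norm (F z) \<le> max 0 C / norm (z - w)" if "z \<noteq> w" for z
  proof (cases "z \<in> K")
    case True
    have "C / norm (z - w) \<le> max 0 C / norm (z - w)" by (intro divide_right_mono) auto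
    with C[OF True that] have "norm (G_fun \<alpha> z w) \<le> max 0 C / norm (z - w)" by linarith
    then show ?thesis using True that by (simp add: F_def)
  qed (simp add: F_def)
  moreover have "F z = 0" if "norm z \<ge> 1" for z
  proof -
    have "z \<notin> K" using that K(2) by auto
    then show ?thesis by (simp add: F_def)
  qed
  ultimately have "integrable lborel F"
    by (rule integrable_weak_singularity)
  then have "integrable lebesgue F" 
    by (subst integrable_completion) auto
  moreover have "indicator K z *\<^sub>R G_fun \<alpha> z w = F z + indicator (K \<inter> {w}) z *\<^sub>R G_fun \<alpha> w w" for z
    by (auto simp: F_def indicator_def)
  moreover have "integrable lebesgue (\<lambda>z. indicator (K \<inter> {w}) z *\<^sub>R G_fun \<alpha> w w)"
  proof (rule integrable_scaleR_left, rule integrable_real_indicator)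
    have fin: "finite (K \<inter> {w})" by simp
    then show "K \<inter> {w} \<in> sets lebesgue"
      by (intro sets_completionI_sets) (simp add: borel_closed finite_imp_closed)
    show "emeasure lebesgue (K \<inter> {w}) < \<infinity>"
      using emeasure_bounded_finite[OF finite_imp_bounded[OF fin]] borel_closed[OF finite_imp_closed[OF fin]]
      by (simp add: emeasure_completion main_part_sets)
  qed
  ultimately show "(\<lambda>z. G_fun \<alpha> z w) absolutely_integrable_on K"
    by (simp add: set_integrable_def)
qed

text \<open>Since \<alpha> + 1 > 0, the factor \<open>g powr (\<alpha> + 1)\<close> tends to 0 with
  \<open>g\<close>. The other factors have finite limits, because |w| < 1 keeps both
  \<open>1 - \<zeta> * cnj w\<close> and \<open>\<zeta> - w\<close> away from 0.\<close>

lemma G_fun_boundary: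
  assumes "\<zeta> \<in> sphere 0 1"
  shows "((\<lambda>z. G_fun \<alpha> z w) \<longlongrightarrow> 0) (at \<zeta> within \<D>)"
proof -
  \<comment> \<open>The closed form of \<open>g_fun\<close>, whose limit 0 at the boundary point can
    be read off.\<close>
  define g where "g = (\<lambda>z. (1 - (norm z)\<^sup>2) * c / (norm (1 - z * cnj w))\<^sup>2)"
  define M where "M = 1 / (\<alpha> + 1) + 2"
  have \<zeta>: "norm \<zeta> = 1" using assms by simp
  have w1: "norm w < 1" using w by simp
  have "\<zeta> \<noteq> w" using \<zeta> w1 by auto
  have "Re (1 - \<zeta> * cnj w) > 0" "Re (1 - cnj \<zeta> * w) > 0"
    by (rule Re_one_minus_mult_pos, use \<zeta> w1 in simp)+
  then have nz: "1 - \<zeta> * cnj w \<noteq> 0" and np: "1 - cnj \<zeta> * w \<notin> \<real>\<^sub>\<le>\<^sub>0"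
    by (force, force simp: complex_nonpos_Reals_iff)
  let ?F = "at \<zeta> within \<D>"
  have id: "((\<lambda>z. z) \<longlongrightarrow> \<zeta>) ?F" by (rule tendsto_ident_at)
  have "(g \<longlongrightarrow> (1 - (norm \<zeta>)\<^sup>2) * c / (norm (1 - \<zeta> * cnj w))\<^sup>2) ?F"
    unfolding g_def using nz by (intro tendsto_intros id) simp
  then have "(g \<longlongrightarrow> 0) ?F" using \<zeta> by simp
  moreover have "\<forall>\<^sub>F z in ?F. 0 \<le> g z"
    unfolding eventually_at_filter
    using norm_squared_less_one c_pos by (intro always_eventually) (auto simp: g_def less_imp_le)
  ultimately have lim_g: "((\<lambda>z. g z powr (\<alpha> + 1)) \<longlongrightarrow> 0 powr (\<alpha> + 1)) ?F"
    using \<alpha> by (intro tendsto_powr' tendsto_const) auto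
  have lim_Q: "(Q \<longlongrightarrow> (1 - cnj \<zeta> * w) powr of_real \<alpha>) ?F"
    unfolding Q_def[abs_def] using np by (intro tendsto_intros id) simp
  have "((\<lambda>z. norm (Q z) * (M * g z powr (\<alpha> + 1) * norm (1 - z * cnj w) / norm (z - w))) \<longlongrightarrow>
      norm ((1 - cnj \<zeta> * w) powr of_real \<alpha>) *
      (M * 0 powr (\<alpha> + 1) * norm (1 - \<zeta> * cnj w) / norm (\<zeta> - w))) ?F"
    using \<open>\<zeta> \<noteq> w\<close> by (intro tendsto_intros lim_Q lim_g id) simp
  then have lim: "((\<lambda>z. norm (Q z) * (M * g z powr (\<alpha> + 1) * norm (1 - z * cnj w) / norm (z - w))) \<longlongrightarrow> 0) ?F"
    by simp
  have "\<forall>\<^sub>F z in ?F. z \<noteq> w"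
    using tendsto_imp_eventually_ne[OF id \<open>\<zeta> \<noteq> w\<close>] .
  moreover have "\<forall>\<^sub>F z in ?F. z \<in> \<D>"
    by (simp add: eventually_at_filter)
  ultimately have "\<forall>\<^sub>F z in ?F. norm (G_fun \<alpha> z w)
      \<le> norm (Q z) * (M * g z powr (\<alpha> + 1) * norm (1 - z * cnj w) / norm (z - w))"
  proof eventually_elim
    case (elim z)
    have "norm (complex_of_real (h_fun \<alpha> (g_fun z w)))
        \<le> M * g_fun z w powr (\<alpha> + 1) * norm (1 - z * cnj w) / norm (z - w)"
      using h_g_le[OF elim(2,1)] h_fun_nonneg[OF g_fun_less_one[OF elim(2) w elim(1)], of \<alpha>]
      unfolding M_def norm_of_real by linarith
    moreover have "g_fun z w = g z"
      using g_fun_eq[OF elim(2) w] by (simp add: g_def c_def)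
    ultimately show ?case
      unfolding G_fun_eq norm_mult[of "Q z"] by (simp only: mult_left_mono norm_ge_zero)
  qed
  from Lim_null_comparison[OF this lim] show ?thesis .
qed

text \<open>With \<open>\<psi> = a * \<phi>B\<close>, the function
  \<open>L_bar \<alpha> \<phi>\<close> is minus the d-derivative of \<open>\<psi>\<close>. This
  derivative is moved onto \<open>G\<close>, the weight \<open>a\<close> is regrouped with
  \<open>GA\<close>, and \<open>weighted_GA\<close> leaves a Cauchy kernel.\<close>

lemma distr_G_fun:
  assumes "\<phi> \<in> test_fun"
  shows "distr_of (\<lambda>z. G_fun \<alpha> z w) (L_bar \<alpha> \<phi>) = \<phi> w"
  using assms
proof (rule test_funD)
  fix S \<phi>A \<phi>B \<phi>BA \<phi>BB
  assume S: "compact S" "S \<subseteq> \<D>" and \<phi>0: "\<And>z. z \<notin> S \<Longrightarrow> \<phi> z = 0"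
    and w\<phi>: "\<And>z. has_wirt \<phi> (\<phi>A z) (\<phi>B z) z"
    and c\<phi>A: "continuous_on UNIV \<phi>A" and c\<phi>B: "continuous_on UNIV \<phi>B"
    and w\<phi>B: "\<And>z. has_wirt \<phi>B (\<phi>BA z) (\<phi>BB z) z"
    and c\<phi>BA: "continuous_on UNIV \<phi>BA" and c\<phi>BB: "continuous_on UNIV \<phi>BB"
  have cl: "closed S" using S(1) by (rule compact_imp_closed)
  have far: "z \<notin> S" if "norm z \<ge> 1" for z using that S(2) by auto
  note off = has_wirt_zero_off_support[OF cl]
  have \<phi>AB0: "\<phi>A z = 0" "\<phi>B z = 0" if "z \<notin> S" for z
    using off[OF \<phi>0 w\<phi> that] by auto
  have \<phi>B0: "\<phi>BA z = 0" "\<phi>BB z = 0" if "z \<notin> S" for z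
    using off[OF \<phi>AB0(2) w\<phi>B that] by auto
  define a where "a = (\<lambda>z::complex. complex_of_real ((1 - (norm z)\<^sup>2) powr (- \<alpha>)))"
  define a' where "a' = (\<lambda>z::complex. complex_of_real (- \<alpha> * (1 - (norm z)\<^sup>2) powr (- \<alpha> - 1)))"
  define \<psi> where "\<psi> = (\<lambda>z. a z * \<phi>B z)"
  define \<psi>A where "\<psi>A = (\<lambda>z. a' z * - cnj z * \<phi>B z + a z * \<phi>BA z)"
  define \<psi>B where "\<psi>B = (\<lambda>z. a' z * - z * \<phi>B z + a z * \<phi>BB z)"
  have w\<psi>: "has_wirt \<psi> (\<psi>A z) (\<psi>B z) z" for z
    unfolding \<psi>_def \<psi>A_def \<psi>B_def a_def a'_def
    by (rule has_wirt_mult_support[OF cl open_ball S(2) \<phi>AB0(2) has_wirt_weight w\<phi>B])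
  have \<psi>0: "\<psi> z = 0" "\<psi>A z = 0" "\<psi>B z = 0" if "z \<notin> S" for z
    using \<phi>AB0[OF that] \<phi>B0[OF that] by (simp_all add: \<psi>_def \<psi>A_def \<psi>B_def)
  have ca: "continuous_on \<D> a" and ca': "continuous_on \<D> a'"
    unfolding a_def a'_def by (intro continuous_on_of_real continuous_on_mult continuous_on_const continuous_on_weight)+
  have contS: "continuous_on UNIV f" if "continuous_on \<D> f" "\<And>z. z \<notin> S \<Longrightarrow> f z = 0"
    for f :: "complex \<Rightarrow> complex"
  proof (rule continuous_on_support[OF open_ball cl that])
    show "UNIV \<subseteq> \<D> \<union> - S" using S(2) by blast
  qed
  note subD = continuous_on_subset[OF _ subset_UNIV, of _ \<D>]
  have c\<psi>: "continuous_on UNIV \<psi>"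
  proof (rule contS)
    show "continuous_on \<D> \<psi>" unfolding \<psi>_def by (intro continuous_on_mult ca subD[OF c\<phi>B])
  qed (rule \<psi>0)
  have c\<psi>A: "continuous_on UNIV \<psi>A"
  proof (rule contS)
    show "continuous_on \<D> \<psi>A"
      unfolding \<psi>A_def by (intro continuous_on_mult continuous_on_add continuous_on_minus
          continuous_on_cnj continuous_on_id ca ca' subD[OF c\<phi>B] subD[OF c\<phi>BA])
  qed (rule \<psi>0)
  have c\<psi>B: "continuous_on UNIV \<psi>B"
  proof (rule contS)
    show "continuous_on \<D> \<psi>B"
      unfolding \<psi>B_def by (intro continuous_on_mult continuous_on_add continuous_on_minus
          continuous_on_id ca ca' subD[OF c\<phi>B] subD[OF c\<phi>BB])
  qed (rule \<psi>0)
  have \<psi>1: "\<psi> z = 0" "\<psi>A z = 0" "\<psi>B z = 0" if "norm z \<ge> 1" for z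
    by (rule \<psi>0[OF far[OF that]])+
  obtain D0 where D0: "D0 \<ge> 0" "\<And>z. norm (\<psi> z) \<le> D0"
    using continuous_compact_support_bounded[OF c\<psi>] \<psi>1(1) by metis
  obtain DA where DA: "DA \<ge> 0" "\<And>z. norm (\<psi>A z) \<le> DA"
    using continuous_compact_support_bounded[OF c\<psi>A] \<psi>1(2) by metis
  obtain DB where DB: "DB \<ge> 0" "\<And>z. norm (\<psi>B z) \<le> DB"
    using continuous_compact_support_bounded[OF c\<psi>B] \<psi>1(3) by metis
  obtain C where C: "\<And>z. z \<in> S \<Longrightarrow> z \<noteq> w \<Longrightarrow> norm (G_fun \<alpha> z w) \<le> C / norm (z - w)"
    "\<And>z. z \<in> S \<Longrightarrow> z \<noteq> w \<Longrightarrow> norm (GA z) \<le> C / norm (z - w)"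
    "\<And>z. z \<in> S \<Longrightarrow> z \<noteq> w \<Longrightarrow> norm (GB z) \<le> C / norm (z - w)"
    using G_singularity[OF S] by blast
  have integ: "integrable lborel (\<lambda>z. q z * f z)"
    if q: "continuous_on (\<D> - {w}) q" "\<And>z. z \<in> S \<Longrightarrow> z \<noteq> w \<Longrightarrow> norm (q z) \<le> C / norm (z - w)"
      and f: "continuous_on UNIV f" "\<And>z. z \<notin> S \<Longrightarrow> f z = 0" and D: "D \<ge> 0" "\<And>z. norm (f z) \<le> D"
    for q f :: "complex \<Rightarrow> complex" and D
  proof (rule integrable_weak_singularity)
    have "continuous_on (- {w}) (\<lambda>z. q z * f z)"
    proof (rule continuous_on_support[OF _ cl])
      show "open (\<D> - {w})" by auto
      show "continuous_on (\<D> - {w}) (\<lambda>z. q z * f z)"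
        by (intro continuous_on_mult q(1) continuous_on_subset[OF f(1)] subset_UNIV)
      show "q z * f z = 0" if "z \<notin> S" for z using f(2)[OF that] by simp
      show "- {w} \<subseteq> \<D> - {w} \<union> - S" using S(2) by blast
    qed
    then show "(\<lambda>z. q z * f z) \<in> borel_measurable borel"
      by (rule borel_measurable_continuous_off_point)
    show "norm (q z * f z) \<le> \<bar>C * D\<bar> / norm (z - w)" if z: "z \<noteq> w" for z
    proof (cases "z \<in> S")
      case True
      have "norm (q z * f z) \<le> C / norm (z - w) * D"
        unfolding norm_mult by (rule mult_mono'[OF q(2)[OF True z] D(2) norm_ge_zero norm_ge_zero])
      also have "\<dots> \<le> \<bar>C * D\<bar> / norm (z - w)"
        unfolding times_divide_eq_left by (rule divide_right_mono[OF abs_ge_self norm_ge_zero])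
      finally show ?thesis .
    next
      case False
      then show ?thesis using f(2)[OF False] by simp
    qed
    show "q z * f z = 0" if "norm z \<ge> 1" for z
      using f(2)[OF far[OF that]] by simp
  qed
  have iGA: "integrable lborel (\<lambda>z. GA z * \<psi> z)"
    by (rule integ[OF continuous_on_GA C(2) c\<psi> \<psi>0(1) D0])
  \<comment> \<open>Only the d-derivative is wanted in the end, but the argument along real lines
    needs both Wirtinger derivatives to be integrable.\<close>
  have iGB: "integrable lborel (\<lambda>z. GB z * \<psi> z)"
    by (rule integ[OF continuous_on_GB C(3) c\<psi> \<psi>0(1) D0])
  have iA: "integrable lborel (\<lambda>z. G_fun \<alpha> z w * \<psi>A z)"
    by (rule integ[OF continuous_on_G C(1) c\<psi>A \<psi>0(2) DA])
  have iB: "integrable lborel (\<lambda>z. G_fun \<alpha> z w * \<psi>B z)"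
    by (rule integ[OF continuous_on_G C(1) c\<psi>B \<psi>0(3) DB])
  have wG: "has_wirt (\<lambda>z. G_fun \<alpha> z w * \<psi> z) (GA z * \<psi> z + G_fun \<alpha> z w * \<psi>A z)
      (GB z * \<psi> z + G_fun \<alpha> z w * \<psi>B z) z" if "z \<noteq> w" for z
  proof (cases "z \<in> S")
    case True
    then show ?thesis using that S(2) by (intro has_wirt_mult has_wirt_G w\<psi>) auto
  next
    case False
    have "has_wirt (\<lambda>z. G_fun \<alpha> z w * \<psi> z) 0 0 z"
      by (rule has_wirt_zero_off_closed[OF cl False]) (simp add: \<psi>0)
    then show ?thesis using \<psi>0[OF False] by simp
  qed
  have "(\<integral>z. GA z * \<psi> z + G_fun \<alpha> z w * \<psi>A z \<partial>lborel) = 0"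
  proof (rule integral_wirt_zero(1)[where F = "\<lambda>z. G_fun \<alpha> z w * \<psi> z" and E = "{w}" and w = w and R = 1
        and B = "\<lambda>z. GB z * \<psi> z + G_fun \<alpha> z w * \<psi>B z"])
    show "finite {x. Complex x y \<in> {w}}" for y
      by (rule finite_subset[of _ "{Re w}"]) auto
    show "finite {y. Complex x y \<in> {w}}" for x
      by (rule finite_subset[of _ "{Im w}"]) auto
    show "isCont (\<lambda>z. G_fun \<alpha> z w * \<psi> z) z" if "z \<noteq> w" for z
      by (rule has_wirt_isCont[OF wG[OF that]])
    show "integrable lborel (\<lambda>z. GA z * \<psi> z + G_fun \<alpha> z w * \<psi>A z)"
      by (rule Bochner_Integration.integrable_add[OF iGA iA])
    show "integrable lborel (\<lambda>z. GB z * \<psi> z + G_fun \<alpha> z w * \<psi>B z)"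
      by (rule Bochner_Integration.integrable_add[OF iGB iB])
    show "has_wirt (\<lambda>z. G_fun \<alpha> z w * \<psi> z) (GA z * \<psi> z + G_fun \<alpha> z w * \<psi>A z)
      (GB z * \<psi> z + G_fun \<alpha> z w * \<psi>B z) z" if "z \<notin> {w}" for z
      using wG that by simp
    show "G_fun \<alpha> z w * \<psi> z = 0 \<and> GA z * \<psi> z + G_fun \<alpha> z w * \<psi>A z = 0 \<and>
        GB z * \<psi> z + G_fun \<alpha> z w * \<psi>B z = 0" if "norm z \<ge> 1" for z
      using \<psi>0[OF far[OF that]] by simp
  qed
  then have 1: "(\<integral>z. G_fun \<alpha> z w * \<psi>A z \<partial>lborel) = - (\<integral>z. GA z * \<psi> z \<partial>lborel)"
    using iGA iA by (simp add: add_eq_0_iff)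
  have "GA z * \<psi> z = - (k z * \<phi>B z / (z - w))" for z
  proof (cases "z \<in> S")
    case True
    then have "z \<in> \<D>" using S(2) by blast
    have "GA z * \<psi> z = (a z * GA z) * \<phi>B z" by (simp add: \<psi>_def)
    also have "\<dots> = - (k z / (z - w)) * \<phi>B z"
      unfolding a_def weighted_GA[OF \<open>z \<in> \<D>\<close>] ..
    finally show ?thesis by simp
  qed (simp add: \<phi>AB0 \<psi>0)
  then have "(\<integral>z. GA z * \<psi> z \<partial>lborel) = - (\<integral>z. k z * \<phi>B z / (z - w) \<partial>lborel)"
    by simp
  \<comment> \<open>Since \<open>k\<close> is holomorphic, \<open>k z * \<phi>B z\<close> is the
    whole dbar-derivative of \<open>k z * \<phi> z\<close>.\<close>
  also have "(\<integral>z. k z * \<phi>B z / (z - w) \<partial>lborel) = - of_real pi * (k w * \<phi> w)"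
  proof (rule Cauchy_Pompeiu[where f = "\<lambda>z. k z * \<phi> z" and B = "\<lambda>z. k z * \<phi>B z"
        and A = "\<lambda>z. kA z * \<phi> z + k z * \<phi>A z" and R = 1])
    show "has_wirt (\<lambda>z. k z * \<phi> z) (kA z * \<phi> z + k z * \<phi>A z) (k z * \<phi>B z) z" for z
      using has_wirt_mult_support[OF cl open_ball S(2) \<phi>0 has_wirt_k w\<phi>, of z] by simp
    have ck: "continuous_on \<D> k"
      by (intro continuous_at_imp_continuous_on ballI) (rule has_wirt_isCont[OF has_wirt_k])
    have ckA: "continuous_on \<D> kA"
      unfolding kA_def[abs_def]
      by (intro continuous_at_imp_continuous_on ballI continuous_intros one_minus_mult_cnj_not_nonpos w)
    have c\<phi>: "continuous_on UNIV \<phi>"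
      by (intro continuous_at_imp_continuous_on ballI) (rule has_wirt_isCont[OF w\<phi>])
    show "continuous_on UNIV (\<lambda>z. kA z * \<phi> z + k z * \<phi>A z)"
    proof (rule continuous_on_support[OF open_ball[of 0 1] cl])
      show "continuous_on \<D> (\<lambda>z. kA z * \<phi> z + k z * \<phi>A z)"
        by (intro continuous_on_add continuous_on_mult ck ckA continuous_on_subset[OF c\<phi>]
            continuous_on_subset[OF c\<phi>A] subset_UNIV)
    qed (use \<phi>0 \<phi>AB0 S(2) in auto)
    show "continuous_on UNIV (\<lambda>z. k z * \<phi>B z)"
    proof (rule continuous_on_support[OF open_ball[of 0 1] cl])
      show "continuous_on \<D> (\<lambda>z. k z * \<phi>B z)"
        by (intro continuous_on_mult ck continuous_on_subset[OF c\<phi>B] subset_UNIV)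
    qed (use \<phi>AB0 S(2) in auto)
    show "k z * \<phi> z = 0 \<and> kA z * \<phi> z + k z * \<phi>A z = 0 \<and> k z * \<phi>B z = 0" if "norm z \<ge> 1" for z
      using \<phi>0[OF far[OF that]] \<phi>AB0[OF far[OF that]] by simp
  qed
  finally have 2: "(\<integral>z. G_fun \<alpha> z w * \<psi>A z \<partial>lborel) = - of_real pi * \<phi> w"
    unfolding 1 by (simp add: k_w)
  have "wirt_dbar \<phi> = \<phi>B" using wirt_dbar_eq[OF w\<phi>] by blast
  then have L: "L_bar \<alpha> \<phi> z = - \<psi>A z" for z
    using wirt_d_eq[OF w\<psi>, of z] by (simp add: L_bar_def \<psi>_def a_def)
  have "indicator \<D> z *\<^sub>R (G_fun \<alpha> z w * L_bar \<alpha> \<phi> z) = - (G_fun \<alpha> z w * \<psi>A z)" for z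
  proof (cases "z \<in> S")
    case True
    then have "z \<in> \<D>" using S(2) by blast
    then show ?thesis by (simp add: L)
  next
    case False
    then show ?thesis using \<psi>0(2) by (simp add: L)
  qed
  then have "distr_of (\<lambda>z. G_fun \<alpha> z w) (L_bar \<alpha> \<phi>)
      = of_real (1 / pi) * - (\<integral>z. G_fun \<alpha> z w * \<psi>A z \<partial>lebesgue)"
    unfolding distr_of_def set_lebesgue_integral_def by simp
  also have "(\<integral>z. G_fun \<alpha> z w * \<psi>A z \<partial>lebesgue) = (\<integral>z. G_fun \<alpha> z w * \<psi>A z \<partial>lborel)"
    by (rule integral_completion) (use iA in auto)
  also have "of_real (1 / pi) * - \<dots> = \<phi> w" unfolding 2 by simp
  finally show ?thesis .
qed

end

theorem G_fun_is_Green_function: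
  assumes "\<alpha> > -1"
  shows "is_Green_function \<alpha> (G_fun \<alpha>)"
  unfolding is_Green_function_def
proof (intro conjI ballI impI)
  fix w assume "w \<in> \<D>"
  then interpret disc_point \<alpha> w using assms by unfold_locales
  show "(\<lambda>z. G_fun \<alpha> z w) \<in> L1_loc" by (rule G_fun_L1_loc)
  show "distr_eq (L_op \<alpha> (distr_of (\<lambda>z. G_fun \<alpha> z w))) (dirac w)"
    by (simp add: distr_eq_def L_op_def dirac_def distr_G_fun)
  show "((\<lambda>z. G_fun \<alpha> z w) \<longlongrightarrow> 0) (at \<zeta> within \<D>)" if "\<zeta> \<in> sphere 0 1" for \<zeta>
    using that by (rule G_fun_boundary)
qed (rule G_fun_commute)

section \<open>Smooth cutoff functions\<close>

primrec rC :: "nat \<Rightarrow> (real \<Rightarrow> real) \<Rightarrow> bool" where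
  "rC 0 f \<longleftrightarrow> continuous_on UNIV f"
| "rC (Suc k) f \<longleftrightarrow> (\<exists>f'. (\<forall>x. (f has_real_derivative f' x) (at x)) \<and> rC k f')"

lemma rC_SucI: "(\<And>x. (f has_real_derivative f' x) (at x)) \<Longrightarrow> rC k f' \<Longrightarrow> rC (Suc k) f"
  by auto

lemma rC_continuous: "rC k f \<Longrightarrow> continuous_on UNIV f"
proof (cases k)
  case (Suc n)
  assume "rC k f"
  then obtain f' where "\<forall>x. (f has_real_derivative f' x) (at x)" using Suc by auto
  then show ?thesis
    by (intro continuous_at_imp_continuous_on ballI) (rule DERIV_isCont, rule spec)
qed simp

lemma rC_Suc_imp: "rC (Suc k) f \<Longrightarrow> rC k f"
proof (induction k arbitrary: f)
  case 0
  then show ?case using rC_continuous[of "Suc 0" f] by (simp only: rC.simps)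
next
  case (Suc k)
  from Suc.prems obtain f' where "\<forall>x. (f has_real_derivative f' x) (at x)" "rC (Suc k) f'"
    unfolding rC.simps(2)[of "Suc k"] by (elim exE conjE)
  then show ?case using Suc.IH[of f'] by (intro rC_SucI[of f f']) (rule spec)
qed

lemma rC_const: "rC k (\<lambda>_. c)"
proof (induction k arbitrary: c)
  case (Suc k)
  show ?case by (rule rC_SucI[OF _ Suc]) (rule DERIV_const)
qed (simp add: continuous_on_const)

lemma rC_add: "rC k f \<Longrightarrow> rC k g \<Longrightarrow> rC k (\<lambda>x. f x + g x)"
proof (induction k arbitrary: f g)
  case 0
  then show ?case by (simp add: continuous_on_add)
next
  case (Suc k)
  from Suc.prems obtain f' g' where f: "\<forall>x. (f has_real_derivative f' x) (at x)" "rC k f'"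
    and g: "\<forall>x. (g has_real_derivative g' x) (at x)" "rC k g'"
    unfolding rC.simps(2)[of k] by (elim exE conjE)
  show ?case
    by (rule rC_SucI[OF DERIV_add[OF spec[OF f(1)] spec[OF g(1)]] Suc.IH[OF f(2) g(2)]])
qed

lemma rC_mult: "rC k f \<Longrightarrow> rC k g \<Longrightarrow> rC k (\<lambda>x. f x * g x)"
proof (induction k arbitrary: f g)
  case 0
  then show ?case by (simp add: continuous_on_mult)
next
  case (Suc k)
  from Suc.prems obtain f' g' where f: "\<forall>x. (f has_real_derivative f' x) (at x)" "rC k f'"
    and g: "\<forall>x. (g has_real_derivative g' x) (at x)" "rC k g'"
    unfolding rC.simps(2)[of k] by (elim exE conjE)
  note fg = Suc.prems[THEN rC_Suc_imp]
  show ?case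
    by (rule rC_SucI[OF DERIV_mult[OF spec[OF f(1)] spec[OF g(1)]]
          rC_add[OF Suc.IH[OF f(2) fg(2)] Suc.IH[OF g(2) fg(1)]]])
qed

lemma rC_ident: "rC k (\<lambda>x. x)"
proof (cases k)
  case (Suc n)
  show ?thesis unfolding Suc by (rule rC_SucI[OF DERIV_ident rC_const])
qed (simp add: continuous_on_id)

lemma rC_affine: "rC k f \<Longrightarrow> rC k (\<lambda>x. f (a * x + b))"
proof (induction k arbitrary: f)
  case 0
  then show ?case
    by (simp add: continuous_on_compose2[of UNIV f UNIV "\<lambda>x. a * x + b"] continuous_on_add continuous_on_mult continuous_on_const continuous_on_id)
next
  case (Suc k)
  from Suc.prems obtain f' where f: "\<forall>x. (f has_real_derivative f' x) (at x)" "rC k f'"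
    unfolding rC.simps(2)[of k] by (elim exE conjE)
  have "((\<lambda>x. f (a * x + b)) has_real_derivative f' (a * x + b) * a) (at x)" for x
    by (rule DERIV_chain2[OF spec[OF f(1)]]) (auto intro!: derivative_eq_intros)
  then show ?case by (rule rC_SucI[OF _ rC_mult[OF Suc.IH[OF f(2)] rC_const]])
qed

lemma rC_inverse: "rC k f \<Longrightarrow> (\<And>x. f x \<noteq> 0) \<Longrightarrow> rC k (\<lambda>x. inverse (f x))"
proof (induction k arbitrary: f)
  case 0
  then show ?case by (simp add: continuous_on_inverse)
next
  case (Suc k)
  from Suc.prems(1) obtain f' where f: "\<forall>x. (f has_real_derivative f' x) (at x)" "rC k f'"
    unfolding rC.simps(2)[of k] by (elim exE conjE)
  have der: "((\<lambda>x. inverse (f x)) has_real_derivative (-1) * (f' x * (inverse (f x) * inverse (f x)))) (at x)" for x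
    by (rule DERIV_cong[OF DERIV_inverse_fun[OF spec[OF f(1)] Suc.prems(2)]]) simp
  note inv = Suc.IH[OF rC_Suc_imp[OF Suc.prems(1)] Suc.prems(2)]
  show ?case
    by (rule rC_SucI[OF der rC_mult[OF rC_const rC_mult[OF f(2) rC_mult[OF inv inv]]]])
qed

text \<open>The flat function exp(-1/x) times a power of 1/x. The index makes the family closed
  under differentiation up to linear combinations, so smoothness follows for all members by one
  induction.\<close>

definition exp_flat :: "nat \<Rightarrow> real \<Rightarrow> real" where
  "exp_flat n x = (if x > 0 then (1 / x) ^ n * exp (- (1 / x)) else 0)"

lemma exp_flat_tendsto_0: "(exp_flat n \<longlongrightarrow> 0) (at_right 0)"
proof -
  have "((\<lambda>t::real. t ^ n / exp t) \<longlongrightarrow> 0) at_top"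
    by (rule tendsto_power_div_exp_0)
  from filterlim_compose[OF this filterlim_inverse_at_top_right]
  have "((\<lambda>x::real. inverse x ^ n / exp (inverse x)) \<longlongrightarrow> 0) (at_right 0)" .
  then show ?thesis
    by (rule Lim_transform_eventually)
       (auto simp: eventually_at_filter exp_flat_def exp_minus inverse_eq_divide)
qed

lemma exp_flat_has_derivative:
  "(exp_flat n has_real_derivative exp_flat (n + 2) x + (- real n) * exp_flat (n + 1) x) (at x)"
proof -
  consider "x > 0" | "x < 0" | "x = 0" by linarith
  then show ?thesis
  proof cases
    case 1
    have u: "((\<lambda>x. 1 / x) has_real_derivative - (1 / x)\<^sup>2) (at x)"
      using 1 by (auto intro!: derivative_eq_intros simp: power2_eq_square)
    have algebra: "real n * (u ^ (n - Suc 0) * - u\<^sup>2) * e + (e * u\<^sup>2) * u ^ n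
        = u ^ (n + 2) * e + (- real n) * (u ^ (n + 1) * e)" for u e :: real
      by (cases n) (auto simp: algebra_simps power2_eq_square)
    have "((\<lambda>x. (1 / x) ^ n * exp (- (1 / x))) has_real_derivative
        (1 / x) ^ (n + 2) * exp (- (1 / x)) + (- real n) * ((1 / x) ^ (n + 1) * exp (- (1 / x)))) (at x)"
      by (rule DERIV_cong[OF DERIV_mult[OF DERIV_power[OF u] DERIV_chain2[OF DERIV_exp DERIV_minus[OF u]]]])
         (use algebra[of "1 / x" "exp (- (1 / x))"] in \<open>simp add: mult_ac\<close>)
    then have "((\<lambda>x. (1 / x) ^ n * exp (- (1 / x))) has_real_derivative
        exp_flat (n + 2) x + (- real n) * exp_flat (n + 1) x) (at x)"
      using 1 by (simp add: exp_flat_def)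
    then show ?thesis
      by (rule has_field_derivative_transform_within_open[of _ _ _ "{0<..}"])
         (use 1 in \<open>auto simp: exp_flat_def\<close>)
  next
    case 2
    have "((\<lambda>_. 0) has_real_derivative exp_flat (n + 2) x + (- real n) * exp_flat (n + 1) x) (at x)"
      using 2 by (simp add: exp_flat_def)
    then show ?thesis
      by (rule has_field_derivative_transform_within_open[of _ _ _ "{..<0}"])
         (use 2 in \<open>auto simp: exp_flat_def\<close>)
  next
    case 3
    \<comment> \<open>For \<open>h > 0\<close> the difference quotient at 0 is
      \<open>exp_flat (Suc n) h\<close>.\<close>
    have "((\<lambda>h. exp_flat n h / h) \<longlongrightarrow> 0) (at_right 0)"
      by (rule Lim_transform_eventually[OF exp_flat_tendsto_0[of "Suc n"]])
         (auto simp: eventually_at_filter exp_flat_def)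
    moreover have "((\<lambda>h. exp_flat n h / h) \<longlongrightarrow> 0) (at_left 0)"
      by (rule Lim_transform_eventually[OF tendsto_const])
         (auto simp: eventually_at_filter exp_flat_def)
    ultimately have "((\<lambda>h. exp_flat n h / h) \<longlongrightarrow> 0) (at 0)"
      using filterlim_split_at by blast
    then show ?thesis
      unfolding 3 DERIV_def by (simp add: exp_flat_def)
  qed
qed

lemma rC_exp_flat: "rC k (exp_flat n)"
proof (induction k arbitrary: n)
  case 0
  show ?case
    unfolding rC.simps by (intro continuous_at_imp_continuous_on ballI) (rule DERIV_isCont[OF exp_flat_has_derivative])
next
  case (Suc k)
  show ?case
    by (rule rC_SucI[OF exp_flat_has_derivative rC_add[OF Suc rC_mult[OF rC_const Suc]]])
qed

lemma exists_smooth_cutoff: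
  obtains cut :: "real \<Rightarrow> real" where "\<And>k. rC k cut" "\<And>s. s \<le> 1 \<Longrightarrow> cut s = 0" "\<And>s. s \<ge> 2 \<Longrightarrow> cut s = 1"
proof
  define e where "e = exp_flat 0"
  \<comment> \<open>The denominator of the cutoff e(s - 1) / (e(s - 1) + e(2 - s)). It is positive
    since s - 1 and 2 - s are never both nonpositive. The arguments are spelled as in
    \<open>rC_affine\<close>.\<close>
  define d where "d = (\<lambda>s. e (1 * s + -1) + e (-1 * s + 2))"
  have pos: "x > 0 \<Longrightarrow> e x > 0" and zero: "x \<le> 0 \<Longrightarrow> e x = 0" for x
    by (auto simp: e_def exp_flat_def)
  have nonneg: "e x \<ge> 0" for x
    by (auto simp: e_def exp_flat_def)
  have d: "d s \<noteq> 0" for s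
  proof (cases "s > 1")
    case True
    then have "e (1 * s + -1) > 0" by (intro pos) simp
    then show ?thesis using nonneg[of "-1 * s + 2"] by (simp add: d_def)
  next
    case False
    then have "e (-1 * s + 2) > 0" by (intro pos) simp
    then show ?thesis using nonneg[of "1 * s + -1"] by (simp add: d_def)
  qed
  show "rC k (\<lambda>s. e (1 * s + -1) * inverse (d s))" for k
    unfolding e_def
    by (intro rC_mult rC_inverse d rC_affine rC_exp_flat) (unfold d_def e_def, intro rC_add rC_affine rC_exp_flat)
  show "e (1 * s + -1) * inverse (d s) = 0" if "s \<le> 1" for s
    using that by (simp add: zero)
  show "e (1 * s + -1) * inverse (d s) = 1" if "s \<ge> 2" for s
    using that d[of s] by (simp add: d_def zero)
qed

section \<open>Radially modulated monomials as test functions\<close>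

definition smooth :: "(real \<Rightarrow> real) \<Rightarrow> bool" where
  "smooth f \<longleftrightarrow> (\<forall>k. rC k f)"

text \<open>For each \<open>k\<close> the predicate \<open>rC (Suc k) f\<close> supplies its own
  derivative; uniqueness of derivatives identifies them, so a single \<open>f'\<close> serves for
  all orders.\<close>

lemma smooth_derivative:
  assumes "smooth f"
  obtains f' where "\<And>x. (f has_real_derivative f' x) (at x)" "smooth f'"
proof -
  have ex: "\<exists>f'. (\<forall>x. (f has_real_derivative f' x) (at x)) \<and> rC k f'" for k
    using assms unfolding smooth_def rC.simps(2)[symmetric] by blast
  obtain f' where f': "\<forall>x. (f has_real_derivative f' x) (at x)" using ex[of 0] by blast
  have "rC k f'" for k
  proof -
    obtain g where g: "\<forall>x. (f has_real_derivative g x) (at x)" "rC k g" using ex by blast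
    then have "g = f'" using f' DERIV_unique by blast
    then show ?thesis using g by simp
  qed
  then show thesis
    by (intro that[of f']) (use f' in \<open>auto simp: smooth_def\<close>)
qed

lemma smooth_add: "smooth f \<Longrightarrow> smooth g \<Longrightarrow> smooth (\<lambda>x. f x + g x)"
  and smooth_mult: "smooth f \<Longrightarrow> smooth g \<Longrightarrow> smooth (\<lambda>x. f x * g x)"
  and smooth_const: "smooth (\<lambda>_. c)"
  and smooth_ident: "smooth (\<lambda>x. x)"
  by (simp_all add: smooth_def rC_add rC_mult rC_const rC_ident)

lemma derivative_zero_below:
  assumes "(f has_real_derivative d) (at x)" "x < e" "\<And>x. x < e \<Longrightarrow> f x = 0"
  shows "d = 0"
proof -
  have "(f has_real_derivative 0) (at x)"
    by (rule has_field_derivative_transform_within_open[OF DERIV_const[of 0], of "{..<e}"])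
       (use assms in auto)
  then show ?thesis using assms(1) DERIV_unique by blast
qed

lemma powr_mult_has_derivative:
  assumes X: "(X has_real_derivative X' x) (at x)" and zero: "\<And>x. x < e \<Longrightarrow> X x = 0" and e: "e > 0"
  shows "((\<lambda>x. x powr b * X x) has_real_derivative b * (x powr (b - 1) * X x) + x powr b * X' x) (at x)"
proof (cases "x < e")
  case True
  have "X' x = 0" by (rule derivative_zero_below[OF X True zero])
  have "((\<lambda>x. x powr b * X x) has_real_derivative 0) (at x)"
    by (rule has_field_derivative_transform_within_open[OF DERIV_const[of 0], of "{..<e}"])
       (use True zero in auto)
  then show ?thesis using zero[OF True] \<open>X' x = 0\<close> by simp
next
  case False
  then have "x > 0" using e by linarith
  then show ?thesis
    by (intro DERIV_cong[OF DERIV_mult[OF has_real_derivative_powr X]]) (simp_all add: mult_ac)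
qed

text \<open>The power is singular at 0, but \<open>X\<close> vanishes up to \<open>e > 0\<close>.
  Differentiation gives two functions of the same kind, with \<open>b - 1\<close> in place of
  \<open>b\<close> or \<open>X'\<close> in place of \<open>X\<close>; hence the induction with both
  of them arbitrary.\<close>

lemma smooth_powr_mult:
  assumes "smooth X" "\<And>x. x < e \<Longrightarrow> X x = 0" "e > 0"
  shows "smooth (\<lambda>x. x powr b * X x)"
proof -
  have "rC k (\<lambda>x. x powr b * X x)" for k
    using assms(1,2)
  proof (induction k arbitrary: b X)
    case 0
    obtain X' where "\<And>x. (X has_real_derivative X' x) (at x)" using smooth_derivative[OF 0(1)] by blast
    then have "((\<lambda>x. x powr b * X x) has_real_derivative b * (x powr (b - 1) * X x) + x powr b * X' x) (at x)" for x
      by (rule powr_mult_has_derivative[OF _ 0(2) \<open>e > 0\<close>])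
    then show ?case
      unfolding rC.simps by (intro continuous_at_imp_continuous_on ballI) (rule DERIV_isCont)
  next
    case (Suc k)
    obtain X' where X': "\<And>x. (X has_real_derivative X' x) (at x)" "smooth X'"
      using smooth_derivative[OF Suc.prems(1)] by blast
    have X'0: "X' x = 0" if "x < e" for x
      by (rule derivative_zero_below[OF X'(1) that Suc.prems(2)])
    have der: "((\<lambda>x. x powr b * X x) has_real_derivative b * (x powr (b - 1) * X x) + x powr b * X' x) (at x)" for x
      by (rule powr_mult_has_derivative[OF X'(1) Suc.prems(2) \<open>e > 0\<close>])
    show ?case
      by (rule rC_SucI[OF der
            rC_add[OF rC_mult[OF rC_const Suc.IH[OF Suc.prems]] Suc.IH[OF X'(2) X'0]]])
  qed
  then show ?thesis by (simp add: smooth_def)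
qed

text \<open>A family whose Wirtinger derivatives are combinations of its members, so that
  smoothness, the action of \<open>L_bar\<close> and the limiting moments are all computed within
  it.\<close>

definition radial_monomial :: "nat \<Rightarrow> nat \<Rightarrow> (real \<Rightarrow> real) \<Rightarrow> complex \<Rightarrow> complex" where
  "radial_monomial m n f z = z ^ m * cnj z ^ n * of_real (f (1 - (norm z)\<^sup>2))"

lemma has_wirt_radial_monomial:
  assumes "\<And>x. (f has_real_derivative f' x) (at x)"
  shows "has_wirt (radial_monomial m n f)
    (of_nat m * radial_monomial (m - 1) n f z + (-1) * radial_monomial m (Suc n) f' z)
    (of_nat n * radial_monomial m (n - 1) f z + (-1) * radial_monomial (Suc m) n f' z) z"
proof -
  have pow: "has_wirt (\<lambda>z. z ^ k) (of_nat k * z ^ (k - 1)) 0 z" for k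
    by (rule has_wirt_field_derivative) (auto intro!: derivative_eq_intros)
  have cpow: "has_wirt (\<lambda>z. cnj z ^ k) 0 (of_nat k * cnj z ^ (k - 1)) z" for k
    using has_wirt_cnj[OF pow[of k]] by simp
  have f: "has_wirt (\<lambda>z. of_real (f (1 - (norm z)\<^sup>2)))
      (of_real (f' (1 - (norm z)\<^sup>2)) * - cnj z) (of_real (f' (1 - (norm z)\<^sup>2)) * - z) z"
    by (rule has_wirt_comp_real[OF has_wirt_norm_squared assms])
  show ?thesis
    unfolding radial_monomial_def
    by (rule has_wirt_cong[OF has_wirt_mult[OF has_wirt_mult[OF pow cpow] f]]) (simp_all add: algebra_simps)
qed

lemma Ck_radial_monomial: "smooth f \<Longrightarrow> Ck k (radial_monomial m n f)"
proof (induction k arbitrary: m n f)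
  case 0
  obtain f' where "\<And>x. (f has_real_derivative f' x) (at x)" using smooth_derivative[OF 0] by blast
  from has_wirt_radial_monomial[OF this]
  show ?case
    unfolding Ck.simps by (intro continuous_at_imp_continuous_on ballI) (rule has_wirt_isCont)
next
  case (Suc k)
  obtain f' where f': "\<And>x. (f has_real_derivative f' x) (at x)" "smooth f'"
    using smooth_derivative[OF Suc.prems] by blast
  show ?case
    unfolding Ck_Suc_iff
    by (intro exI conjI allI, rule has_wirt_radial_monomial[OF f'(1)])
       (intro Ck_lincomb Suc.IH Suc.prems f'(2))+
qed

lemma radial_monomial_eq_0:
  assumes "\<And>x. x < e \<Longrightarrow> f x = 0" "z \<notin> {z. (norm z)\<^sup>2 \<le> 1 - e}"
  shows "radial_monomial m n f z = 0"
  using assms(1)[of "1 - (norm z)\<^sup>2"] assms(2) by (simp add: radial_monomial_def)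

lemma compact_norm_square_le: "compact {z::complex. (norm z)\<^sup>2 \<le> r}"
proof (rule compact_eq_bounded_closed[THEN iffD2], rule conjI)
  show "closed {z::complex. (norm z)\<^sup>2 \<le> r}"
    by (intro closed_Collect_le continuous_intros)
  show "bounded {z::complex. (norm z)\<^sup>2 \<le> r}"
    unfolding bounded_iff
  proof (intro exI ballI)
    fix z :: complex assume "z \<in> {z. (norm z)\<^sup>2 \<le> r}"
    then show "norm z \<le> sqrt r" by (simp add: real_le_rsqrt)
  qed
qed

lemma norm_square_le_subset_disc:
  assumes "e > 0"
  shows "{z::complex. (norm z)\<^sup>2 \<le> 1 - e} \<subseteq> \<D>"
proof
  fix z :: complex assume "z \<in> {z. (norm z)\<^sup>2 \<le> 1 - e}"
  then have "(norm z)\<^sup>2 < 1" using assms by simp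
  then show "z \<in> \<D>" by (simp add: abs_square_less_1)
qed

lemma radial_monomial_test_fun:
  assumes "smooth f" "\<And>x. x < e \<Longrightarrow> f x = 0" "e > 0"
  shows "radial_monomial m n f \<in> test_fun"
proof -
  define S where "S = {z::complex. (norm z)\<^sup>2 \<le> 1 - e}"
  have "{z. radial_monomial m n f z \<noteq> 0} \<subseteq> S"
  proof
    fix z assume "z \<in> {z. radial_monomial m n f z \<noteq> 0}"
    then show "z \<in> S"
      using radial_monomial_eq_0[of e f z m n] assms(2) unfolding S_def by blast
  qed
  then have sub: "closure {z. radial_monomial m n f z \<noteq> 0} \<subseteq> S"
    using compact_norm_square_le compact_imp_closed unfolding S_def by (intro closure_minimal) auto
  then have "compact (closure {z. radial_monomial m n f z \<noteq> 0})"
    using compact_norm_square_le[of "1 - e"] bounded_subset compact_imp_bounded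
    unfolding S_def compact_eq_bounded_closed by blast
  then show ?thesis
    using sub norm_square_le_subset_disc[OF assms(3)] Ck_radial_monomial[OF assms(1)]
    unfolding test_fun_def S_def by blast
qed

text \<open>The exponent \<alpha> + 1 is such that after multiplication by the weight no fractional
  power survives, neither in the function (\<open>pf\<close>) nor in its derivative
  (\<open>qf\<close>). The terms are arranged by their size for a cutoff of small scale: in the
  first three every \<open>X1\<close> comes with a factor \<open>x\<close>, while the last one is
  unbounded. Where \<open>m - 1\<close> or \<open>n - 1\<close> is truncated, the coefficient is
  0.\<close>

lemma L_bar_radial_monomial:
  assumes X: "smooth X" "\<And>x. x < e \<Longrightarrow> X x = 0" "e > 0"
    and X1: "\<And>x. (X has_real_derivative X1 x) (at x)"
    and X2: "\<And>x. (X1 has_real_derivative X2 x) (at x)"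
  shows "L_bar \<alpha> (radial_monomial m n (\<lambda>x. x powr (\<alpha> + 1) * X x)) z =
    - (of_nat n * (of_nat m * radial_monomial (m - 1) (n - 1) (\<lambda>x. x * X x) z)
      - of_nat n * radial_monomial m (Suc (n - 1)) (\<lambda>x. X x + x * X1 x) z
      - of_nat (Suc m) * radial_monomial m n (\<lambda>x. (\<alpha> + 1) * X x + x * X1 x) z
      + radial_monomial (Suc m) (Suc n) (\<lambda>x. (\<alpha> + 2) * X1 x + x * X2 x) z)"
proof -
  define f where "f = (\<lambda>x. x powr (\<alpha> + 1) * X x)"
  define f' where "f' = (\<lambda>x. (\<alpha> + 1) * (x powr (\<alpha> + 1 - 1) * X x) + x powr (\<alpha> + 1) * X1 x)"
  define p where "p = (\<lambda>x. x * X x)"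
  define q where "q = (\<lambda>x. (\<alpha> + 1) * X x + x * X1 x)"
  have X10: "X1 x = 0" if "x < e" for x
    by (rule derivative_zero_below[OF X1 that X(2)])
  have f': "(f has_real_derivative f' x) (at x)" for x
    unfolding f_def f'_def by (rule powr_mult_has_derivative[OF X1 X(2,3)])
  have p': "(p has_real_derivative X x + x * X1 x) (at x)" for x
    unfolding p_def by (rule DERIV_cong[OF DERIV_mult[OF DERIV_ident X1]]) simp
  have q': "(q has_real_derivative (\<alpha> + 2) * X1 x + x * X2 x) (at x)" for x
    unfolding q_def
    by (rule DERIV_cong[OF DERIV_add[OF DERIV_cmult[OF X1] DERIV_mult[OF DERIV_ident X2]]])
       (simp add: algebra_simps)
  have pf: "x powr (- \<alpha>) * f x = p x" and qf: "x powr (- \<alpha>) * f' x = q x" for x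
  proof -
    have "x powr (- \<alpha>) * f x = p x \<and> x powr (- \<alpha>) * f' x = q x"
    proof (cases "x < e")
      case True
      then show ?thesis using X(2) X10 by (simp add: f_def f'_def p_def q_def)
    next
      case False
      then have "x > 0" using X(3) by linarith
      then have 1: "x powr (- \<alpha>) * x powr \<alpha> = 1" and 2: "x powr (\<alpha> + 1) = x powr \<alpha> * x"
        by (simp_all add: powr_add flip: powr_add[of _ "- \<alpha>"])
      have "x powr (- \<alpha>) * f x = (x powr (- \<alpha>) * x powr \<alpha>) * (x * X x)"
        "x powr (- \<alpha>) * f' x = (x powr (- \<alpha>) * x powr \<alpha>) * ((\<alpha> + 1) * X x + x * X1 x)"
        unfolding f_def f'_def add_diff_cancel_right' 2 by (simp_all add: algebra_simps)
      then have "x powr (- \<alpha>) * f x = x * X x" "x powr (- \<alpha>) * f' x = (\<alpha> + 1) * X x + x * X1 x"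
        unfolding 1 by simp_all
      then show ?thesis by (simp add: p_def q_def)
    qed
    then show "x powr (- \<alpha>) * f x = p x" "x powr (- \<alpha>) * f' x = q x" by blast+
  qed
  define a where "a = (\<lambda>z::complex. complex_of_real ((1 - (norm z)\<^sup>2) powr (- \<alpha>)))"
  have scale: "a z * radial_monomial i j F z = radial_monomial i j H z"
    if "\<And>x. x powr (- \<alpha>) * F x = H x" for i j F H z
    using that[of "1 - (norm z)\<^sup>2", symmetric] by (simp add: a_def radial_monomial_def)
  have dbar: "a z * wirt_dbar (radial_monomial m n f) z =
      of_nat n * radial_monomial m (n - 1) p z + (-1) * radial_monomial (Suc m) n q z" for z
    unfolding wirt_dbar_eq[OF has_wirt_radial_monomial[OF f']]
    using scale[OF pf, where i = m and j = "n - 1" and z = z]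
      scale[OF qf, where i = "Suc m" and j = n and z = z]
    by (simp add: distrib_left right_diff_distrib mult.left_commute[of "a z"])
  have "L_bar \<alpha> (radial_monomial m n f) z = - wirt_d (\<lambda>z. of_nat n * radial_monomial m (n - 1) p z
      + (-1) * radial_monomial (Suc m) n q z) z"
    unfolding L_bar_def dbar[unfolded a_def] ..
  also have "wirt_d (\<lambda>z. of_nat n * radial_monomial m (n - 1) p z
      + (-1) * radial_monomial (Suc m) n q z) z =
      of_nat n * (of_nat m * radial_monomial (m - 1) (n - 1) p z
         + (-1) * radial_monomial m (Suc (n - 1)) (\<lambda>x. X x + x * X1 x) z)
      + (-1) * (of_nat (Suc m) * radial_monomial (Suc m - 1) n q z
         + (-1) * radial_monomial (Suc m) (Suc n) (\<lambda>x. (\<alpha> + 2) * X1 x + x * X2 x) z)"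
    by (rule wirt_d_eq[OF has_wirt_add[OF has_wirt_cmult[OF has_wirt_radial_monomial[OF p']]
          has_wirt_cmult[OF has_wirt_radial_monomial[OF q']]]])
  finally show ?thesis
    unfolding f_def p_def q_def by (simp add: algebra_simps)
qed

section \<open>Moments of a decaying solution\<close>

lemma derivative_zero_open:
  assumes "(f has_real_derivative d) (at x)" "open S" "x \<in> S" "\<And>x. x \<in> S \<Longrightarrow> f x = c"
  shows "d = 0"
proof -
  have "(f has_real_derivative 0) (at x)"
    by (rule has_field_derivative_transform_within_open[OF DERIV_const[of c], of S])
       (use assms in auto)
  then show ?thesis using assms(1) DERIV_unique by blast
qed

lemma bounded_if_constant_outside:
  fixes f :: "real \<Rightarrow> real"
  assumes "continuous_on UNIV f" "\<And>s. s < 1 \<Longrightarrow> f s = a" "\<And>s. s > 2 \<Longrightarrow> f s = b"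
  obtains M where "\<And>s. \<bar>f s\<bar> \<le> M"
proof -
  have "bounded (f ` {1..2})"
    by (intro compact_imp_bounded compact_continuous_image continuous_on_subset[OF assms(1)] subset_UNIV compact_Icc)
  then obtain M where M: "\<And>s. s \<in> {1..2} \<Longrightarrow> \<bar>f s\<bar> \<le> M"
    unfolding bounded_iff ball_simps real_norm_def by blast
  show thesis
  proof (rule that)
    fix s :: real
    consider "s < 1" | "s > 2" | "s \<in> {1..2}" by force
    then show "\<bar>f s\<bar> \<le> max M (max \<bar>a\<bar> \<bar>b\<bar>)"
    proof cases
      case 1
      then show ?thesis using assms(2) by simp
    next
      case 2
      then show ?thesis using assms(3) by simp
    next
      case 3
      then show ?thesis using M[of s] by simp
    qed
  qed
qed

lemma smooth_cutoff_with_derivatives: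
  obtains X X1 X2 :: "real \<Rightarrow> real" and M where
    "smooth X" "\<And>x. (X has_real_derivative X1 x) (at x)" "\<And>x. (X1 has_real_derivative X2 x) (at x)"
    "\<And>s. s < 1 \<Longrightarrow> X s = 0" "\<And>s. s > 2 \<Longrightarrow> X s = 1"
    "\<And>s. s < 1 \<or> s > 2 \<Longrightarrow> X1 s = 0" "\<And>s. s < 1 \<or> s > 2 \<Longrightarrow> X2 s = 0"
    "\<And>s. \<bar>X s\<bar> \<le> M" "\<And>s. \<bar>X1 s\<bar> \<le> M" "\<And>s. \<bar>X2 s\<bar> \<le> M"
proof -
  obtain X :: "real \<Rightarrow> real" where X: "\<And>k. rC k X" "\<And>s. s \<le> 1 \<Longrightarrow> X s = 0" "\<And>s. s \<ge> 2 \<Longrightarrow> X s = 1"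
    using exists_smooth_cutoff by blast
  have sX: "smooth X" using X(1) by (simp add: smooth_def)
  obtain X1 where X1: "\<And>x. (X has_real_derivative X1 x) (at x)" and sX1: "smooth X1"
    using smooth_derivative[OF sX] by blast
  obtain X2 where X2: "\<And>x. (X1 has_real_derivative X2 x) (at x)" and sX2: "smooth X2"
    using smooth_derivative[OF sX1] by blast
  have cont: "continuous_on UNIV f" if "smooth f" for f
    by (rule rC_continuous[OF spec[OF that[unfolded smooth_def]]])
  have low1: "X1 s = 0" if "s < 1" for s
    by (rule derivative_zero_open[OF X1, of "{..<1}" _ 0]) (use that X(2) in auto)
  have high1: "X1 s = 0" if "s > 2" for s
    by (rule derivative_zero_open[OF X1, of "{2<..}" _ 1]) (use that X(3) in auto)
  have low2: "X2 s = 0" if "s < 1" for s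
    by (rule derivative_zero_open[OF X2, of "{..<1}" _ 0]) (use that low1 in auto)
  have high2: "X2 s = 0" if "s > 2" for s
    by (rule derivative_zero_open[OF X2, of "{2<..}" _ 0]) (use that high1 in auto)
  have X01: "\<And>s. s < 1 \<Longrightarrow> X s = 0" "\<And>s. s > 2 \<Longrightarrow> X s = 1" using X by auto
  obtain M0 where M0: "\<And>s. \<bar>X s\<bar> \<le> M0"
    using bounded_if_constant_outside[OF cont[OF sX]] X01 by metis
  obtain M1 where M1: "\<And>s. \<bar>X1 s\<bar> \<le> M1"
    using bounded_if_constant_outside[OF cont[OF sX1]] low1 high1 by metis
  obtain M2 where M2: "\<And>s. \<bar>X2 s\<bar> \<le> M2"
    using bounded_if_constant_outside[OF cont[OF sX2]] low2 high2 by metis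
  show thesis
  proof (rule that[OF sX X1 X2 X01])
    show "X1 s = 0" "X2 s = 0" if "s < 1 \<or> s > 2" for s
      using that low1 low2 high1 high2 by blast+
    show "\<bar>X s\<bar> \<le> max M0 (max M1 M2)" "\<bar>X1 s\<bar> \<le> max M0 (max M1 M2)" "\<bar>X2 s\<bar> \<le> max M0 (max M1 M2)" for s
      using M0[of s] M1[of s] M2[of s] by linarith+
  qed
qed

text \<open>The area is linear in \<open>e\<close>, which balances the growth 1/e of the cutoff term
  integrated over this annulus. The condition \<open>e \<le> 1/2\<close> makes the inner radius
  real.\<close>

lemma measure_annulus_le:
  assumes "0 < e" "e \<le> 1/2"
  shows "measure lebesgue {z::complex. 1 - 2 * e \<le> (norm z)\<^sup>2 \<and> (norm z)\<^sup>2 \<le> 1 - e} \<le> pi * e"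
    and "{z::complex. 1 - 2 * e \<le> (norm z)\<^sup>2 \<and> (norm z)\<^sup>2 \<le> 1 - e} \<in> lmeasurable"
proof -
  define A where "A = {z::complex. 1 - 2 * e \<le> (norm z)\<^sup>2 \<and> (norm z)\<^sup>2 \<le> 1 - e}"
  define a b where "a = sqrt (1 - 2 * e)" and "b = sqrt (1 - e)"
  have ab: "0 \<le> a" "a < b" "a\<^sup>2 = 1 - 2 * e" "b\<^sup>2 = 1 - e"
    using assms by (auto simp: a_def b_def)
  have "compact A"
  proof -
    have "A = {z. (norm z)\<^sup>2 \<le> 1 - e} \<inter> {z. 1 - 2 * e \<le> (norm z)\<^sup>2}" by (auto simp: A_def)
    moreover have "closed {z::complex. 1 - 2 * e \<le> (norm z)\<^sup>2}"
      by (intro closed_Collect_le continuous_intros)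
    ultimately show ?thesis using compact_norm_square_le compact_Int_closed by metis
  qed
  then show lm: "{z::complex. 1 - 2 * e \<le> (norm z)\<^sup>2 \<and> (norm z)\<^sup>2 \<le> 1 - e} \<in> lmeasurable"
    unfolding A_def[symmetric] by (rule lmeasurable_compact)
  have "A \<subseteq> cball 0 b - ball 0 a"
  proof
    fix z assume "z \<in> A"
    then have "a\<^sup>2 \<le> (norm z)\<^sup>2" "(norm z)\<^sup>2 \<le> b\<^sup>2" by (auto simp: A_def ab)
    then show "z \<in> cball 0 b - ball 0 a"
      using ab power2_le_imp_le[of a "norm z"] power2_le_imp_le[of "norm z" b] by auto
  qed
  then have "measure lebesgue A \<le> measure lebesgue (cball 0 b - ball (0::complex) a)"
    by (rule measure_mono_fmeasurable) (use \<open>compact A\<close> in \<open>auto simp: lmeasurable_compact fmeasurableD fmeasurable.Diff\<close>)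
  also have "\<dots> = measure lebesgue (cball (0::complex) b) - measure lebesgue (ball (0::complex) a)"
    by (rule measurable_measure_Diff) (use ab in auto)
  also have "\<dots> = pi * b\<^sup>2 - pi * a\<^sup>2"
    using ab by (simp add: content_ball content_cball unit_ball_vol_2)
  also have "\<dots> = pi * e" unfolding ab by (simp add: algebra_simps)
  finally show "measure lebesgue {z::complex. 1 - 2 * e \<le> (norm z)\<^sup>2 \<and> (norm z)\<^sup>2 \<le> 1 - e} \<le> pi * e"
    by (simp add: A_def)
qed

lemma norm_radial_monomial_le:
  assumes "z \<in> \<D>"
  shows "norm (radial_monomial m n f z) \<le> \<bar>f (1 - (norm z)\<^sup>2)\<bar>"
proof -
  have "norm z ^ m * norm z ^ n \<le> 1"
    using assms by (intro mult_le_one power_le_one) auto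
  then show ?thesis
    unfolding radial_monomial_def by (simp add: norm_mult norm_power mult_left_le_one_le)
qed

lemma integrable_mult_bounded_on:
  fixes U f :: "complex \<Rightarrow> complex"
  assumes "integrable lebesgue U" "\<And>z. z \<notin> \<D> \<Longrightarrow> U z = 0" "continuous_on UNIV f"
    "\<And>z. z \<in> \<D> \<Longrightarrow> norm (f z) \<le> C"
  shows "integrable lebesgue (\<lambda>z. U z * f z)"
proof (rule Bochner_Integration.integrable_bound)
  show "integrable lebesgue (\<lambda>z. of_real C * U z)" using assms(1) by simp
  have "f \<in> borel_measurable borel" using assms(3) by (rule borel_measurable_continuous_onI)
  then have "f \<in> borel_measurable lebesgue" by (intro measurable_completion) simp
  then show "(\<lambda>z. U z * f z) \<in> borel_measurable lebesgue"
    using assms(1) by (intro borel_measurable_times) auto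
  show "AE z in lebesgue. norm (U z * f z) \<le> norm (of_real C * U z)"
  proof (rule AE_I2)
    fix z
    show "norm (U z * f z) \<le> norm (of_real C * U z)"
    proof (cases "z \<in> \<D>")
      case True
      have "norm (f z) \<le> \<bar>C\<bar>" using assms(4)[OF True] by linarith
      from mult_right_mono[OF this norm_ge_zero[of "U z"]] show ?thesis
        by (simp add: norm_mult mult.commute)
    qed (simp add: assms(2))
  qed
qed

lemma smooth_has_derivative:
  assumes "smooth f" "\<And>x. (f has_real_derivative f' x) (at x)"
  shows "smooth f'"
proof -
  obtain g where g: "\<And>x. (f has_real_derivative g x) (at x)" "smooth g"
    using smooth_derivative[OF assms(1)] by blast
  have "g x = f' x" for x by (rule DERIV_unique[OF g(1) assms(2)])
  then have "g = f'" by (rule ext)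
  then show ?thesis using g(2) by simp
qed

text \<open>Cutoffs of scale \<open>e j\<close> are inserted into the annihilation hypothesis. The
  part \<open>T\<close> of \<open>L_bar\<close> stays bounded and converges pointwise to a
  polynomial, so dominated convergence applies. The part \<open>R\<close> lives on a thin annulus,
  where \<open>U\<close> is uniformly small.\<close>

lemma L_bar_annihilator_moments:
  fixes U :: "complex \<Rightarrow> complex" and \<alpha> :: real
  assumes U: "integrable lebesgue U" and U0: "\<And>z. z \<notin> \<D> \<Longrightarrow> U z = 0"
    and bdry: "\<And>\<delta>. \<delta> > 0 \<Longrightarrow> \<exists>r<1. \<forall>z. norm z > r \<longrightarrow> norm (U z) \<le> \<delta>"
    and ann: "\<And>m n X e. smooth X \<Longrightarrow> (\<And>x. x < e \<Longrightarrow> X x = 0) \<Longrightarrow> e > 0 \<Longrightarrow>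
      (\<integral>z. U z * L_bar \<alpha> (radial_monomial m n (\<lambda>x. x powr (\<alpha> + 1) * X x)) z \<partial>lebesgue) = 0"
  shows "of_nat n * of_nat m * (\<integral>z. U z * (z ^ (m - 1) * cnj z ^ (n - 1)) \<partial>lebesgue)
    = of_nat (Suc m) * of_real (real n + \<alpha> + 1) * (\<integral>z. U z * (z ^ m * cnj z ^ n) \<partial>lebesgue)"
proof -
  obtain X X1 X2 M where X: "smooth X" "\<And>x. (X has_real_derivative X1 x) (at x)"
      "\<And>x. (X1 has_real_derivative X2 x) (at x)"
    and X0: "\<And>s. s < 1 \<Longrightarrow> X s = 0" and Xone: "\<And>s. s > 2 \<Longrightarrow> X s = 1"
    and X10: "\<And>s. s < 1 \<or> s > 2 \<Longrightarrow> X1 s = 0" and X20: "\<And>s. s < 1 \<or> s > 2 \<Longrightarrow> X2 s = 0"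
    and M: "\<And>s. \<bar>X s\<bar> \<le> M" "\<And>s. \<bar>X1 s\<bar> \<le> M" "\<And>s. \<bar>X2 s\<bar> \<le> M"
    by (rule smooth_cutoff_with_derivatives) (rule that)
  have "M \<ge> 0" using M(1)[of 0] by linarith
  have sX1: "smooth X1" by (rule smooth_has_derivative[OF X(1,2)])
  then have sX2: "smooth X2" by (rule smooth_has_derivative[OF _ X(3)])
  \<comment> \<open>The shift by 3 ensures \<open>e j \<le> 1/2\<close>, as
    \<open>measure_annulus_le\<close> demands.\<close>
  define e where "e = (\<lambda>j. 1 / real (j + 3))"
  have e: "e j > 0" "e j \<le> 1/2" for j by (auto simp: e_def)
  define Y where "Y = (\<lambda>j x. X ((1 / e j) * x + 0))"
  define Y1 where "Y1 = (\<lambda>j x. X1 ((1 / e j) * x + 0) * (1 / e j))"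
  define Y2 where "Y2 = (\<lambda>j x. X2 ((1 / e j) * x + 0) * (1 / e j) * (1 / e j))"
  have smooth_affine: "smooth (\<lambda>x. f (a * x + b))" if "smooth f" for f a b
    unfolding smooth_def by (intro allI rC_affine spec[OF that[unfolded smooth_def]])
  have sY: "smooth (Y j)" "smooth (Y1 j)" "smooth (Y2 j)" for j
    unfolding Y_def Y1_def Y2_def
    by (rule smooth_affine[OF X(1)], rule smooth_mult[OF smooth_affine[OF sX1] smooth_const],
        rule smooth_mult[OF smooth_mult[OF smooth_affine[OF sX2] smooth_const] smooth_const])
  have lin: "((\<lambda>x. (1 / e j) * x + 0) has_real_derivative 1 / e j) (at x)" for j x
    using e(1)[of j] by (auto intro!: derivative_eq_intros)
  have dY: "(Y j has_real_derivative Y1 j x) (at x)" for j x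
    unfolding Y_def Y1_def by (rule DERIV_chain2[OF X(2) lin])
  have dY1: "(Y1 j has_real_derivative Y2 j x) (at x)" for j x
    unfolding Y1_def Y2_def by (rule DERIV_cmult_right[OF DERIV_chain2[OF X(3) lin]])
  have Y0: "Y j x = 0" if "x < e j" for j x
    unfolding Y_def using that e(1)[of j] by (intro X0) (simp add: divide_simps)
  define p where "p = (\<lambda>j x. x * Y j x)"
  define p' where "p' = (\<lambda>j x. Y j x + x * Y1 j x)"
  define q where "q = (\<lambda>j x. (\<alpha> + 1) * Y j x + x * Y1 j x)"
  define q' where "q' = (\<lambda>j x. (\<alpha> + 2) * Y1 j x + x * Y2 j x)"
  have smooths: "smooth (p j)" "smooth (p' j)" "smooth (q j)" "smooth (q' j)" for j
    unfolding p_def p'_def q_def q'_def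
    by (rule smooth_mult[OF smooth_ident sY(1)],
        rule smooth_add[OF sY(1) smooth_mult[OF smooth_ident sY(2)]],
        rule smooth_add[OF smooth_mult[OF smooth_const sY(1)] smooth_mult[OF smooth_ident sY(2)]],
        rule smooth_add[OF smooth_mult[OF smooth_const sY(2)] smooth_mult[OF smooth_ident sY(3)]])
  have cont: "continuous_on UNIV (radial_monomial i k f)" if "smooth f" for i k f
    by (rule Ck_imp_continuous[OF Ck_radial_monomial[OF that, where k = 0]])
  define T where "T = (\<lambda>j z. of_nat n * (of_nat m * radial_monomial (m - 1) (n - 1) (p j) z)
      - of_nat n * radial_monomial m (Suc (n - 1)) (p' j) z - of_nat (Suc m) * radial_monomial m n (q j) z)"
  define R where "R = (\<lambda>j. radial_monomial (Suc m) (Suc n) (q' j))"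
  have LTR: "L_bar \<alpha> (radial_monomial m n (\<lambda>x. x powr (\<alpha> + 1) * Y j x)) z = - (T j z + R j z)" for j z
    unfolding T_def R_def p_def p'_def q_def q'_def
    by (rule L_bar_radial_monomial[OF sY(1) Y0 e(1) dY dY1])
  \<comment> \<open>With s = x / \<open>e j\<close> the product is s \<open>X1\<close>(s), and
    \<open>X1\<close> vanishes unless s lies between 1 and 2. The factor \<open>x\<close> thus
    absorbs one factor 1/\<open>e j\<close>.\<close>
  have xY1: "\<bar>x * Y1 j x\<bar> \<le> 2 * M" for j x
  proof (cases "(1 / e j) * x + 0 < 1 \<or> (1 / e j) * x + 0 > 2")
    case True
    then show ?thesis unfolding Y1_def X10[OF True] using \<open>M \<ge> 0\<close> by simp
  next
    case False
    then have "\<bar>(1 / e j) * x\<bar> * \<bar>X1 ((1 / e j) * x + 0)\<bar> \<le> 2 * M"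
      by (intro mult_mono M) auto
    then show ?thesis by (simp add: Y1_def abs_mult mult_ac)
  qed
  have xY2: "\<bar>x * Y2 j x\<bar> \<le> 2 * M * (1 / e j)" for j x
  proof (cases "(1 / e j) * x + 0 < 1 \<or> (1 / e j) * x + 0 > 2")
    case True
    then show ?thesis unfolding Y2_def X20[OF True] using \<open>M \<ge> 0\<close> e(1)[of j] by simp
  next
    case False
    then have "\<bar>(1 / e j) * x\<bar> * \<bar>X2 ((1 / e j) * x + 0)\<bar> \<le> 2 * M"
      by (intro mult_mono M) auto
    then have "\<bar>(1 / e j) * x\<bar> * \<bar>X2 ((1 / e j) * x + 0)\<bar> * (1 / e j) \<le> 2 * M * (1 / e j)"
      using e(1)[of j] by (intro mult_right_mono) auto
    then show ?thesis using e(1)[of j] by (simp add: Y2_def abs_mult mult_ac)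
  qed
  have absY: "\<bar>Y j x\<bar> \<le> M" for j x unfolding Y_def by (rule M)
  \<comment> \<open>The largest constant among the four estimates; it comes from \<open>q'\<close>,
    as (|\<alpha>| + 2) M + 2 M.\<close>
  define B where "B = M * (\<bar>\<alpha>\<bar> + 4)"
  have p_le: "\<bar>p j x\<bar> \<le> B" if "0 \<le> x" "x \<le> 1" for j x
  proof -
    have "\<bar>p j x\<bar> \<le> 1 * M" unfolding p_def abs_mult using that by (intro mult_mono absY) auto
    also have "\<dots> \<le> B" using \<open>M \<ge> 0\<close> unfolding B_def mult.commute[of 1] by (intro mult_left_mono) auto
    finally show ?thesis .
  qed
  have p'_le: "\<bar>p' j x\<bar> \<le> B" for j x
  proof -
    have "\<bar>p' j x\<bar> \<le> M + 2 * M"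
      unfolding p'_def using absY[of j x] xY1[of x j] by linarith
    also have "\<dots> = M * 3" by simp
    also have "\<dots> \<le> B" using \<open>M \<ge> 0\<close> unfolding B_def by (intro mult_left_mono) auto
    finally show ?thesis .
  qed
  have q_le: "\<bar>q j x\<bar> \<le> B" for j x
  proof -
    have "\<bar>(\<alpha> + 1) * Y j x\<bar> \<le> (\<bar>\<alpha>\<bar> + 1) * M"
      unfolding abs_mult by (intro mult_mono absY) auto
    then have "\<bar>q j x\<bar> \<le> (\<bar>\<alpha>\<bar> + 1) * M + 2 * M"
      unfolding q_def using xY1[of x j] by linarith
    also have "\<dots> \<le> B" using \<open>M \<ge> 0\<close> unfolding B_def by (simp add: algebra_simps)
    finally show ?thesis .
  qed
  have q'_le: "\<bar>q' j x\<bar> \<le> B / e j" for j x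
  proof -
    have "\<bar>Y1 j x\<bar> \<le> M * (1 / e j)"
      unfolding Y1_def abs_mult using e(1)[of j] M(2) \<open>M \<ge> 0\<close> by (intro mult_mono) auto
    then have "\<bar>(\<alpha> + 2) * Y1 j x\<bar> \<le> (\<bar>\<alpha>\<bar> + 2) * (M * (1 / e j))"
      unfolding abs_mult by (intro mult_mono) auto
    then have "\<bar>q' j x\<bar> \<le> (\<bar>\<alpha>\<bar> + 2) * (M * (1 / e j)) + 2 * M * (1 / e j)"
      unfolding q'_def using xY2[of x j] by linarith
    also have "\<dots> = B / e j" by (simp add: B_def algebra_simps add_divide_distrib)
    finally show ?thesis .
  qed
  have q'_0: "q' j x = 0" if "x < e j \<or> x > 2 * e j" for j x
  proof -
    have "(1 / e j) * x + 0 < 1 \<or> (1 / e j) * x + 0 > 2"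
      using that e(1)[of j] by (auto simp: field_simps)
    then show ?thesis by (simp add: q'_def Y1_def Y2_def X10 X20)
  qed
  have x01: "0 \<le> 1 - (norm z)\<^sup>2" "1 - (norm z)\<^sup>2 \<le> 1" if "z \<in> \<D>" for z :: complex
    using norm_squared_less_one[OF that] by auto
  define CT where "CT = real n * (real m * B) + real n * B + real (Suc m) * B"
  have T_le: "norm (T j z) \<le> CT" if z: "z \<in> \<D>" for j z
  proof -
    have rm: "norm (radial_monomial i k f z) \<le> B" if "\<bar>f (1 - (norm z)\<^sup>2)\<bar> \<le> B" for i k f
      using norm_radial_monomial_le[OF z] that by (rule order_trans)
    have "norm (of_nat n * (of_nat m * radial_monomial (m - 1) (n - 1) (p j) z)) \<le> real n * (real m * B)"
      unfolding norm_mult norm_of_nat by (intro mult_left_mono rm p_le x01 z) auto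
    moreover have "norm (of_nat n * radial_monomial m (Suc (n - 1)) (p' j) z) \<le> real n * B"
      unfolding norm_mult norm_of_nat by (intro mult_left_mono rm p'_le) auto
    moreover have "norm (of_nat (Suc m) * radial_monomial m n (q j) z) \<le> real (Suc m) * B"
      unfolding norm_mult norm_of_nat by (intro mult_left_mono rm q_le) auto
    ultimately show ?thesis
      unfolding T_def CT_def by (intro norm_triangle_le_diff add_mono)
  qed
  have R_le: "norm (R j z) \<le> B / e j" if z: "z \<in> \<D>" for j z
    unfolding R_def by (rule order_trans[OF norm_radial_monomial_le[OF z] q'_le])
  have contT: "continuous_on UNIV (T j)" and contR: "continuous_on UNIV (R j)" for j
    unfolding T_def R_def
    by (intro continuous_on_diff continuous_on_mult continuous_on_const cont smooths)+
  have iT: "integrable lebesgue (\<lambda>z. U z * T j z)" for j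
    by (rule integrable_mult_bounded_on[OF U U0 contT T_le])
  have iR: "integrable lebesgue (\<lambda>z. U z * R j z)" for j
    by (rule integrable_mult_bounded_on[OF U U0 contR R_le])
  have TR: "(\<integral>z. U z * T j z \<partial>lebesgue) = - (\<integral>z. U z * R j z \<partial>lebesgue)" for j
  proof -
    have "0 = (\<integral>z. U z * L_bar \<alpha> (radial_monomial m n (\<lambda>x. x powr (\<alpha> + 1) * Y j x)) z \<partial>lebesgue)"
      by (rule ann[OF sY(1) Y0 e(1), symmetric])
    also have "\<dots> = (\<integral>z. - (U z * T j z + U z * R j z) \<partial>lebesgue)"
      unfolding LTR by (intro Bochner_Integration.integral_cong refl) (simp add: algebra_simps)
    also have "\<dots> = - ((\<integral>z. U z * T j z \<partial>lebesgue) + (\<integral>z. U z * R j z \<partial>lebesgue))"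
      using iT[of j] iR[of j] by simp
    finally show ?thesis unfolding eq_neg_iff_add_eq_0 by simp
  qed
  have R_lim: "(\<lambda>j. \<integral>z. U z * R j z \<partial>lebesgue) \<longlonglongrightarrow> 0"
  proof (rule LIMSEQ_I)
    fix \<delta> :: real assume "\<delta> > 0"
    have "B \<ge> 0" using \<open>M \<ge> 0\<close> by (simp add: B_def)
    \<comment> \<open>The integral of \<open>R j\<close> will be at most pi \<open>e j\<close> times
      \<gamma> B / \<open>e j\<close>, that is \<gamma> pi B, and so at most \<delta>/2. Adding 1
      avoids division by zero.\<close>
    define \<gamma> where "\<gamma> = \<delta> / (2 * (pi * B + 1))"
    have pos: "pi * B + 1 > 0" using \<open>B \<ge> 0\<close> by (simp add: add_nonneg_pos)
    then have "\<gamma> > 0" using \<open>\<delta> > 0\<close> by (simp add: \<gamma>_def)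
    obtain r where r: "r < 1" "\<And>z. norm z > r \<Longrightarrow> norm (U z) \<le> \<gamma>"
      using bdry[OF \<open>\<gamma> > 0\<close>] by blast
    \<comment> \<open>A negative \<open>r\<close> may have a large square; passing to the positive
      part keeps \<open>1 - r0\<^sup>2\<close> positive.\<close>
    define r0 where "r0 = max r 0"
    have "1 - r0\<^sup>2 > 0" using r(1) by (simp add: r0_def abs_square_less_1)
    moreover have "(\<lambda>j. 2 * e j) \<longlonglongrightarrow> 0"
      unfolding e_def
      by (intro tendsto_mult_right_zero LIMSEQ_ignore_initial_segment[OF lim_const_over_n])
    ultimately have "\<forall>\<^sub>F j in sequentially. 2 * e j < 1 - r0\<^sup>2"
      by (rule order_tendstoD(2)[rotated])
    then obtain N where N: "\<And>j. j \<ge> N \<Longrightarrow> 2 * e j < 1 - r0\<^sup>2"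
      unfolding eventually_sequentially by blast
    show "\<exists>N. \<forall>j\<ge>N. norm ((\<integral>z. U z * R j z \<partial>lebesgue) - 0) < \<delta>"
    proof (intro exI[of _ N] allI impI)
      fix j assume j: "j \<ge> N"
      define A where "A = {z::complex. 1 - 2 * e j \<le> (norm z)\<^sup>2 \<and> (norm z)\<^sup>2 \<le> 1 - e j}"
      have A: "A \<in> lmeasurable" "measure lebesgue A \<le> pi * e j"
        using measure_annulus_le[OF e] by (simp_all add: A_def)
      have pt: "norm (U z * R j z) \<le> indicator A z * (\<gamma> * (B / e j))" for z
      proof (cases "z \<in> A")
        case True
        then have "r0\<^sup>2 < (norm z)\<^sup>2" using N[OF j] by (simp add: A_def)
        then have "norm z > r0" by (rule power2_less_imp_less) simp
        then have "norm z > r" by (simp add: r0_def)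
        have "(norm z)\<^sup>2 < 1" using True e(1)[of j] by (simp add: A_def)
        then have "z \<in> \<D>" by (simp add: abs_square_less_1)
        have "norm (U z) * norm (R j z) \<le> \<gamma> * (B / e j)"
          using \<open>\<gamma> > 0\<close> by (intro mult_mono r(2) R_le \<open>norm z > r\<close> \<open>z \<in> \<D>\<close>) auto
        then show ?thesis using True by (simp add: norm_mult)
      next
        case False
        then have "R j z = 0"
          unfolding R_def radial_monomial_def A_def by (subst q'_0) (use False in \<open>auto simp: A_def\<close>)
        then show ?thesis using False by simp
      qed
      have "norm (\<integral>z. U z * R j z \<partial>lebesgue) \<le> (\<integral>z. indicator A z * (\<gamma> * (B / e j)) \<partial>lebesgue)"
      proof (rule Bochner_Integration.integral_norm_bound_integral[OF iR])
        show "integrable lebesgue (\<lambda>z. indicator A z * (\<gamma> * (B / e j)))"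
          using A(1) by (intro integrable_mult_left integrable_real_indicator) (auto simp: fmeasurable_def)
      qed (rule pt)
      also have "\<dots> = measure lebesgue A * (\<gamma> * (B / e j))"
        using A(1) by (simp add: fmeasurable_def)
      also have "\<dots> \<le> (pi * e j) * (\<gamma> * (B / e j))"
        using A(2) \<open>\<gamma> > 0\<close> \<open>B \<ge> 0\<close> e(1)[of j] by (intro mult_right_mono) auto
      also have "\<dots> = \<gamma> * (pi * B)" using e(1)[of j] by simp
      also have "\<dots> \<le> \<gamma> * (pi * B + 1)" using \<open>\<gamma> > 0\<close> by (intro mult_left_mono) auto
      also have "\<dots> = \<delta> / 2" using pos by (simp add: \<gamma>_def field_simps)
      also have "\<dots> < \<delta>" using \<open>\<delta> > 0\<close> by simp
      finally show "norm ((\<integral>z. U z * R j z \<partial>lebesgue) - 0) < \<delta>" by simp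
    qed
  qed
  define T' where "T' = (\<lambda>z::complex. of_nat n * of_nat m * (z ^ (m - 1) * cnj z ^ (n - 1))
      - of_nat (Suc m) * of_real (real n + \<alpha> + 1) * (z ^ m * cnj z ^ n))"
  have T_ev: "T j z = T' z" if z: "z \<in> \<D>" and j: "2 * e j < 1 - (norm z)\<^sup>2" for j z
  proof -
    define x where "x = 1 - (norm z)\<^sup>2"
    have "(1 / e j) * x + 0 > 2" using j e(1)[of j] by (simp add: x_def field_simps)
    then have "Y j x = 1" "Y1 j x = 0" by (simp_all add: Y_def Y1_def Xone X10)
    then have "p j x = x" "p' j x = 1" "q j x = \<alpha> + 1"
      by (simp_all add: p_def p'_def q_def)
    moreover have "complex_of_real x = 1 - z * cnj z"
      unfolding x_def of_real_diff of_real_1 complex_norm_square ..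
    ultimately have "T j z = of_nat n * (of_nat m * (z ^ (m - 1) * cnj z ^ (n - 1) * (1 - z * cnj z)))
      - of_nat n * (z ^ m * cnj z ^ Suc (n - 1)) - of_nat (Suc m) * (z ^ m * cnj z ^ n * of_real (\<alpha> + 1))"
      unfolding T_def radial_monomial_def x_def[symmetric] by simp
    \<comment> \<open>Up to sign the coefficients of z^m (cnj z)^n add up to n m + n + (m +
      1)(\<alpha> + 1) = (m + 1)(n + \<alpha> + 1). The case split deals with truncated
      exponents.\<close>
    also have "\<dots> = T' z"
      unfolding T'_def by (cases m; cases n) (simp_all add: algebra_simps)
    finally show ?thesis .
  qed
  have T_lim: "(\<lambda>j. \<integral>z. U z * T j z \<partial>lebesgue) \<longlonglongrightarrow> (\<integral>z. U z * T' z \<partial>lebesgue)"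
  proof (rule integral_dominated_convergence[where w = "\<lambda>z. norm (of_real CT * U z)"])
    have "continuous_on UNIV T'" unfolding T'_def by (intro continuous_intros)
    then have "T' \<in> borel_measurable borel" by (rule borel_measurable_continuous_onI)
    then have "T' \<in> borel_measurable lebesgue" by (intro measurable_completion) simp
    then show "(\<lambda>z. U z * T' z) \<in> borel_measurable lebesgue"
      using U by (intro borel_measurable_times) auto
    show "(\<lambda>z. U z * T j z) \<in> borel_measurable lebesgue" for j
      using iT[of j] by auto
    show "integrable lebesgue (\<lambda>z. norm (of_real CT * U z))"
      using U by (intro integrable_norm) simp
    show "AE z in lebesgue. norm (U z * T j z) \<le> norm (of_real CT * U z)" for j
    proof (rule AE_I2)
      fix z
      show "norm (U z * T j z) \<le> norm (of_real CT * U z)"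
      proof (cases "z \<in> \<D>")
        case True
        have "norm (T j z) \<le> \<bar>CT\<bar>" using T_le[OF True, of j] by linarith
        from mult_right_mono[OF this norm_ge_zero[of "U z"]] show ?thesis
          by (simp add: norm_mult mult.commute)
      qed (simp add: U0)
    qed
    show "AE z in lebesgue. (\<lambda>j. U z * T j z) \<longlonglongrightarrow> U z * T' z"
    proof (rule AE_I2)
      fix z
      show "(\<lambda>j. U z * T j z) \<longlonglongrightarrow> U z * T' z"
      proof (cases "z \<in> \<D>")
        case True
        have "(\<lambda>j. 2 * e j) \<longlonglongrightarrow> 0" unfolding e_def
      by (intro tendsto_mult_right_zero LIMSEQ_ignore_initial_segment[OF lim_const_over_n])
        then have "\<forall>\<^sub>F j in sequentially. 2 * e j < 1 - (norm z)\<^sup>2"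
          using norm_squared_less_one[OF True] by (rule order_tendstoD(2))
        then have "\<forall>\<^sub>F j in sequentially. U z * T' z = U z * T j z"
          by eventually_elim (simp add: T_ev[OF True])
        then show ?thesis by (rule Lim_transform_eventually[OF tendsto_const])
      qed (simp add: U0)
    qed
  qed
  have "(\<lambda>j. \<integral>z. U z * T j z \<partial>lebesgue) \<longlonglongrightarrow> - 0"
    unfolding TR by (rule tendsto_minus[OF R_lim])
  then have zero: "(\<integral>z. U z * T' z \<partial>lebesgue) = 0"
    using LIMSEQ_unique[OF T_lim] by simp
  have imom: "integrable lebesgue (\<lambda>z. U z * (z ^ i * cnj z ^ k))" for i k
  proof (rule integrable_mult_bounded_on[OF U U0])
    show "continuous_on UNIV (\<lambda>z::complex. z ^ i * cnj z ^ k)" by (intro continuous_intros)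
    show "norm (z ^ i * cnj z ^ k) \<le> 1" if "z \<in> \<D>" for z
      using that by (simp add: norm_mult norm_power mult_le_one power_le_one)
  qed
  have "(\<integral>z. U z * T' z \<partial>lebesgue) =
      (\<integral>z. of_nat n * of_nat m * (U z * (z ^ (m - 1) * cnj z ^ (n - 1)))
        - of_nat (Suc m) * of_real (real n + \<alpha> + 1) * (U z * (z ^ m * cnj z ^ n)) \<partial>lebesgue)"
    by (rule Bochner_Integration.integral_cong[OF refl]) (simp add: T'_def algebra_simps)
  also have "\<dots> = of_nat n * of_nat m * (\<integral>z. U z * (z ^ (m - 1) * cnj z ^ (n - 1)) \<partial>lebesgue)
    - of_nat (Suc m) * of_real (real n + \<alpha> + 1) * (\<integral>z. U z * (z ^ m * cnj z ^ n) \<partial>lebesgue)"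
    by (subst Bochner_Integration.integral_diff) (intro integrable_mult_right imom, intro integrable_mult_right imom,
        simp only: integral_mult_right_zero)
  finally show ?thesis using zero by simp
qed

section \<open>Vanishing moments\<close>

text \<open>The factor on the right is nonzero because \<alpha> > -1. For n = 0 the left side is 0;
  otherwise it contains a moment with smaller n, which vanishes by induction for every m.\<close>

lemma moments_vanish:
  fixes I :: "nat \<Rightarrow> nat \<Rightarrow> complex" and \<alpha> :: real
  assumes "\<alpha> > -1"
    and rec: "\<And>m n. of_nat n * of_nat m * I (m - 1) (n - 1) = of_nat (Suc m) * of_real (real n + \<alpha> + 1) * I m n"
  shows "I m n = 0"
proof (induction n arbitrary: m)
  case 0
  have "of_real (real 0 + \<alpha> + 1) \<noteq> (0::complex)" using assms(1) unfolding of_real_eq_0_iff by linarith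
  then show ?case using rec[of 0 m] by (simp del: of_nat_Suc)
next
  case (Suc n)
  have "of_real (real (Suc n) + \<alpha> + 1) \<noteq> (0::complex)" using assms(1) unfolding of_real_eq_0_iff by linarith
  then show ?case using rec[of "Suc n" m] Suc by (simp del: of_nat_Suc)
qed

lemma sigma_finite_lebesgue: "sigma_finite_measure (lebesgue :: 'a::euclidean_space measure)"
proof
  obtain F :: "'a set set" where F: "countable F" "F \<subseteq> sets lborel" "\<Union>F = space lborel" "\<forall>a\<in>F. emeasure lborel a \<noteq> \<infinity>"
    using lborel.sigma_finite_countable by blast
  have "emeasure lebesgue a = emeasure lborel a" if "a \<in> F" for a
    using that F(2) by (simp add: emeasure_completion main_part_sets subset_eq)
  then show "\<exists>A::'a set set. countable A \<and> A \<subseteq> sets lebesgue \<and> \<Union> A = space lebesgue \<and> (\<forall>a\<in>A. emeasure lebesgue a \<noteq> \<infinity>)"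
    using F by (intro exI[of _ F]) (auto intro: sets_completionI_sets)
qed

locale vanishing_moments =
  fixes U :: "complex \<Rightarrow> complex"
  assumes U: "integrable lebesgue U" and U0: "\<And>z. z \<notin> \<D> \<Longrightarrow> U z = 0"
    and mom: "\<And>m n. (\<integral>z. U z * (z ^ m * cnj z ^ n) \<partial>lebesgue) = 0"
begin

text \<open>The class of all \<open>f\<close> such that \<open>f U\<close> again has vanishing moments is stable under multiplication by
  \<open>z\<close> and \<open>cnj z\<close>, hence by polynomials.\<close>

definition Ann :: "(complex \<Rightarrow> complex) \<Rightarrow> bool" where
  "Ann f \<longleftrightarrow> continuous_on UNIV f \<and> (\<forall>m n. (\<integral>z. U z * (f z * (z ^ m * cnj z ^ n)) \<partial>lebesgue) = 0)"

lemma integrable_mult_continuous: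
  assumes "continuous_on UNIV f"
  shows "integrable lebesgue (\<lambda>z. U z * f z)"
proof -
  have "bounded (f ` cball 0 1)"
    by (intro compact_imp_bounded compact_continuous_image continuous_on_subset[OF assms] subset_UNIV compact_cball)
  then obtain C where C: "\<And>z. z \<in> cball 0 1 \<Longrightarrow> norm (f z) \<le> C"
    unfolding bounded_iff ball_simps by blast
  show ?thesis
  proof (rule integrable_mult_bounded_on[OF U U0 assms])
    show "norm (f z) \<le> C" if "z \<in> \<D>" for z
      by (rule C) (use that in auto)
  qed
qed

lemma Ann_lincomb:
  assumes "Ann f" "Ann g"
  shows "Ann (\<lambda>z. a * f z + b * g z)"
  unfolding Ann_def
proof (intro conjI allI)
  note cont = assms[unfolded Ann_def, THEN conjunct1]
  note zero = assms[unfolded Ann_def, THEN conjunct2, rule_format]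
  show "continuous_on UNIV (\<lambda>z. a * f z + b * g z)"
    by (intro continuous_on_add continuous_on_mult continuous_on_const cont)
  fix m n
  have i: "integrable lebesgue (\<lambda>z. U z * (h z * (z ^ m * cnj z ^ n)))" if "continuous_on UNIV h" for h
    by (intro integrable_mult_continuous continuous_on_mult that continuous_intros)
  have "(\<integral>z. U z * ((a * f z + b * g z) * (z ^ m * cnj z ^ n)) \<partial>lebesgue) =
      (\<integral>z. a * (U z * (f z * (z ^ m * cnj z ^ n))) + b * (U z * (g z * (z ^ m * cnj z ^ n))) \<partial>lebesgue)"
    by (rule Bochner_Integration.integral_cong[OF refl]) (simp add: algebra_simps)
  also have "\<dots> = a * (\<integral>z. U z * (f z * (z ^ m * cnj z ^ n)) \<partial>lebesgue)
      + b * (\<integral>z. U z * (g z * (z ^ m * cnj z ^ n)) \<partial>lebesgue)"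
    by (subst Bochner_Integration.integral_add)
       (intro integrable_mult_right i cont, intro integrable_mult_right i cont, simp only: integral_mult_right_zero)
  finally show "(\<integral>z. U z * ((a * f z + b * g z) * (z ^ m * cnj z ^ n)) \<partial>lebesgue) = 0"
    by (simp add: zero)
qed

lemma Ann_mult_z:
  assumes "Ann f"
  shows "Ann (\<lambda>z. f z * z)" "Ann (\<lambda>z. f z * cnj z)"
proof -
  note cont = assms[unfolded Ann_def, THEN conjunct1]
  note zero = assms[unfolded Ann_def, THEN conjunct2, rule_format]
  have "(\<integral>z. U z * (f z * z * (z ^ m * cnj z ^ n)) \<partial>lebesgue) = 0" for m n
    using zero[of "Suc m" n] by (simp add: mult_ac)
  moreover have "(\<integral>z. U z * (f z * cnj z * (z ^ m * cnj z ^ n)) \<partial>lebesgue) = 0" for m n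
    using zero[of m "Suc n"] by (simp add: mult_ac)
  moreover have "continuous_on UNIV (\<lambda>z. f z * z)" "continuous_on UNIV (\<lambda>z. f z * cnj z)"
    by (intro continuous_on_mult cont continuous_on_cnj continuous_on_id)+
  ultimately show "Ann (\<lambda>z. f z * z)" "Ann (\<lambda>z. f z * cnj z)"
    unfolding Ann_def by blast+
qed

lemma Ann_mult_polynomial:
  assumes "real_polynomial_function p"
  shows "Ann f \<Longrightarrow> Ann (\<lambda>z. f z * of_real (p z))"
  using assms
proof (induction p arbitrary: f rule: real_polynomial_function.induct)
  case (linear p)
  then interpret bounded_linear p by simp
  define a b where "a = complex_of_real (p 1)" and "b = complex_of_real (p \<i>)"
  \<comment> \<open>A real-linear form on the plane is a complex combination of z and
    \<open>cnj z\<close>, which reduces this case to \<open>Ann_mult_z\<close>.\<close>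
  have "complex_of_real (p z) = (a - \<i> * b) / 2 * z + (a + \<i> * b) / 2 * cnj z" for z
  proof -
    have "z = Re z *\<^sub>R 1 + Im z *\<^sub>R \<i>" by (simp add: complex_eq_iff)
    then have "p z = Re z * p 1 + Im z * p \<i>"
      by (metis add scaleR real_scaleR_def)
    then show ?thesis
      by (simp add: a_def b_def complex_eq_iff algebra_simps add_divide_distrib diff_divide_distrib)
  qed
  then have "(\<lambda>z. f z * of_real (p z)) = (\<lambda>z. (a - \<i> * b) / 2 * (f z * z) + (a + \<i> * b) / 2 * (f z * cnj z))"
    by (auto simp: algebra_simps)
  then show ?case
    using Ann_lincomb[OF Ann_mult_z[OF linear.prems], of "(a - \<i> * b) / 2" "(a + \<i> * b) / 2"] by (simp only:)
next
  case (const c)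
  then show ?case
    using Ann_lincomb[OF const const, of "of_real c" 0] by (simp add: mult.commute)
next
  case (add p q)
  then show ?case
    using Ann_lincomb[OF add.IH(1)[OF add.prems] add.IH(2)[OF add.prems], of 1 1] by (simp add: distrib_left)
next
  case (mult p q)
  then show ?case
    using mult.IH(2)[OF mult.IH(1)[OF mult.prems]] by (simp add: mult.assoc)
qed

lemma integral_mult_continuous:
  fixes \<psi> :: "complex \<Rightarrow> real"
  assumes "continuous_on UNIV \<psi>"
  shows "(\<integral>z. U z * of_real (\<psi> z) \<partial>lebesgue) = 0"
proof (rule ccontr)
  assume "(\<integral>z. U z * of_real (\<psi> z) \<partial>lebesgue) \<noteq> 0"
  then have pos: "norm (\<integral>z. U z * of_real (\<psi> z) \<partial>lebesgue) > 0" by simp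
  define N where "N = (\<integral>z. norm (U z) \<partial>lebesgue)"
  \<comment> \<open>The approximation error is chosen so that d N < d (N + 1) = |integral|; the
    summand 1 also covers N = 0.\<close>
  define d where "d = norm (\<integral>z. U z * of_real (\<psi> z) \<partial>lebesgue) / (N + 1)"
  have "N \<ge> 0" by (simp add: N_def)
  then have "d > 0" using pos by (simp add: d_def)
  obtain p where p: "real_polynomial_function p" "\<And>z. z \<in> cball 0 1 \<Longrightarrow> \<bar>\<psi> z - p z\<bar> < d"
    using Stone_Weierstrass_real_polynomial_function[OF compact_cball continuous_on_subset[OF assms subset_UNIV] \<open>d > 0\<close>]
    by metis
  have "Ann (\<lambda>_. 1)" unfolding Ann_def using mom by simp
  from Ann_mult_polynomial[OF p(1) this]
  have "Ann (\<lambda>z. of_real (p z))" by simp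
  then have "\<forall>m n. (\<integral>z. U z * (of_real (p z) * (z ^ m * cnj z ^ n)) \<partial>lebesgue) = 0"
    unfolding Ann_def by blast
  from spec[OF spec[OF this, of 0], of 0]
  have zero: "(\<integral>z. U z * of_real (p z) \<partial>lebesgue) = 0" by simp
  have contp: "continuous_on UNIV p"
    by (intro continuous_at_imp_continuous_on ballI continuous_real_polymonial_function[OF p(1)])
  have i1: "integrable lebesgue (\<lambda>z. U z * of_real (\<psi> z))" and i2: "integrable lebesgue (\<lambda>z. U z * of_real (p z))"
    by (intro integrable_mult_continuous continuous_on_of_real assms contp)+
  have "(\<integral>z. U z * of_real (\<psi> z) \<partial>lebesgue) = (\<integral>z. U z * of_real (\<psi> z) - U z * of_real (p z) \<partial>lebesgue)"
    using zero i1 i2 by simp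
  also have "norm \<dots> \<le> (\<integral>z. d * norm (U z) \<partial>lebesgue)"
  proof (rule Bochner_Integration.integral_norm_bound_integral)
    show "integrable lebesgue (\<lambda>z. U z * of_real (\<psi> z) - U z * of_real (p z))"
      by (rule Bochner_Integration.integrable_diff[OF i1 i2])
    show "integrable lebesgue (\<lambda>z. d * norm (U z))"
      by (intro integrable_mult_right integrable_norm U)
    fix z :: complex
    show "norm (U z * of_real (\<psi> z) - U z * of_real (p z)) \<le> d * norm (U z)"
    proof (cases "z \<in> \<D>")
      case True
      then have "\<bar>\<psi> z - p z\<bar> \<le> d" using p(2)[of z] by simp
      from mult_right_mono[OF this norm_ge_zero[of "U z"]]
      show ?thesis
        by (simp add: norm_mult mult.commute flip: right_diff_distrib of_real_diff)
    qed (simp add: U0)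
  qed
  also have "\<dots> = d * N" by (simp add: N_def)
  also have "\<dots> < d * (N + 1)" using \<open>d > 0\<close> by simp
  also have "\<dots> = norm (\<integral>z. U z * of_real (\<psi> z) \<partial>lebesgue)"
    using \<open>N \<ge> 0\<close> by (simp add: d_def)
  finally show False by simp
qed

lemma integral_closed:
  assumes "closed K"
  shows "(LINT z:K|lebesgue. U z) = 0"
\<comment> \<open>The empty set is separate because \<open>infdist z {} = 0\<close> would make every
  \<open>\<psi> n\<close> equal to 1.\<close>
proof (cases "K = {}")
  case False
  define \<psi> where "\<psi> = (\<lambda>n z. max 0 (1 - real n * infdist z K))"
  have "(\<lambda>n. \<integral>z. U z * of_real (\<psi> n z) \<partial>lebesgue) \<longlonglongrightarrow> (\<integral>z. indicator K z *\<^sub>R U z \<partial>lebesgue)"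
  proof (rule integral_dominated_convergence[where w = "\<lambda>z. norm (U z)"])
    have cont: "continuous_on UNIV (\<psi> n)" for n
      unfolding \<psi>_def by (intro continuous_intros)
    then show "(\<lambda>z. U z * of_real (\<psi> n z)) \<in> borel_measurable lebesgue" for n
      by (intro borel_measurable_integrable integrable_mult_continuous continuous_on_of_real)
    have "K \<in> sets lebesgue" using assms by simp
    then show "(\<lambda>z. indicator K z *\<^sub>R U z) \<in> borel_measurable lebesgue"
      using U by (intro borel_measurable_scaleR borel_measurable_indicator) auto
    show "integrable lebesgue (\<lambda>z. norm (U z))" using U by (rule integrable_norm)
    show "AE z in lebesgue. norm (U z * of_real (\<psi> n z)) \<le> norm (U z)" for n
    proof (rule AE_I2)
      fix z
      have "\<bar>\<psi> n z\<bar> \<le> 1" by (simp add: \<psi>_def infdist_nonneg)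
      from mult_left_mono[OF this norm_ge_zero[of "U z"]]
      show "norm (U z * of_real (\<psi> n z)) \<le> norm (U z)" by (simp add: norm_mult)
    qed
    show "AE z in lebesgue. (\<lambda>n. U z * of_real (\<psi> n z)) \<longlonglongrightarrow> indicator K z *\<^sub>R U z"
    proof (rule AE_I2)
      fix z
      show "(\<lambda>n. U z * of_real (\<psi> n z)) \<longlonglongrightarrow> indicator K z *\<^sub>R U z"
      proof (cases "z \<in> K")
        case True
        then show ?thesis by (simp add: \<psi>_def)
      next
        case out: False
        then have d: "infdist z K > 0"
          using infdist_pos_not_in_closed[OF assms False] by simp
        obtain N where N: "real N * infdist z K > 1"
          using reals_Archimedean3[OF d] by blast
        have "\<psi> n z = 0" if "n \<ge> N" for n
        proof -
          have "real N * infdist z K \<le> real n * infdist z K"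
            using that d by (intro mult_right_mono) auto
          then show ?thesis using N by (simp add: \<psi>_def)
        qed
        then have "\<forall>\<^sub>F n in sequentially. 0 = U z * of_real (\<psi> n z)"
          unfolding eventually_sequentially by (intro exI[of _ N]) simp
        then show ?thesis
          using out by (simp add: Lim_transform_eventually[OF tendsto_const])
      qed
    qed
  qed
  moreover have "(\<integral>z. U z * of_real (\<psi> n z) \<partial>lebesgue) = 0" for n
    by (rule integral_mult_continuous) (unfold \<psi>_def, intro continuous_intros)
  ultimately show ?thesis
    unfolding set_lebesgue_integral_def by (simp add: LIMSEQ_const_iff)
qed (simp add: set_lebesgue_integral_def)

lemma set_integrable_U: "A \<in> sets lebesgue \<Longrightarrow> set_integrable lebesgue A U"
  unfolding set_integrable_def by (rule integrable_mult_indicator[OF _ U])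

text \<open>The closed sets generate the Borel sets and are stable under intersection, so the Dynkin
  induction extends the vanishing from them.\<close>

lemma integral_borel:
  assumes "A \<in> sets borel"
  shows "(LINT z:A|lebesgue. U z) = 0"
proof -
  have A: "A \<in> sigma_sets UNIV (Collect closed)"
    using assms by (simp add: borel_eq_closed sets_measure_of)
  have "Int_stable (Collect closed :: complex set set)" "Collect closed \<subseteq> Pow (UNIV :: complex set)"
    by (auto simp: Int_stable_def)
  from this A show ?thesis
  proof (induction rule: sigma_sets_induct_disjoint)
    case (basic A)
    then show ?case by (intro integral_closed) simp
  next
    case empty
    then show ?case by (simp add: set_lebesgue_integral_def)
  next
    case (compl A)
    then have A: "A \<in> sets lebesgue"
      by (auto simp: borel_eq_closed sets_measure_of intro!: sets_completionI_sets)
    have "(LINT z:A \<union> (UNIV - A)|lebesgue. U z) = (LINT z:A|lebesgue. U z) + (LINT z:UNIV - A|lebesgue. U z)"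
      by (rule set_integral_Un) (use A in \<open>auto intro!: set_integrable_U\<close>)
    moreover have "(LINT z:UNIV|lebesgue. U z) = 0" by (rule integral_closed) simp
    ultimately show ?case using compl by simp
  next
    case (union A)
    then have "A i \<in> sigma_sets UNIV (Collect closed)" for i by blast
    then have A: "A i \<in> sets lebesgue" for i
      by (auto simp: borel_eq_closed sets_measure_of intro!: sets_completionI_sets)
    then have "(LINT z:(\<Union>i. A i)|lebesgue. U z) = (\<Sum>i. LINT z:A i|lebesgue. U z)"
      using union(1) by (intro lebesgue_integral_countable_add set_integrable_U) (auto simp: disjoint_family_on_def)
    then show ?case using union by simp
  qed
qed

theorem AE_zero: "AE z in lebesgue. U z = 0"
proof (rule sigma_finite_measure.density_zero[OF sigma_finite_lebesgue U])
  fix A :: "complex set" assume "A \<in> sets lebesgue"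
  then obtain S N N' where A: "A = S \<union> N" "N \<subseteq> N'" "N' \<in> null_sets lborel" "S \<in> sets borel"
    by (rule sets_completionE) auto
  have "AE z in lebesgue. z \<notin> N'"
    using A(3) by (intro AE_not_in null_sets_completionI)
  then have "AE z in lebesgue. z \<in> S \<longleftrightarrow> z \<in> A"
    by eventually_elim (use A in auto)
  then have "(LINT z:A|lebesgue. U z) = (LINT z:S|lebesgue. U z)"
  proof (intro set_integral_cong_set)
    have "S \<in> sets lebesgue" using A(4) by (simp add: sets_completionI_sets)
    with \<open>A \<in> sets lebesgue\<close>
    show "set_borel_measurable lebesgue A U" "set_borel_measurable lebesgue S U"
      using set_integrable_U unfolding set_borel_measurable_def set_integrable_def by auto
  qed
  then show "(LINT z:A|lebesgue. U z) = 0"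
    using integral_borel[OF A(4)] by simp
qed

end

section \<open>Uniqueness\<close>

lemma L1_loc_integrable_mult:
  assumes "v \<in> L1_loc" "compact S" "S \<subseteq> \<D>" "continuous_on UNIV \<psi>" "\<And>z. z \<notin> S \<Longrightarrow> \<psi> z = 0"
  shows "integrable lebesgue (\<lambda>z. v z * \<psi> z)"
proof -
  have int: "integrable lebesgue (\<lambda>z. indicator S z *\<^sub>R v z)"
    using assms(1-3) unfolding L1_loc_def set_integrable_def by blast
  have "bounded (\<psi> ` cball 0 1)"
    by (intro compact_imp_bounded compact_continuous_image continuous_on_subset[OF assms(4)] subset_UNIV compact_cball)
  then obtain C where C: "\<And>z. z \<in> cball 0 1 \<Longrightarrow> norm (\<psi> z) \<le> C"
    unfolding bounded_iff ball_simps by blast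
  have "integrable lebesgue (\<lambda>z. indicator S z *\<^sub>R v z * \<psi> z)"
  proof (rule integrable_mult_bounded_on[OF int _ assms(4)])
    show "indicator S z *\<^sub>R v z = 0" if "z \<notin> \<D>" for z
      using that assms(3) by (auto simp: indicator_def)
    show "norm (\<psi> z) \<le> C" if "z \<in> \<D>" for z
      by (rule C) (use that in auto)
  qed
  moreover have "indicator S z *\<^sub>R v z * \<psi> z = v z * \<psi> z" for z
    using assms(5) by (cases "z \<in> S") auto
  ultimately show ?thesis by simp
qed

lemma distr_of_compact_support:
  assumes "S \<subseteq> \<D>" "\<And>z. z \<notin> S \<Longrightarrow> \<psi> z = 0"
  shows "distr_of v \<psi> = of_real (1 / pi) * (\<integral>z. v z * \<psi> z \<partial>lebesgue)"
proof -
  have "indicator \<D> z *\<^sub>R (v z * \<psi> z) = v z * \<psi> z" for z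
    using assms by (cases "z \<in> S") auto
  then show ?thesis by (simp add: distr_of_def set_lebesgue_integral_def)
qed

lemma distr_of_diff:
  assumes "u \<in> L1_loc" "v \<in> L1_loc" "compact S" "S \<subseteq> \<D>" "continuous_on UNIV \<psi>"
    "\<And>z. z \<notin> S \<Longrightarrow> \<psi> z = 0" "distr_of u \<psi> = distr_of v \<psi>"
  shows "(\<integral>z. (indicator \<D> z *\<^sub>R (u z - v z)) * \<psi> z \<partial>lebesgue) = 0"
proof -
  have "(indicator \<D> z *\<^sub>R (u z - v z)) * \<psi> z = u z * \<psi> z - v z * \<psi> z" for z
    using assms(4,6) by (cases "z \<in> S") (auto simp: left_diff_distrib)
  then have "(\<integral>z. (indicator \<D> z *\<^sub>R (u z - v z)) * \<psi> z \<partial>lebesgue)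
      = (\<integral>z. u z * \<psi> z \<partial>lebesgue) - (\<integral>z. v z * \<psi> z \<partial>lebesgue)"
    using L1_loc_integrable_mult[OF assms(1,3,4,5,6)] L1_loc_integrable_mult[OF assms(2,3,4,5,6)] by simp
  then show ?thesis
    using assms(7) distr_of_compact_support[OF assms(4,6)] by simp
qed

text \<open>The explicit formula exhibits continuity and compact support, which allow integration
  against a merely locally integrable function.\<close>

lemma L_bar_radial_monomial_support:
  fixes \<alpha> e :: real and m n :: nat and X :: "real \<Rightarrow> real"
  assumes X: "smooth X" "\<And>x. x < e \<Longrightarrow> X x = 0" "e > 0"
  defines "\<psi> \<equiv> L_bar \<alpha> (radial_monomial m n (\<lambda>x. x powr (\<alpha> + 1) * X x))"
  shows "continuous_on UNIV \<psi>" "z \<notin> {z. (norm z)\<^sup>2 \<le> 1 - e} \<Longrightarrow> \<psi> z = 0"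
proof -
  obtain X1 where X1: "\<And>x. (X has_real_derivative X1 x) (at x)" "smooth X1"
    using smooth_derivative[OF X(1)] by blast
  obtain X2 where X2: "\<And>x. (X1 has_real_derivative X2 x) (at x)" "smooth X2"
    using smooth_derivative[OF X1(2)] by blast
  have X10: "X1 x = 0" if "x < e" for x by (rule derivative_zero_below[OF X1(1) that X(2)])
  have X20: "X2 x = 0" if "x < e" for x by (rule derivative_zero_below[OF X2(1) that X10])
  have \<psi>: "\<psi> = (\<lambda>z. - (of_nat n * (of_nat m * radial_monomial (m - 1) (n - 1) (\<lambda>x. x * X x) z)
      - of_nat n * radial_monomial m (Suc (n - 1)) (\<lambda>x. X x + x * X1 x) z
      - of_nat (Suc m) * radial_monomial m n (\<lambda>x. (\<alpha> + 1) * X x + x * X1 x) z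
      + radial_monomial (Suc m) (Suc n) (\<lambda>x. (\<alpha> + 2) * X1 x + x * X2 x) z))"
    unfolding \<psi>_def by (rule ext, rule L_bar_radial_monomial[OF X X1(1) X2(1)])
  have cont: "continuous_on UNIV (radial_monomial i k f)" if "smooth f" for i k f
    by (rule Ck_imp_continuous[OF Ck_radial_monomial[OF that, where k = 0]])
  have s: "smooth (\<lambda>x. x * X x)" "smooth (\<lambda>x. X x + x * X1 x)"
    "smooth (\<lambda>x. (\<alpha> + 1) * X x + x * X1 x)" "smooth (\<lambda>x. (\<alpha> + 2) * X1 x + x * X2 x)"
    by (rule smooth_mult[OF smooth_ident X(1)],
        rule smooth_add[OF X(1) smooth_mult[OF smooth_ident X1(2)]],
        rule smooth_add[OF smooth_mult[OF smooth_const X(1)] smooth_mult[OF smooth_ident X1(2)]],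
        rule smooth_add[OF smooth_mult[OF smooth_const X1(2)] smooth_mult[OF smooth_ident X2(2)]])
  show "continuous_on UNIV \<psi>"
    unfolding \<psi>
    by (intro continuous_on_minus continuous_on_add continuous_on_diff continuous_on_mult
        continuous_on_const cont s)
  show "\<psi> z = 0" if z: "z \<notin> {z. (norm z)\<^sup>2 \<le> 1 - e}"
    unfolding \<psi> by (subst (1 2 3 4) radial_monomial_eq_0[OF _ z]) (simp_all add: X(2) X10 X20)
qed

text \<open>The points of the disc where |u| > \<delta> cannot accumulate at the circle, since this
  would contradict the limit there. Their closure is compact in the open disc and hence lies in a
  smaller disc.\<close>

lemma uniform_boundary_decay:
  fixes u :: "complex \<Rightarrow> complex"
  assumes lim: "\<And>\<zeta>. \<zeta> \<in> sphere 0 1 \<Longrightarrow> (u \<longlongrightarrow> 0) (at \<zeta> within \<D>)" and "\<delta> > 0"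
  shows "\<exists>r<1. \<forall>z. norm z > r \<longrightarrow> norm (indicator \<D> z *\<^sub>R u z) \<le> \<delta>"
proof -
  define T where "T = {z \<in> \<D>. norm (u z) > \<delta>}"
  have T: "closure T \<subseteq> cball 0 1"
    by (rule closure_minimal) (auto simp: T_def)
  have "norm \<zeta> < 1" if cl: "\<zeta> \<in> closure T" for \<zeta>
  proof (rule ccontr)
    assume "\<not> norm \<zeta> < 1"
    then have sph: "\<zeta> \<in> sphere 0 1" using T cl by auto
    have "\<forall>\<^sub>F z in at \<zeta> within \<D>. dist (u z) 0 < \<delta>"
      by (rule tendstoD[OF lim[OF sph] \<open>\<delta> > 0\<close>])
    then obtain d where d: "d > 0" "\<And>z. z \<in> \<D> \<Longrightarrow> z \<noteq> \<zeta> \<Longrightarrow> dist z \<zeta> < d \<Longrightarrow> norm (u z) < \<delta>"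
      unfolding eventually_at by auto
    obtain z where z: "z \<in> T" "dist z \<zeta> < d"
      using cl \<open>d > 0\<close> unfolding closure_approachable by blast
    then have "z \<in> \<D>" "z \<noteq> \<zeta>" using sph by (auto simp: T_def)
    then show False using d(2)[of z] z by (simp add: T_def)
  qed
  moreover have "compact (closure T)"
    using T bounded_subset[OF bounded_cball] by (simp add: compact_eq_bounded_closed)
  ultimately obtain r where r: "r < 1" "\<And>z. z \<in> closure T \<Longrightarrow> norm z \<le> r"
  proof (cases "T = {}")
    case True
    then show thesis using that[of 0] by simp
  next
    case False
    then obtain x where "x \<in> closure T" "\<forall>y\<in>closure T. norm y \<le> norm x"
      using continuous_attains_sup[OF \<open>compact (closure T)\<close>, of norm] continuous_on_norm_id by auto
    then show thesis using that[of "norm x"] \<open>\<And>\<zeta>. \<zeta> \<in> closure T \<Longrightarrow> norm \<zeta> < 1\<close> by blast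
  qed
  have "norm (indicator \<D> z *\<^sub>R u z) \<le> \<delta>" if "norm z > r" for z
  proof -
    have "z \<notin> T" using r(2)[of z] closure_subset[of T] that by auto
    then show ?thesis using \<open>\<delta> > 0\<close> by (auto simp: T_def indicator_def)
  qed
  then show ?thesis using r(1) by blast
qed

text \<open>Near the centre local integrability applies; near the circle the function is at most 1
  on a set of finite area. Measurability comes from exhausting the disc by the closed discs
  \<open>S n\<close>.\<close>

lemma L1_loc_decay_integrable:
  assumes loc: "\<And>S. compact S \<Longrightarrow> S \<subseteq> \<D> \<Longrightarrow> set_integrable lebesgue S u"
    and decay: "r < 1" "\<And>z. norm z > r \<Longrightarrow> norm (indicator \<D> z *\<^sub>R u z :: complex) \<le> 1"
  shows "integrable lebesgue (\<lambda>z. indicator \<D> z *\<^sub>R u z)"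
proof (rule Bochner_Integration.integrable_bound)
  define S where "S = (\<lambda>n. cball (0::complex) (1 - 1 / real (n + 2)))"
  have S: "compact (S n)" "S n \<subseteq> \<D>" for n
  proof -
    have "0 < 1 / real (n + 2)" by simp
    then show "S n \<subseteq> \<D>"
      unfolding S_def by (intro subsetI, unfold mem_cball mem_ball) linarith
  qed (simp add: S_def)
  show "(\<lambda>z. indicator \<D> z *\<^sub>R u z) \<in> borel_measurable lebesgue"
  proof (rule borel_measurable_LIMSEQ_metric)
    show "(\<lambda>z. indicator (S n) z *\<^sub>R u z) \<in> borel_measurable lebesgue" for n
      using loc[OF S] unfolding set_integrable_def by (rule borel_measurable_integrable)
    show "(\<lambda>n. indicator (S n) z *\<^sub>R u z) \<longlonglongrightarrow> indicator \<D> z *\<^sub>R u z" for z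
    proof (cases "z \<in> \<D>")
      case True
      have "(\<lambda>n. 1 - 1 / real (n + 2)) \<longlonglongrightarrow> 1 - 0"
        by (intro tendsto_diff tendsto_const LIMSEQ_ignore_initial_segment[OF lim_const_over_n])
      then have "\<forall>\<^sub>F n in sequentially. norm z < 1 - 1 / real (n + 2)"
        by (rule order_tendstoD(1)) (use True in simp)
      then have "\<forall>\<^sub>F n in sequentially. indicator \<D> z *\<^sub>R u z = indicator (S n) z *\<^sub>R u z"
        by eventually_elim (use True in \<open>simp add: S_def\<close>)
      then show ?thesis by (rule Lim_transform_eventually[OF tendsto_const])
    next
      case False
      then have "z \<notin> S n" for n using S(2) by blast
      then show ?thesis using False by simp
    qed
  qed
  have "cball 0 r \<subseteq> \<D>" using decay(1) by auto
  then have "integrable lebesgue (\<lambda>z. indicator (cball 0 r) z *\<^sub>R u z)"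
    using loc[of "cball 0 r"] by (simp add: set_integrable_def)
  moreover have "integrable lebesgue (indicator \<D> :: complex \<Rightarrow> real)"
    by (rule integrable_real_indicator) (use lmeasurable_ball[of "0::complex" 1] in \<open>auto simp: fmeasurable_def\<close>)
  ultimately show "integrable lebesgue (\<lambda>z. norm (indicator (cball 0 r) z *\<^sub>R u z) + indicator \<D> z)"
    by (intro Bochner_Integration.integrable_add integrable_norm)
  show "AE z in lebesgue. norm (indicator \<D> z *\<^sub>R u z)
      \<le> norm (norm (indicator (cball 0 r) z *\<^sub>R u z) + indicator \<D> z)"
  proof (rule AE_I2)
    fix z
    show "norm (indicator \<D> z *\<^sub>R u z) \<le> norm (norm (indicator (cball 0 r) z *\<^sub>R u z) + indicator \<D> z)"
      using decay(2)[of z] by (cases "norm z \<le> r"; cases "z \<in> \<D>") auto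
  qed
qed

theorem Green_function_unique:
  assumes \<alpha>: "\<alpha> > -1" and K: "is_Green_function \<alpha> K" and G: "is_Green_function \<alpha> G" and w: "w \<in> \<D>"
  shows "AE z in lebesgue. z \<in> \<D> \<longrightarrow> K z w = G z w"
proof -
  define U where "U = (\<lambda>z. indicator \<D> z *\<^sub>R (K z w - G z w))"
  have K1: "(\<lambda>z. K z w) \<in> L1_loc" and K2: "distr_eq (L_op \<alpha> (distr_of (\<lambda>z. K z w))) (dirac w)"
    and K3: "\<And>\<zeta>. \<zeta> \<in> sphere 0 1 \<Longrightarrow> ((\<lambda>z. K z w) \<longlongrightarrow> 0) (at \<zeta> within \<D>)"
    using K w unfolding is_Green_function_def by blast+
  have G1: "(\<lambda>z. G z w) \<in> L1_loc" and G2: "distr_eq (L_op \<alpha> (distr_of (\<lambda>z. G z w))) (dirac w)"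
    and G3: "\<And>\<zeta>. \<zeta> \<in> sphere 0 1 \<Longrightarrow> ((\<lambda>z. G z w) \<longlongrightarrow> 0) (at \<zeta> within \<D>)"
    using G w unfolding is_Green_function_def by blast+
  have lim: "((\<lambda>z. K z w - G z w) \<longlongrightarrow> 0) (at \<zeta> within \<D>)" if "\<zeta> \<in> sphere 0 1" for \<zeta>
    using tendsto_diff[OF K3[OF that] G3[OF that]] by simp
  have decay: "\<exists>r<1. \<forall>z. norm z > r \<longrightarrow> norm (U z) \<le> \<delta>" if "\<delta> > 0" for \<delta>
    unfolding U_def by (rule uniform_boundary_decay[OF lim that])
  have loc: "set_integrable lebesgue S (\<lambda>z. K z w - G z w)" if "compact S" "S \<subseteq> \<D>" for S
    using K1 G1 that unfolding L1_loc_def by (intro set_integral_diff) auto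
  obtain r where "r < 1" "\<And>z. norm z > r \<Longrightarrow> norm (U z) \<le> 1"
    using decay[OF zero_less_one] by blast
  then have intU: "integrable lebesgue U"
    unfolding U_def by (intro L1_loc_decay_integrable[OF loc])
  have U0: "U z = 0" if "z \<notin> \<D>" for z using that by (simp add: U_def)
  \<comment> \<open>Both kernels reproduce the value of the same test function at \<open>w\<close>,
    so the Dirac terms cancel in the difference.\<close>
  have ann: "(\<integral>z. U z * L_bar \<alpha> (radial_monomial m n (\<lambda>x. x powr (\<alpha> + 1) * X x)) z \<partial>lebesgue) = 0"
    if X: "smooth X" "\<And>x. x < e \<Longrightarrow> X x = 0" "e > 0" for m n X e
    unfolding U_def
  proof (rule distr_of_diff[OF K1 G1 compact_norm_square_le norm_square_le_subset_disc[OF X(3)]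
        L_bar_radial_monomial_support(1)[OF X] L_bar_radial_monomial_support(2)[OF X]])
    have zero: "x powr (\<alpha> + 1) * X x = 0" if "x < e" for x
      using X(2)[OF that] by simp
    have "radial_monomial m n (\<lambda>x. x powr (\<alpha> + 1) * X x) \<in> test_fun"
      by (rule radial_monomial_test_fun[OF smooth_powr_mult[OF X] zero X(3)])
    then show "distr_of (\<lambda>z. K z w) (L_bar \<alpha> (radial_monomial m n (\<lambda>x. x powr (\<alpha> + 1) * X x)))
        = distr_of (\<lambda>z. G z w) (L_bar \<alpha> (radial_monomial m n (\<lambda>x. x powr (\<alpha> + 1) * X x)))"
      using K2 G2 by (simp add: distr_eq_def L_op_def)
  qed
  interpret vanishing_moments U
  proof
    show "(\<integral>z. U z * (z ^ m * cnj z ^ n) \<partial>lebesgue) = 0" for m n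
      by (rule moments_vanish[OF \<alpha> L_bar_annihilator_moments[OF intU U0 decay ann]])
  qed (use intU U0 in auto)
  from AE_zero show ?thesis
    by eventually_elim (auto simp: U_def)
qed

theorem theorem1:
  fixes \<alpha> :: real
  assumes "\<alpha> > -1"
  shows "(\<forall>s\<in>{0..<1}. set_integrable lborel {0..s} (\<lambda>t. t powr \<alpha> / (1 - t)) \<and>
            (\<lambda>n. s powr (\<alpha> + 1 + real n) / (\<alpha> + 1 + real n)) sums h_fun \<alpha> s) \<and>
         (\<forall>z\<in>\<D>. \<forall>w\<in>\<D>. g_fun z w =
            (1 - (norm z)\<^sup>2) * (1 - (norm w)\<^sup>2) / (norm (1 - z * cnj w))\<^sup>2) \<and>
         is_Green_function \<alpha> (G_fun \<alpha>) \<and>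
         (\<forall>K. is_Green_function \<alpha> K \<longrightarrow>
            (\<forall>w\<in>\<D>. AE z in lebesgue. z \<in> \<D> \<longrightarrow> K z w = G_fun \<alpha> z w))"
  using h_fun_series[OF assms] g_fun_eq G_fun_is_Green_function[OF assms]
    Green_function_unique[OF assms _ G_fun_is_Green_function[OF assms]]
  by (intro conjI ballI allI impI) auto

end
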